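(* Let $(M,g,J)$, $\dim M=2n\ge4$, be a (connected) Bochner-Kähler manifold. Then the function $$\|\rho\|^2-\frac{\tau^2}{2(n+1)}+\frac{\Delta\tau}{n+1}$$ is a constant.
   Context: $(M,g,J)$ is Kähler of real dimension $2n$ with Levi-Civita connection $\nabla$; $R(X,Y)Z=\nabla_X\nabla_YZ-\nabla_Y\nabla_XZ-\nabla_{[X,Y]}Z$, $R(X,Y,Z,U)=g(R(X,Y)Z,U)$, $\rho(Y,Z)=\sum_iR(e_i,Y,Z,e_i)$, $\tau=\sum_i\rho(e_i,e_i)$, $\|\rho\|^2=\sum_{i,j}\rho(e_i,e_j)^2$ for an orthonormal basis $e_1,\dots,e_{2n}$ of $T_mM$; $\Delta\tau=\sum_i(\nabla d\tau)(e_i,e_i)$. In a complex basis $Z_\alpha$ of $T^{1,0}M$ (with $Z_{\bar\alpha}=\overline{Z_\alpha}$), Bochner-Kähler means $$R_{\alpha\bar\beta\gamma\bar\delta}=\frac1{n+2}(g_{\alpha\bar\beta}\rho_{\gamma\bar\delta}+g_{\gamma\bar\beta}\rho_{\alpha\bar\delta}+g_{\gamma\bar\delta}\rho_{\alpha\bar\beta}+g_{\alpha\bar\delta}\rho_{\gamma\bar\beta})-\frac{\tau}{2(n+1)(n+2)}(g_{\alpha\bar\beta}g_{\gamma\bar\delta}+g_{\gamma\bar\beta}g_{\alpha\bar\delta}).$$ *)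

theory Defs
  imports "HOL-Analysis.Analysis"
begin

section \<open>Smooth maps between normed spaces\<close>

text \<open>\<open>Ck_on k S f\<close>: \<open>f\<close> is of class \<open>C\<^sup>k\<close> on the open set \<open>S\<close>, by recursion on directional
  derivatives; meant for finite-dimensional domains only.\<close>

primrec Ck_on ::
  "nat \<Rightarrow> 'v::real_normed_vector set \<Rightarrow> ('v \<Rightarrow> 'w::real_normed_vector) \<Rightarrow> bool" where
  "Ck_on 0 S f \<longleftrightarrow> continuous_on S f"
| "Ck_on (Suc k) S f \<longleftrightarrow>
     f differentiable_on S \<and> (\<forall>v. Ck_on k S (\<lambda>x. frechet_derivative f (at x) v))"

definition smooth_on :: "'v::real_normed_vector set \<Rightarrow> ('v \<Rightarrow> 'w::real_normed_vector) \<Rightarrow> bool" where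
  "smooth_on S f \<longleftrightarrow> (\<forall>k. Ck_on k S f)"


section \<open>Smooth manifolds\<close>

text \<open>A chart is a pair of its domain and its coordinate map; the coordinate map is irrelevant
  outside the domain. The model space is \<open>real^'m\<close>, so the dimension is \<open>CARD('m)\<close>.\<close>

type_synonym ('a, 'm) chart = "'a set \<times> ('a \<Rightarrow> (real, 'm) vec)"

abbreviation chart_inv :: "('a, 'm::finite) chart \<Rightarrow> real^'m \<Rightarrow> 'a" where
  "chart_inv c \<equiv> inv_into (fst c) (snd c)"

definition chart_on :: "'a topology \<Rightarrow> ('a, 'm::finite) chart \<Rightarrow> bool" where
  "chart_on M c \<longleftrightarrow> openin M (fst c) \<and> open (snd c ` fst c) \<and>
     homeomorphic_map (subtopology M (fst c)) (top_of_set (snd c ` fst c)) (snd c)"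

definition smooth_atlas :: "'a topology \<Rightarrow> ('a, 'm::finite) chart set \<Rightarrow> bool" where
  "smooth_atlas M A \<longleftrightarrow> (\<forall>c\<in>A. chart_on M c) \<and> (\<Union>c\<in>A. fst c) = topspace M \<and>
     (\<forall>c\<in>A. \<forall>d\<in>A. smooth_on (snd c ` (fst c \<inter> fst d)) (snd d \<circ> chart_inv c))"

definition smooth_manifold :: "'a topology \<Rightarrow> ('a, 'm::finite) chart set \<Rightarrow> bool" where
  "smooth_manifold M A \<longleftrightarrow>
     Hausdorff_space M \<and> second_countable M \<and> smooth_atlas M A"

text \<open>One chart is singled out around every point \<open>p\<close>, and the tangent space at \<open>p\<close> is identified
  with \<open>real^'m\<close> through it: a vector \<open>v :: real^'m\<close> stands for the tangent vector at \<open>p\<close> whose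
  components in the chart \<open>chart_at A p\<close> are those of \<open>v\<close>. The components in any other chart are
  obtained from the derivative of the coordinate change (\<open>tangent_to_chart\<close>), and conversely
  (\<open>tangent_of_chart\<close>). A vector field is thus a function \<open>'a \<Rightarrow> real^'m\<close>, and no continuity of
  \<open>p \<mapsto> chart_at A p\<close> is implied: smoothness is always tested in a fixed chart.\<close>

definition chart_at :: "('a, 'm::finite) chart set \<Rightarrow> 'a \<Rightarrow> ('a, 'm) chart" where
  "chart_at A p = (SOME c. c \<in> A \<and> p \<in> fst c)"

definition tangent_to_chart ::
  "('a, 'm::finite) chart set \<Rightarrow> ('a, 'm) chart \<Rightarrow> 'a \<Rightarrow> real^'m \<Rightarrow> real^'m" where
  "tangent_to_chart A c p =
     frechet_derivative (snd c \<circ> chart_inv (chart_at A p)) (at (snd (chart_at A p) p))"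

definition tangent_of_chart ::
  "('a, 'm::finite) chart set \<Rightarrow> ('a, 'm) chart \<Rightarrow> 'a \<Rightarrow> real^'m \<Rightarrow> real^'m" where
  "tangent_of_chart A c p =
     frechet_derivative (snd (chart_at A p) \<circ> chart_inv c) (at (snd c p))"

definition smooth_fun :: "('a, 'm::finite) chart set \<Rightarrow> 'a set \<Rightarrow> ('a \<Rightarrow> real) \<Rightarrow> bool" where
  "smooth_fun A U f \<longleftrightarrow> (\<forall>c\<in>A. smooth_on (snd c ` (fst c \<inter> U)) (f \<circ> chart_inv c))"

definition field_in_chart ::
  "('a, 'm::finite) chart set \<Rightarrow> ('a, 'm) chart \<Rightarrow> ('a \<Rightarrow> real^'m) \<Rightarrow> real^'m \<Rightarrow> real^'m" where
  "field_in_chart A c X = (\<lambda>x. tangent_to_chart A c (chart_inv c x) (X (chart_inv c x)))"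

definition smooth_field :: "('a, 'm::finite) chart set \<Rightarrow> 'a set \<Rightarrow> ('a \<Rightarrow> real^'m) \<Rightarrow> bool" where
  "smooth_field A U X \<longleftrightarrow> (\<forall>c\<in>A. smooth_on (snd c ` (fst c \<inter> U)) (field_in_chart A c X))"

definition differential ::
  "('a, 'm::finite) chart set \<Rightarrow> ('a \<Rightarrow> real) \<Rightarrow> 'a \<Rightarrow> real^'m \<Rightarrow> real" where
  "differential A f p = frechet_derivative (f \<circ> chart_inv (chart_at A p)) (at (snd (chart_at A p) p))"

definition lie_bracket ::
  "('a, 'm::finite) chart set \<Rightarrow> ('a \<Rightarrow> real^'m) \<Rightarrow> ('a \<Rightarrow> real^'m) \<Rightarrow> 'a \<Rightarrow> real^'m" where
  "lie_bracket A X Y p =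
     (let c = chart_at A p in
        frechet_derivative (field_in_chart A c Y) (at (snd c p)) (X p) -
        frechet_derivative (field_in_chart A c X) (at (snd c p)) (Y p))"

text \<open>An extension of the tangent vector \<open>v\<close> at \<open>p\<close> to a smooth vector field near \<open>p\<close>, namely the
  one with constant components in the chart singled out at \<open>p\<close>. It is only used to evaluate
  tensorial expressions, which do not depend on the choice of the extension.\<close>

definition extend :: "('a, 'm::finite) chart set \<Rightarrow> 'a \<Rightarrow> real^'m \<Rightarrow> 'a \<Rightarrow> real^'m" where
  "extend A p v = (\<lambda>q. tangent_of_chart A (chart_at A p) q v)"


section \<open>Riemannian and Kaehler structures\<close>

definition riemannian_metric ::
  "'a topology \<Rightarrow> ('a, 'm::finite) chart set \<Rightarrow> ('a \<Rightarrow> real^'m \<Rightarrow> real^'m \<Rightarrow> real) \<Rightarrow> bool" where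
  "riemannian_metric M A g \<longleftrightarrow>
     (\<forall>p\<in>topspace M. bilinear (g p) \<and> (\<forall>u v. g p u v = g p v u) \<and> (\<forall>v. v \<noteq> 0 \<longrightarrow> 0 < g p v v)) \<and>
     (\<forall>U X Y. openin M U \<and> smooth_field A U X \<and> smooth_field A U Y \<longrightarrow>
        smooth_fun A U (\<lambda>p. g p (X p) (Y p)))"

text \<open>A connection \<open>nab X Y = \<nabla>\<^sub>X Y\<close> acts on vector fields that are smooth on an arbitrary open
  set \<open>U\<close>, and on \<open>U\<close> the result depends on the restrictions to \<open>U\<close> only. Nothing is required of
  the values outside \<open>U\<close> or for non-smooth arguments.\<close>

definition affine_connection ::
  "'a topology \<Rightarrow> ('a, 'm::finite) chart set \<Rightarrow>
    (('a \<Rightarrow> real^'m) \<Rightarrow> ('a \<Rightarrow> real^'m) \<Rightarrow> 'a \<Rightarrow> real^'m) \<Rightarrow> bool" where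
  "affine_connection M A nab \<longleftrightarrow>
     (\<forall>U X Y. openin M U \<and> smooth_field A U X \<and> smooth_field A U Y \<longrightarrow>
        smooth_field A U (nab X Y) \<and>
        (\<forall>X' Y'. smooth_field A U X' \<and> smooth_field A U Y' \<longrightarrow>
           (\<forall>p\<in>U. nab (\<lambda>q. X q + X' q) Y p = nab X Y p + nab X' Y p \<and>
                  nab X (\<lambda>q. Y q + Y' q) p = nab X Y p + nab X Y' p) \<and>
           ((\<forall>p\<in>U. X p = X' p \<and> Y p = Y' p) \<longrightarrow> (\<forall>p\<in>U. nab X Y p = nab X' Y' p))) \<and>
        (\<forall>f. smooth_fun A U f \<longrightarrow>
           (\<forall>p\<in>U. nab (\<lambda>q. f q *\<^sub>R X q) Y p = f p *\<^sub>R nab X Y p \<and>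
                  nab X (\<lambda>q. f q *\<^sub>R Y q) p = differential A f p (X p) *\<^sub>R Y p + f p *\<^sub>R nab X Y p)))"

definition levi_civita ::
  "'a topology \<Rightarrow> ('a, 'm::finite) chart set \<Rightarrow> ('a \<Rightarrow> real^'m \<Rightarrow> real^'m \<Rightarrow> real) \<Rightarrow>
    (('a \<Rightarrow> real^'m) \<Rightarrow> ('a \<Rightarrow> real^'m) \<Rightarrow> 'a \<Rightarrow> real^'m) \<Rightarrow> bool" where
  "levi_civita M A g nab \<longleftrightarrow> affine_connection M A nab \<and>
     (\<forall>U X Y. openin M U \<and> smooth_field A U X \<and> smooth_field A U Y \<longrightarrow>
        (\<forall>p\<in>U. nab X Y p - nab Y X p = lie_bracket A X Y p)) \<and>
     (\<forall>U X Y Z. openin M U \<and> smooth_field A U X \<and> smooth_field A U Y \<and> smooth_field A U Z \<longrightarrow>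
        (\<forall>p\<in>U. differential A (\<lambda>q. g q (Y q) (Z q)) p (X p) =
               g p (nab X Y p) (Z p) + g p (Y p) (nab X Z p)))"

definition almost_complex_structure ::
  "'a topology \<Rightarrow> ('a, 'm::finite) chart set \<Rightarrow> ('a \<Rightarrow> real^'m \<Rightarrow> real^'m) \<Rightarrow> bool" where
  "almost_complex_structure M A J \<longleftrightarrow>
     (\<forall>p\<in>topspace M. linear (J p) \<and> (\<forall>v. J p (J p v) = - v)) \<and>
     (\<forall>U X. openin M U \<and> smooth_field A U X \<longrightarrow> smooth_field A U (\<lambda>p. J p (X p)))"

definition parallel_endomorphism ::
  "'a topology \<Rightarrow> ('a, 'm::finite) chart set \<Rightarrow>
    (('a \<Rightarrow> real^'m) \<Rightarrow> ('a \<Rightarrow> real^'m) \<Rightarrow> 'a \<Rightarrow> real^'m) \<Rightarrow> ('a \<Rightarrow> real^'m \<Rightarrow> real^'m) \<Rightarrow> bool" where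
  "parallel_endomorphism M A nab J \<longleftrightarrow>
     (\<forall>U X Y. openin M U \<and> smooth_field A U X \<and> smooth_field A U Y \<longrightarrow>
        (\<forall>p\<in>U. nab X (\<lambda>q. J q (Y q)) p = J p (nab X Y p)))"

text \<open>The Levi-Civita connection \<open>nab\<close>, which is unique on smooth vector fields, is carried along
  as part of the data.\<close>

definition kaehler_manifold ::
  "'a topology \<Rightarrow> ('a, 'm::finite) chart set \<Rightarrow> ('a \<Rightarrow> real^'m \<Rightarrow> real^'m \<Rightarrow> real) \<Rightarrow>
    ('a \<Rightarrow> real^'m \<Rightarrow> real^'m) \<Rightarrow>
    (('a \<Rightarrow> real^'m) \<Rightarrow> ('a \<Rightarrow> real^'m) \<Rightarrow> 'a \<Rightarrow> real^'m) \<Rightarrow> bool" where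
  "kaehler_manifold M A g J nab \<longleftrightarrow>
     smooth_manifold M A \<and> riemannian_metric M A g \<and> almost_complex_structure M A J \<and>
     (\<forall>p\<in>topspace M. \<forall>u v. g p (J p u) (J p v) = g p u v) \<and>
     levi_civita M A g nab \<and> parallel_endomorphism M A nab J"


section \<open>Curvature\<close>

definition curvature_field ::
  "('a, 'm::finite) chart set \<Rightarrow> (('a \<Rightarrow> real^'m) \<Rightarrow> ('a \<Rightarrow> real^'m) \<Rightarrow> 'a \<Rightarrow> real^'m) \<Rightarrow>
    ('a \<Rightarrow> real^'m) \<Rightarrow> ('a \<Rightarrow> real^'m) \<Rightarrow> ('a \<Rightarrow> real^'m) \<Rightarrow> 'a \<Rightarrow> real^'m" where
  "curvature_field A nab X Y Z p =
     nab X (nab Y Z) p - nab Y (nab X Z) p - nab (lie_bracket A X Y) Z p"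

definition curvature ::
  "('a, 'm::finite) chart set \<Rightarrow> ('a \<Rightarrow> real^'m \<Rightarrow> real^'m \<Rightarrow> real) \<Rightarrow>
    (('a \<Rightarrow> real^'m) \<Rightarrow> ('a \<Rightarrow> real^'m) \<Rightarrow> 'a \<Rightarrow> real^'m) \<Rightarrow>
    'a \<Rightarrow> real^'m \<Rightarrow> real^'m \<Rightarrow> real^'m \<Rightarrow> real^'m \<Rightarrow> real" where
  "curvature A g nab p x y z u =
     g p (curvature_field A nab (extend A p x) (extend A p y) (extend A p z) p) u"

text \<open>An orthonormal family indexed by \<open>'m\<close> is a basis, since \<open>CARD('m)\<close> is the dimension.\<close>

definition orthonormal_frame ::
  "(real^'m \<Rightarrow> real^'m \<Rightarrow> real) \<Rightarrow> ('m::finite \<Rightarrow> real^'m) \<Rightarrow> bool" where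
  "orthonormal_frame h e \<longleftrightarrow> (\<forall>i j. h (e i) (e j) = (if i = j then 1 else 0))"

definition some_frame :: "(real^'m \<Rightarrow> real^'m \<Rightarrow> real) \<Rightarrow> 'm::finite \<Rightarrow> real^'m" where
  "some_frame h = (SOME e. orthonormal_frame h e)"

definition ricci ::
  "('a, 'm::finite) chart set \<Rightarrow> ('a \<Rightarrow> real^'m \<Rightarrow> real^'m \<Rightarrow> real) \<Rightarrow>
    (('a \<Rightarrow> real^'m) \<Rightarrow> ('a \<Rightarrow> real^'m) \<Rightarrow> 'a \<Rightarrow> real^'m) \<Rightarrow> 'a \<Rightarrow> real^'m \<Rightarrow> real^'m \<Rightarrow> real" where
  "ricci A g nab p y z =
     (let e = some_frame (g p) in \<Sum>i\<in>UNIV. curvature A g nab p (e i) y z (e i))"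

definition scalar_curvature ::
  "('a, 'm::finite) chart set \<Rightarrow> ('a \<Rightarrow> real^'m \<Rightarrow> real^'m \<Rightarrow> real) \<Rightarrow>
    (('a \<Rightarrow> real^'m) \<Rightarrow> ('a \<Rightarrow> real^'m) \<Rightarrow> 'a \<Rightarrow> real^'m) \<Rightarrow> 'a \<Rightarrow> real" where
  "scalar_curvature A g nab p =
     (let e = some_frame (g p) in \<Sum>i\<in>UNIV. ricci A g nab p (e i) (e i))"

definition ricci_norm_squared ::
  "('a, 'm::finite) chart set \<Rightarrow> ('a \<Rightarrow> real^'m \<Rightarrow> real^'m \<Rightarrow> real) \<Rightarrow>
    (('a \<Rightarrow> real^'m) \<Rightarrow> ('a \<Rightarrow> real^'m) \<Rightarrow> 'a \<Rightarrow> real^'m) \<Rightarrow> 'a \<Rightarrow> real" where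
  "ricci_norm_squared A g nab p =
     (let e = some_frame (g p) in \<Sum>i\<in>UNIV. \<Sum>j\<in>UNIV. (ricci A g nab p (e i) (e j))\<^sup>2)"

text \<open>\<open>(\<nabla>\<omega>)(x, y) = x(\<omega>(Y)) - \<omega>(\<nabla>\<^sub>x Y)\<close> for a one-form \<open>\<omega>\<close>, with \<open>Y\<close> extending \<open>y\<close>.\<close>

definition covariant_derivative ::
  "('a, 'm::finite) chart set \<Rightarrow> (('a \<Rightarrow> real^'m) \<Rightarrow> ('a \<Rightarrow> real^'m) \<Rightarrow> 'a \<Rightarrow> real^'m) \<Rightarrow>
    ('a \<Rightarrow> real^'m \<Rightarrow> real) \<Rightarrow> 'a \<Rightarrow> real^'m \<Rightarrow> real^'m \<Rightarrow> real" where
  "covariant_derivative A nab \<omega> p x y =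
     differential A (\<lambda>q. \<omega> q (extend A p y q)) p x - \<omega> p (nab (extend A p x) (extend A p y) p)"

definition laplacian ::
  "('a, 'm::finite) chart set \<Rightarrow> ('a \<Rightarrow> real^'m \<Rightarrow> real^'m \<Rightarrow> real) \<Rightarrow>
    (('a \<Rightarrow> real^'m) \<Rightarrow> ('a \<Rightarrow> real^'m) \<Rightarrow> 'a \<Rightarrow> real^'m) \<Rightarrow> ('a \<Rightarrow> real) \<Rightarrow> 'a \<Rightarrow> real" where
  "laplacian A g nab f p =
     (let e = some_frame (g p)
      in \<Sum>i\<in>UNIV. covariant_derivative A nab (differential A f) p (e i) (e i))"


section \<open>The complexified tangent space and Bochner-Kaehler manifolds\<close>

text \<open>The complexification of the tangent space \<open>real^'m\<close> is \<open>complex^'m\<close>; tensors are extended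
  complex-multilinearly, slot by slot.\<close>

definition Re_vec :: "complex^'m \<Rightarrow> real^'m::finite" where
  "Re_vec Z = (\<chi> i. Re (Z $ i))"

definition Im_vec :: "complex^'m \<Rightarrow> real^'m::finite" where
  "Im_vec Z = (\<chi> i. Im (Z $ i))"

definition cnj_vec :: "complex^'m \<Rightarrow> complex^'m::finite" where
  "cnj_vec Z = (\<chi> i. cnj (Z $ i))"

definition cext :: "(real^'m::finite \<Rightarrow> complex) \<Rightarrow> complex^'m \<Rightarrow> complex" where
  "cext f Z = f (Re_vec Z) + \<i> * f (Im_vec Z)"

definition cext2 :: "(real^'m::finite \<Rightarrow> real^'m \<Rightarrow> real) \<Rightarrow> complex^'m \<Rightarrow> complex^'m \<Rightarrow> complex" where
  "cext2 b Z W = cext (\<lambda>u. cext (\<lambda>v. complex_of_real (b u v)) W) Z"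

definition cext4 ::
  "(real^'m::finite \<Rightarrow> real^'m \<Rightarrow> real^'m \<Rightarrow> real^'m \<Rightarrow> real) \<Rightarrow>
    complex^'m \<Rightarrow> complex^'m \<Rightarrow> complex^'m \<Rightarrow> complex^'m \<Rightarrow> complex" where
  "cext4 r Z\<^sub>1 Z\<^sub>2 Z\<^sub>3 Z\<^sub>4 =
     cext (\<lambda>x. cext (\<lambda>y. cext (\<lambda>z. cext (\<lambda>u. complex_of_real (r x y z u)) Z\<^sub>4) Z\<^sub>3) Z\<^sub>2) Z\<^sub>1"

definition cext_endo :: "(real^'m::finite \<Rightarrow> real^'m) \<Rightarrow> complex^'m \<Rightarrow> complex^'m" where
  "cext_endo j Z = (\<chi> i. Complex (j (Re_vec Z) $ i) (j (Im_vec Z) $ i))"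

definition holomorphic_tangent_space :: "(real^'m::finite \<Rightarrow> real^'m) \<Rightarrow> (complex^'m) set" where
  "holomorphic_tangent_space j = {Z. cext_endo j Z = \<i> *s Z}"

definition complex_basis :: "(real^'m::finite \<Rightarrow> real^'m) \<Rightarrow> (complex^'m) set \<Rightarrow> bool" where
  "complex_basis j B \<longleftrightarrow> vec.independent B \<and> vec.span B = holomorphic_tangent_space j"

text \<open>The indices \<open>\<alpha>, \<beta>, \<gamma>, \<delta>\<close> are the elements of the complex basis \<open>B\<close> themselves. By
  multilinearity the condition holds in one complex basis iff it holds in every one.\<close>

definition bochner_kaehler ::
  "'a topology \<Rightarrow> ('a, 'm::finite) chart set \<Rightarrow> ('a \<Rightarrow> real^'m \<Rightarrow> real^'m \<Rightarrow> real) \<Rightarrow>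
    ('a \<Rightarrow> real^'m \<Rightarrow> real^'m) \<Rightarrow>
    (('a \<Rightarrow> real^'m) \<Rightarrow> ('a \<Rightarrow> real^'m) \<Rightarrow> 'a \<Rightarrow> real^'m) \<Rightarrow> nat \<Rightarrow> bool" where
  "bochner_kaehler M A g J nab n \<longleftrightarrow>
     kaehler_manifold M A g J nab \<and>
     (\<forall>p\<in>topspace M. \<exists>B. complex_basis (J p) B \<and>
        (\<forall>\<alpha>\<in>B. \<forall>\<beta>\<in>B. \<forall>\<gamma>\<in>B. \<forall>\<delta>\<in>B.
           let G = (\<lambda>Z W. cext2 (g p) Z (cnj_vec W));
               Rho = (\<lambda>Z W. cext2 (ricci A g nab p) Z (cnj_vec W));
               \<tau> = complex_of_real (scalar_curvature A g nab p)
           in cext4 (curvature A g nab p) \<alpha> (cnj_vec \<beta>) \<gamma> (cnj_vec \<delta>) =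
              1 / (of_nat n + 2) *
                (G \<alpha> \<beta> * Rho \<gamma> \<delta> + G \<gamma> \<beta> * Rho \<alpha> \<delta> + G \<gamma> \<delta> * Rho \<alpha> \<beta> + G \<alpha> \<delta> * Rho \<gamma> \<beta>)
              - \<tau> / (2 * (of_nat n + 1) * (of_nat n + 2)) *
                (G \<alpha> \<beta> * G \<gamma> \<delta> + G \<gamma> \<beta> * G \<alpha> \<delta>)))"

end

theory Submission
  imports Defs
begin

text \<open>Everything is computed in the domain of one chart. There the real part of the Bochner-Kaehler
  condition, together with the second Bianchi identity, expresses \<open>\<nabla>\<rho>\<close> through \<open>d\<tau>\<close>:
  \<open>4(n+1) (\<nabla>\<^sub>w\<rho>)(y,z) = 2 g(y,z) d\<tau>(w) + g(w,y) d\<tau>(z) + g(w,z) d\<tau>(y) + g(w,Jy) d\<tau>(Jz) + g(w,Jz) d\<tau>(Jy)\<close>.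
  Hence \<open>d|\<rho>|\<^sup>2 = (\<tau> d\<tau> + 2 \<rho>(\<cdot>, grad \<tau>)) / (n+1)\<close>. Commuting two covariant derivatives of \<open>\<rho>\<close> shows
  that \<open>\<nabla>d\<tau>\<close> is \<open>J\<close>-invariant, and commuting two covariant derivatives of \<open>d\<tau>\<close> then yields
  \<open>d\<Delta>\<tau> = -2 \<rho>(\<cdot>, grad \<tau>)\<close>. So the differential of the function in question vanishes.\<close>

section \<open>Directional derivatives of smooth maps\<close>

text \<open>Two choices in the definitions are not smooth: \<open>chart_at\<close> may jump from
  point to point, and \<open>some_frame\<close> picks an unrelated frame at each point. So
  everything is moved to one fixed chart, and traces are differentiated through the inverse metric,
  whose components are smooth although the frames need not be. Only R(a,b,c,d) - R(a,Jb,c,Jd) is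
  extracted from the Bochner condition. Its divergence suffices: it determines \<nabla>\<rho> plus a
  J-twisted copy, and symmetry and J-invariance of \<rho> remove the copy. The formula for
  d\<Delta>\<tau> comes from one difference evaluated twice. With D the divergence of
  \<nabla>d\<tau>, commuting derivatives gives d\<Delta>\<tau> - D = -\<rho>(., grad \<tau>), while
  J-invariance of \<nabla>d\<tau> gives d\<Delta>\<tau> - D = D. The bound n \<ge> 2 matters for
  that J-invariance, where a factor 2n - 2 is cancelled.\<close>

definition ddir :: "'v::real_normed_vector \<Rightarrow> ('v \<Rightarrow> 'w::real_normed_vector) \<Rightarrow> 'v \<Rightarrow> 'w" where
  "ddir v f x = frechet_derivative f (at x) v"

lemma Ck_on_Suc_ddir:
  "Ck_on (Suc k) S f \<longleftrightarrow> f differentiable_on S \<and> (\<forall>v. Ck_on k S (ddir v f))"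
  by (simp add: ddir_def[abs_def])

lemma has_derivative_ddir:
  "f differentiable (at x) \<Longrightarrow> (f has_derivative (\<lambda>v. ddir v f x)) (at x)"
  by (simp add: ddir_def frechet_derivative_works)

lemma ddir_eqI: "(f has_derivative f') (at x) \<Longrightarrow> ddir v f x = f' v"
  by (metis ddir_def frechet_derivative_at)

text \<open>No differentiability is assumed: where it fails for \<open>f\<close> it fails for
  \<open>g\<close>, and then both derivatives are the same default value, the \<open>SOME\<close>
  choice from an unsatisfiable predicate.\<close>

lemma ddir_transform:
  assumes "open S" "x \<in> S" "\<And>y. y \<in> S \<Longrightarrow> f y = g y"
  shows "ddir v f x = ddir v g x"
proof (cases "f differentiable (at x)")
  case True
  then show ?thesis
    unfolding ddir_def using frechet_derivative_transform_within_open[OF True assms] by simp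
next
  case False
  then have "\<not> g differentiable (at x)"
    using assms unfolding differentiable_def
    by (metis has_derivative_transform_within_open)
  then have "(f has_derivative h) (at x) \<longleftrightarrow> (g has_derivative h) (at x)" for h
    using False by (auto simp: differentiable_def)
  then show ?thesis by (simp add: ddir_def frechet_derivative_def)
qed

lemma Ck_on_cong:
  assumes "open S" "\<And>y. y \<in> S \<Longrightarrow> f y = g y" "Ck_on k S f"
  shows "Ck_on k S g"
  using assms(2,3)
proof (induction k arbitrary: f g)
  case 0
  then show ?case by (simp cong: continuous_on_cong)
next
  case (Suc k)
  have "g differentiable_on S"
    using Suc.prems unfolding differentiable_on_def
    by (metis Ck_on.simps(2) differentiable_on_def differentiable_transform_within zero_less_one)
  moreover have "Ck_on k S (ddir v g)" for v
    using Suc.IH[of "ddir v f" "ddir v g"] Suc.prems ddir_transform[OF assms(1), of _ f g v]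
    by (simp add: Ck_on_Suc_ddir del: Ck_on.simps)
  ultimately show ?case by (simp add: Ck_on_Suc_ddir del: Ck_on.simps)
qed

lemma Ck_on_SucD: "Ck_on (Suc k) S f \<Longrightarrow> Ck_on k S f"
proof (induction k arbitrary: f)
  case 0
  then show ?case by (simp add: differentiable_imp_continuous_on)
next
  case (Suc k)
  then show ?case by (metis Ck_on_Suc_ddir)
qed

lemma Ck_on_differentiable: 
  "\<lbrakk>open S; Ck_on (Suc k) S f; x \<in> S\<rbrakk> \<Longrightarrow> f differentiable (at x)"
  by (metis Ck_on_Suc_ddir at_within_open differentiable_on_def)

lemma Ck_on_has_derivative:
  "\<lbrakk>open S; Ck_on (Suc k) S f; x \<in> S\<rbrakk> \<Longrightarrow> (f has_derivative (\<lambda>v. ddir v f x)) (at x)"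
  using has_derivative_ddir Ck_on_differentiable by blast

lemma Ck_on_subset:
  "\<lbrakk>T \<subseteq> S; Ck_on k S f\<rbrakk> \<Longrightarrow> Ck_on k T f"
proof (induction k arbitrary: f)
  case 0
  then show ?case using continuous_on_subset by auto
next
  case (Suc k)
  then show ?case by (meson Ck_on_Suc_ddir differentiable_on_subset)
qed

lemma Ck_on_const: "Ck_on k S (\<lambda>x. c)"
proof (induction k arbitrary: c)
  case (Suc k)
  have "ddir v (\<lambda>x. c) = (\<lambda>x. 0)" for v :: 'a
    by (auto simp: ddir_def fun_eq_iff)
  then show ?case using Suc by (simp add: Ck_on_Suc_ddir del: Ck_on.simps(2))
qed simp

text \<open>Lets an explicit derivative formula stand in for \<open>ddir\<close>; the inductions on
  k that follow go through this rule.\<close>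

lemma Ck_on_Suc_I:
  assumes "open S" "\<And>x. x \<in> S \<Longrightarrow> (f has_derivative (\<lambda>v. f' v x)) (at x)" "\<And>v. Ck_on k S (f' v)"
  shows "Ck_on (Suc k) S f"
proof -
  have "f differentiable_on S"
    using assms(2) by (meson differentiable_at_imp_differentiable_on differentiableI)
  moreover have "Ck_on k S (ddir v f)" for v
    using Ck_on_cong[OF assms(1), of "f' v" "ddir v f"] assms(2,3) by (metis ddir_eqI)
  ultimately show ?thesis by (simp add: Ck_on_Suc_ddir del: Ck_on.simps)
qed

section \<open>Closure of C^k maps under algebraic operations and composition\<close>

lemma Ck_on_linear:
  assumes "bounded_linear h" "open S" "Ck_on k S f"
  shows "Ck_on k S (\<lambda>x. h (f x))"
  using assms(3)
proof (induction k arbitrary: f)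
  case 0
  then show ?case
    by (simp add: bounded_linear.continuous_on[OF assms(1)])
next
  case (Suc k)
  show ?case
  proof (rule Ck_on_Suc_I[OF assms(2)])
    show "((\<lambda>x. h (f x)) has_derivative (\<lambda>v. h (ddir v f x))) (at x)" if "x \<in> S" for x
      using has_derivative_ddir[OF Ck_on_differentiable[OF assms(2) Suc.prems that]]
      by (rule bounded_linear.has_derivative[OF assms(1)])
    show "Ck_on k S (\<lambda>x. h (ddir v f x))" for v
      using Suc by (simp add: Ck_on_Suc_ddir del: Ck_on.simps)
  qed
qed

lemma Ck_on_add:
  assumes "open S" "Ck_on k S f" "Ck_on k S g"
  shows "Ck_on k S (\<lambda>x. f x + g x)"
  using assms(2,3)
proof (induction k arbitrary: f g)
  case 0
  then show ?case by (simp add: continuous_on_add)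
next
  case (Suc k)
  show ?case
  proof (rule Ck_on_Suc_I[OF assms(1)])
    show "((\<lambda>x. f x + g x) has_derivative (\<lambda>v. ddir v f x + ddir v g x)) (at x)" if "x \<in> S" for x
      using Ck_on_has_derivative[OF assms(1) _ that] Suc.prems
      by (intro has_derivative_add) blast+
    show "Ck_on k S (\<lambda>x. ddir v f x + ddir v g x)" for v
      using Suc by (simp add: Ck_on_Suc_ddir del: Ck_on.simps)
  qed
qed

lemma Ck_on_bilinear:
  assumes "bounded_bilinear h" "open S" "Ck_on k S f" "Ck_on k S g"
  shows "Ck_on k S (\<lambda>x. h (f x) (g x))"
  using assms(3,4)
proof (induction k arbitrary: f g)
  case 0
  then show ?case
    by (simp add: bounded_bilinear.continuous_on[OF assms(1)])
next
  case (Suc k)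
  show ?case
  proof (rule Ck_on_Suc_I[OF assms(2)])
    show "((\<lambda>x. h (f x) (g x)) has_derivative (\<lambda>v. h (f x) (ddir v g x) + h (ddir v f x) (g x))) (at x)"
      if "x \<in> S" for x
      by (intro bounded_bilinear.FDERIV[OF assms(1)] Ck_on_has_derivative[OF assms(2) _ that]) (rule Suc.prems)+
    show "Ck_on k S (\<lambda>x. h (f x) (ddir v g x) + h (ddir v f x) (g x))" for v
      using Suc.prems Ck_on_SucD[OF Suc.prems(1)] Ck_on_SucD[OF Suc.prems(2)]
      by (intro Ck_on_add[OF assms(2)] Suc.IH) (simp_all add: Ck_on_Suc_ddir del: Ck_on.simps)
  qed
qed

lemma Ck_on_sum:
  assumes "open S" "\<And>i. i \<in> I \<Longrightarrow> Ck_on k S (f i)"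
  shows "Ck_on k S (\<lambda>x. \<Sum>i\<in>I. f i x)"
  using assms(2)
proof (induction I rule: infinite_finite_induct)
  case (insert i I)
  then show ?case using Ck_on_add[OF assms(1), of k "f i" "\<lambda>x. \<Sum>i\<in>I. f i x"] by simp
qed (auto intro: Ck_on_const)

text \<open>The chain rule differentiates \<open>f\<close> in the moving direction
  \<open>ddir v h x\<close>, to which the induction hypothesis does not apply. Expanding that
  direction in \<open>Basis\<close> leaves products of scalar functions with derivatives of
  \<open>f\<close> in fixed directions; hence the Euclidean domain of \<open>f\<close>.\<close>

lemma Ck_on_compose:
  fixes f :: "'v::euclidean_space \<Rightarrow> 'w::real_normed_vector"
    and h :: "'u::real_normed_vector \<Rightarrow> 'v"
  assumes "open S" "open T" "h ` S \<subseteq> T" "Ck_on k T f" "Ck_on k S h"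
  shows "Ck_on k S (\<lambda>x. f (h x))"
  using assms(4,5)
proof (induction k arbitrary: f)
  case 0
  then show ?case
    using assms(3) by (auto intro: continuous_on_compose2)
next
  case (Suc k)
  show ?case
  proof (rule Ck_on_Suc_I[OF assms(1)])
    fix x assume x: "x \<in> S"
    have fd: "(f has_derivative (\<lambda>v. ddir v f (h x))) (at (h x))"
      using x assms(3) Suc.prems by (intro has_derivative_ddir Ck_on_differentiable[OF assms(2)]) auto
    have hd: "(h has_derivative (\<lambda>v. ddir v h x)) (at x)"
      using x Suc.prems by (intro has_derivative_ddir Ck_on_differentiable[OF assms(1)]) auto
    have lin: "linear (\<lambda>v. ddir v f (h x))"
      using fd has_derivative_linear by blast
    have "((\<lambda>x. f (h x)) has_derivative (\<lambda>v. ddir (ddir v h x) f (h x))) (at x)"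
      using has_derivative_compose[OF hd fd] by simp
    moreover have "ddir (ddir v h x) f (h x) = (\<Sum>b\<in>Basis. (ddir v h x \<bullet> b) *\<^sub>R ddir b f (h x))" for v
    proof -
      have "ddir (\<Sum>b\<in>Basis. (ddir v h x \<bullet> b) *\<^sub>R b) f (h x)
          = (\<Sum>b\<in>Basis. (ddir v h x \<bullet> b) *\<^sub>R ddir b f (h x))"
        by (subst linear_sum[OF lin]) (simp add: linear_cmul[OF lin])
      then show ?thesis by (simp only: euclidean_representation)
    qed
    ultimately show "((\<lambda>x. f (h x)) has_derivative
        (\<lambda>v. \<Sum>b\<in>Basis. (ddir v h x \<bullet> b) *\<^sub>R ddir b f (h x))) (at x)" by simp
  next
    fix v
    have "Ck_on k S (\<lambda>x. ddir v h x \<bullet> b)" for b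
      using Suc.prems Ck_on_linear[OF bounded_linear_inner_left assms(1)]
      by (metis Ck_on_Suc_ddir)
    moreover have "Ck_on k S (\<lambda>x. ddir b f (h x))" for b
      using Suc Ck_on_SucD by (metis Ck_on_Suc_ddir)
    ultimately show "Ck_on k S (\<lambda>x. \<Sum>b\<in>Basis. (ddir v h x \<bullet> b) *\<^sub>R ddir b f (h x))"
      by (intro Ck_on_sum Ck_on_bilinear[OF bounded_bilinear_scaleR] assms(1)) auto
  qed
qed

lemma Ck_on_inverse:
  fixes f :: "'v::real_normed_vector \<Rightarrow> real"
  assumes "open S" "\<And>x. x \<in> S \<Longrightarrow> f x \<noteq> 0" "Ck_on k S f"
  shows "Ck_on k S (\<lambda>x. inverse (f x))"
  using assms(3)
proof (induction k)
  case 0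
  then show ?case using assms(2) by (simp add: continuous_on_inverse)
next
  case (Suc k)
  \<comment> \<open>The derivative -(1/f) f' (1/f) contains 1/f itself, so the induction hypothesis
    is needed for this very function one level down.\<close>
  have k: "Ck_on k S (\<lambda>x. inverse (f x))"
    using Suc Ck_on_SucD by blast
  show ?case
  proof (rule Ck_on_Suc_I[OF assms(1)])
    show "((\<lambda>x. inverse (f x)) has_derivative (\<lambda>v. (- 1) *\<^sub>R (inverse (f x) * ddir v f x * inverse (f x)))) (at x)"
      if "x \<in> S" for x
      using Deriv.has_derivative_inverse[OF assms(2)[OF that] has_derivative_ddir[OF Ck_on_differentiable[OF assms(1) Suc.prems that]]]
      by simp
    show "Ck_on k S (\<lambda>x. (- 1) *\<^sub>R (inverse (f x) * ddir v f x * inverse (f x)))" for v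
      using k Suc.prems Ck_on_Suc_ddir
      by (intro Ck_on_linear[OF bounded_linear_scaleR_right] Ck_on_bilinear[OF bounded_bilinear_mult] assms(1)) blast+
  qed
qed

section \<open>The same closure properties for smooth maps\<close>

lemma smooth_on_differentiable: "\<lbrakk>open S; smooth_on S f; x \<in> S\<rbrakk> \<Longrightarrow> f differentiable (at x)"
  using Ck_on_differentiable unfolding smooth_on_def by blast

lemma smooth_on_has_derivative:
  "\<lbrakk>open S; smooth_on S f; x \<in> S\<rbrakk> \<Longrightarrow> (f has_derivative (\<lambda>v. ddir v f x)) (at x)"
  using has_derivative_ddir smooth_on_differentiable by blast

lemma smooth_on_ddir: "smooth_on S f \<Longrightarrow> smooth_on S (ddir v f)"
  unfolding smooth_on_def using Ck_on_Suc_ddir by blast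

lemma smooth_on_cong:
  "\<lbrakk>open S; \<And>y. y \<in> S \<Longrightarrow> f y = g y; smooth_on S f\<rbrakk> \<Longrightarrow> smooth_on S g"
  unfolding smooth_on_def using Ck_on_cong by blast

lemma smooth_on_subset: "\<lbrakk>smooth_on S f; T \<subseteq> S\<rbrakk> \<Longrightarrow> smooth_on T f"
  unfolding smooth_on_def using Ck_on_subset by blast

lemma smooth_on_const: "smooth_on S (\<lambda>x. c)"
  unfolding smooth_on_def using Ck_on_const by blast

lemma smooth_on_linear:
  "\<lbrakk>bounded_linear h; open S; smooth_on S f\<rbrakk> \<Longrightarrow> smooth_on S (\<lambda>x. h (f x))"
  unfolding smooth_on_def using Ck_on_linear by blast

lemma smooth_on_add: "\<lbrakk>open S; smooth_on S f; smooth_on S g\<rbrakk> \<Longrightarrow> smooth_on S (\<lambda>x. f x + g x)"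
  unfolding smooth_on_def using Ck_on_add by blast

lemma smooth_on_minus: "\<lbrakk>open S; smooth_on S f\<rbrakk> \<Longrightarrow> smooth_on S (\<lambda>x. - f x)"
  using smooth_on_linear[OF bounded_linear_minus[OF bounded_linear_ident]] by blast

lemma smooth_on_diff: "\<lbrakk>open S; smooth_on S f; smooth_on S g\<rbrakk> \<Longrightarrow> smooth_on S (\<lambda>x. f x - g x)"
  using smooth_on_add[of S f "\<lambda>x. - g x"] smooth_on_minus[of S g] by simp

lemma smooth_on_scaleR:
  "\<lbrakk>open S; smooth_on S f; smooth_on S g\<rbrakk> \<Longrightarrow> smooth_on S (\<lambda>x. f x *\<^sub>R g x)"
  unfolding smooth_on_def using Ck_on_bilinear[OF bounded_bilinear_scaleR] by blast

lemma smooth_on_mult: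
  fixes f g :: "'v::real_normed_vector \<Rightarrow> real"
  shows "\<lbrakk>open S; smooth_on S f; smooth_on S g\<rbrakk> \<Longrightarrow> smooth_on S (\<lambda>x. f x * g x)"
  unfolding smooth_on_def using Ck_on_bilinear[OF bounded_bilinear_mult] by blast

lemma smooth_on_sum:
  "\<lbrakk>open S; \<And>i. i \<in> I \<Longrightarrow> smooth_on S (f i)\<rbrakk> \<Longrightarrow> smooth_on S (\<lambda>x. \<Sum>i\<in>I. f i x)"
  unfolding smooth_on_def using Ck_on_sum[of S I _ f] by blast

lemma smooth_on_prod:
  fixes f :: "'i \<Rightarrow> 'v::real_normed_vector \<Rightarrow> real"
  assumes "open S" "\<And>i. i \<in> I \<Longrightarrow> smooth_on S (f i)"
  shows "smooth_on S (\<lambda>x. \<Prod>i\<in>I. f i x)"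
  using assms(2)
proof (induction I rule: infinite_finite_induct)
  case (insert i I)
  then show ?case using smooth_on_mult[OF assms(1), of "f i" "\<lambda>x. \<Prod>i\<in>I. f i x"] by simp
qed (auto intro: smooth_on_const)

lemma smooth_on_inverse:
  fixes f :: "'v::real_normed_vector \<Rightarrow> real"
  shows "\<lbrakk>open S; smooth_on S f; \<And>x. x \<in> S \<Longrightarrow> f x \<noteq> 0\<rbrakk> \<Longrightarrow> smooth_on S (\<lambda>x. inverse (f x))"
  unfolding smooth_on_def using Ck_on_inverse by blast

lemma smooth_on_compose:
  fixes f :: "'v::euclidean_space \<Rightarrow> 'w::real_normed_vector"
    and h :: "'u::real_normed_vector \<Rightarrow> 'v"
  shows "\<lbrakk>open S; open T; h ` S \<subseteq> T; smooth_on T f; smooth_on S h\<rbrakk> \<Longrightarrow> smooth_on S (\<lambda>x. f (h x))"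
  unfolding smooth_on_def using Ck_on_compose by blast

lemma smooth_on_nth:
  "\<lbrakk>open S; smooth_on S f\<rbrakk> \<Longrightarrow> smooth_on S (\<lambda>x. f x $ i)"
  using smooth_on_linear[OF bounded_linear_vec_nth] by blast

section \<open>Calculus rules for directional derivatives\<close>

lemma linear_ddir: "f differentiable (at x) \<Longrightarrow> linear (\<lambda>v. ddir v f x)"
  using has_derivative_ddir has_derivative_linear by blast

lemma ddir_add:
  "\<lbrakk>f differentiable (at x); g differentiable (at x)\<rbrakk> \<Longrightarrow>
   ddir v (\<lambda>x. f x + g x) x = ddir v f x + ddir v g x"
  by (rule ddir_eqI[OF has_derivative_add[OF has_derivative_ddir has_derivative_ddir]])

lemma ddir_diff:
  "\<lbrakk>f differentiable (at x); g differentiable (at x)\<rbrakk> \<Longrightarrow>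
   ddir v (\<lambda>x. f x - g x) x = ddir v f x - ddir v g x"
  by (rule ddir_eqI[OF has_derivative_diff[OF has_derivative_ddir has_derivative_ddir]])

lemma ddir_linear:
  "\<lbrakk>bounded_linear h; f differentiable (at x)\<rbrakk> \<Longrightarrow> ddir v (\<lambda>x. h (f x)) x = h (ddir v f x)"
  by (rule ddir_eqI[OF bounded_linear.has_derivative[OF _ has_derivative_ddir]])

lemma ddir_scaleR:
  "\<lbrakk>f differentiable (at x); g differentiable (at x)\<rbrakk> \<Longrightarrow>
   ddir v (\<lambda>x. f x *\<^sub>R g x) x = f x *\<^sub>R ddir v g x + ddir v f x *\<^sub>R g x"
  by (rule ddir_eqI[OF has_derivative_scaleR[OF has_derivative_ddir has_derivative_ddir]])

lemma ddir_mult: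
  fixes f g :: "'v::real_normed_vector \<Rightarrow> real"
  shows "\<lbrakk>f differentiable (at x); g differentiable (at x)\<rbrakk> \<Longrightarrow>
   ddir v (\<lambda>x. f x * g x) x = f x * ddir v g x + ddir v f x * g x"
  by (rule ddir_eqI[OF has_derivative_mult[OF has_derivative_ddir has_derivative_ddir]])

lemma ddir_sum:
  "(\<And>i. i \<in> I \<Longrightarrow> f i differentiable (at x)) \<Longrightarrow>
   ddir v (\<lambda>x. \<Sum>i\<in>I. f i x) x = (\<Sum>i\<in>I. ddir v (f i) x)"
  by (rule ddir_eqI[OF has_derivative_sum[OF has_derivative_ddir]])

lemma ddir_const [simp]: "ddir v (\<lambda>x. c) x = 0"
  by (simp add: ddir_def)

lemma ddir_compose:
  assumes "h differentiable (at x)" "f differentiable (at (h x))"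
  shows "ddir v (\<lambda>x. f (h x)) x = ddir (ddir v h x) f (h x)"
  using ddir_eqI[OF has_derivative_compose[OF has_derivative_ddir[OF assms(1)] has_derivative_ddir[OF assms(2)]]] .

lemma ddir_nth: "f differentiable (at x) \<Longrightarrow> ddir v f x $ i = ddir v (\<lambda>x. f x $ i) x"
  by (simp add: ddir_linear[OF bounded_linear_vec_nth])

text \<open>Both mixed derivatives are limits of the same second difference quotient, by applying the
  mean value theorem twice.\<close>

lemma second_difference_mean_value:
  fixes f :: "'v::real_normed_vector \<Rightarrow> real"
  assumes S: "open S" and f: "smooth_on S f" and h: "0 < h"
    and seg: "\<And>a b. \<lbrakk>0 \<le> a; a \<le> h; 0 \<le> b; b \<le> h\<rbrakk> \<Longrightarrow> x + a *\<^sub>R u + b *\<^sub>R v \<in> S"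
  shows "\<exists>a b. 0 \<le> a \<and> a \<le> h \<and> 0 \<le> b \<and> b \<le> h \<and>
    f (x + h *\<^sub>R u + h *\<^sub>R v) - f (x + h *\<^sub>R u) - f (x + h *\<^sub>R v) + f x
      = h * h * ddir v (ddir u f) (x + a *\<^sub>R u + b *\<^sub>R v)"
proof -
  have d1: "((\<lambda>a. f (x + a *\<^sub>R u + b *\<^sub>R v)) has_real_derivative ddir u f (x + a *\<^sub>R u + b *\<^sub>R v)) (at a)"
    if "0 \<le> a" "a \<le> h" "0 \<le> b" "b \<le> h" for a b
  proof -
    have "((\<lambda>a. x + a *\<^sub>R u + b *\<^sub>R v) has_derivative (\<lambda>t. t *\<^sub>R u)) (at a)"
      by (auto intro!: derivative_eq_intros)
    from has_derivative_compose[OF this smooth_on_has_derivative[OF S f seg[OF that]]]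
    have "((\<lambda>a. f (x + a *\<^sub>R u + b *\<^sub>R v)) has_derivative (\<lambda>t. ddir (t *\<^sub>R u) f (x + a *\<^sub>R u + b *\<^sub>R v))) (at a)" .
    moreover have "ddir (t *\<^sub>R u) f (x + a *\<^sub>R u + b *\<^sub>R v) = ddir u f (x + a *\<^sub>R u + b *\<^sub>R v) * t" for t
      using linear_cmul[OF linear_ddir[OF smooth_on_differentiable[OF S f seg[OF that]]]] by simp
    ultimately show ?thesis by (simp add: has_field_derivative_def)
  qed
  have d2: "((\<lambda>b. ddir u f (x + a *\<^sub>R u + b *\<^sub>R v)) has_real_derivative ddir v (ddir u f) (x + a *\<^sub>R u + b *\<^sub>R v)) (at b)"
    if "0 \<le> a" "a \<le> h" "0 \<le> b" "b \<le> h" for a b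
  proof -
    have f': "smooth_on S (ddir u f)" using f by (rule smooth_on_ddir)
    have "((\<lambda>b. x + a *\<^sub>R u + b *\<^sub>R v) has_derivative (\<lambda>t. t *\<^sub>R v)) (at b)"
      by (auto intro!: derivative_eq_intros)
    from has_derivative_compose[OF this smooth_on_has_derivative[OF S f' seg[OF that]]]
    have "((\<lambda>b. ddir u f (x + a *\<^sub>R u + b *\<^sub>R v)) has_derivative (\<lambda>t. ddir (t *\<^sub>R v) (ddir u f) (x + a *\<^sub>R u + b *\<^sub>R v))) (at b)" .
    moreover have "ddir (t *\<^sub>R v) (ddir u f) (x + a *\<^sub>R u + b *\<^sub>R v) = ddir v (ddir u f) (x + a *\<^sub>R u + b *\<^sub>R v) * t" for t
      using linear_cmul[OF linear_ddir[OF smooth_on_differentiable[OF S f' seg[OF that]]]] by simp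
    ultimately show ?thesis by (simp add: has_field_derivative_def)
  qed
  \<comment> \<open>The increment over a step \<open>h\<close> in direction \<open>v\<close>. The
    second difference is the increment of \<phi> over a step \<open>h\<close> in direction
    \<open>u\<close>, which is what the first mean value theorem sees.\<close>
  define \<phi> where "\<phi> a = f (x + a *\<^sub>R u + h *\<^sub>R v) - f (x + a *\<^sub>R u + 0 *\<^sub>R v)" for a
  have "\<exists>a. 0 < a \<and> a < h \<and> \<phi> h - \<phi> 0 = (h - 0) *
      (ddir u f (x + a *\<^sub>R u + h *\<^sub>R v) - ddir u f (x + a *\<^sub>R u + 0 *\<^sub>R v))"
  proof (rule MVT2[OF h])
    fix a assume "0 \<le> a" "a \<le> h"
    then show "(\<phi> has_real_derivative
        ddir u f (x + a *\<^sub>R u + h *\<^sub>R v) - ddir u f (x + a *\<^sub>R u + 0 *\<^sub>R v)) (at a)"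
      unfolding \<phi>_def using h d1[of a h] d1[of a 0] by (intro DERIV_diff) auto
  qed
  then obtain a where a: "0 < a" "a < h" and
    e1: "\<phi> h - \<phi> 0 = h * (ddir u f (x + a *\<^sub>R u + h *\<^sub>R v) - ddir u f (x + a *\<^sub>R u + 0 *\<^sub>R v))" by auto
  have "\<exists>b. 0 < b \<and> b < h \<and> ddir u f (x + a *\<^sub>R u + h *\<^sub>R v) - ddir u f (x + a *\<^sub>R u + 0 *\<^sub>R v)
      = (h - 0) * ddir v (ddir u f) (x + a *\<^sub>R u + b *\<^sub>R v)"
    using a by (intro MVT2[OF h] d2) auto
  then obtain b where b: "0 < b" "b < h" and
    e2: "ddir u f (x + a *\<^sub>R u + h *\<^sub>R v) - ddir u f (x + a *\<^sub>R u + 0 *\<^sub>R v)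
      = h * ddir v (ddir u f) (x + a *\<^sub>R u + b *\<^sub>R v)" by auto
  have "f (x + h *\<^sub>R u + h *\<^sub>R v) - f (x + h *\<^sub>R u) - f (x + h *\<^sub>R v) + f x
      = h * h * ddir v (ddir u f) (x + a *\<^sub>R u + b *\<^sub>R v)"
    using e1 e2 by (simp add: \<phi>_def)
  then show ?thesis using a b by (intro exI[of _ a] exI[of _ b]) auto
qed

lemma ddir_commute_real:
  fixes f :: "'v::real_normed_vector \<Rightarrow> real"
  assumes S: "open S" and f: "smooth_on S f" and x: "x \<in> S"
  shows "ddir u (ddir v f) x = ddir v (ddir u f) x"
proof (rule ccontr)
  assume ne: "ddir u (ddir v f) x \<noteq> ddir v (ddir u f) x"
  \<comment> \<open>Half the gap: near x each mixed derivative moves by less than \<open>e\<close>,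
    so a common value of the two would force the gap below 2 e, that is, below itself.\<close>
  define e where "e = \<bar>ddir u (ddir v f) x - ddir v (ddir u f) x\<bar> / 2"
  have e: "0 < e" using ne by (simp add: e_def)
  have cont: "continuous_on S (ddir p (ddir q f))" for p q
    using smooth_on_ddir[OF smooth_on_ddir[OF f]] unfolding smooth_on_def by (metis Ck_on.simps(1))
  obtain r1 where r1: "r1 > 0" "\<And>y. \<lbrakk>y \<in> S; dist y x < r1\<rbrakk> \<Longrightarrow> dist (ddir u (ddir v f) y) (ddir u (ddir v f) x) < e"
    using cont[of u v] x e unfolding continuous_on_iff by metis
  obtain r2 where r2: "r2 > 0" "\<And>y. \<lbrakk>y \<in> S; dist y x < r2\<rbrakk> \<Longrightarrow> dist (ddir v (ddir u f) y) (ddir v (ddir u f) x) < e"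
    using cont[of v u] x e unfolding continuous_on_iff by metis
  obtain r3 where r3: "r3 > 0" "ball x r3 \<subseteq> S" using S x open_contains_ball by blast
  define r where "r = min r1 (min r2 r3)"
  have r: "r > 0" using r1 r2 r3 by (simp add: r_def)
  \<comment> \<open>Small enough to keep the whole parallelogram within distance \<open>r\<close> of
    x; the summand 1 covers u = v = 0.\<close>
  define h where "h = r / (norm u + norm v + 1)"
  have h: "h > 0" using r by (simp add: h_def add_nonneg_pos)
  have near: "dist (x + a *\<^sub>R u + b *\<^sub>R v) x < r" if "0 \<le> a" "a \<le> h" "0 \<le> b" "b \<le> h" for a b
  proof -
    have "dist (x + a *\<^sub>R u + b *\<^sub>R v) x \<le> a * norm u + b * norm v"
      using that norm_triangle_ineq[of "a *\<^sub>R u" "b *\<^sub>R v"] by (simp add: dist_norm add.assoc)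
    also have "\<dots> \<le> h * norm u + h * norm v"
      using that by (intro add_mono mult_right_mono) auto
    also have "\<dots> < h * (norm u + norm v + 1)" using h by (simp add: algebra_simps)
    also have "\<dots> = r" using h unfolding h_def by (smt (verit) nonzero_eq_divide_eq norm_ge_zero)
    finally show ?thesis .
  qed
  have seg: "x + a *\<^sub>R u + b *\<^sub>R v \<in> S" if "0 \<le> a" "a \<le> h" "0 \<le> b" "b \<le> h" for a b
    using near[OF that] r3 by (auto simp: r_def dist_commute subset_iff)
  obtain a b where ab: "0 \<le> a" "a \<le> h" "0 \<le> b" "b \<le> h"
    "f (x + h *\<^sub>R u + h *\<^sub>R v) - f (x + h *\<^sub>R u) - f (x + h *\<^sub>R v) + f x
      = h * h * ddir v (ddir u f) (x + a *\<^sub>R u + b *\<^sub>R v)"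
    using second_difference_mean_value[OF S f h seg] by blast
  have seg': "x + a *\<^sub>R v + b *\<^sub>R u \<in> S" if "0 \<le> a" "a \<le> h" "0 \<le> b" "b \<le> h" for a b
    using seg[of b a] that by (simp add: algebra_simps)
  obtain c d where cd: "0 \<le> c" "c \<le> h" "0 \<le> d" "d \<le> h"
    "f (x + h *\<^sub>R v + h *\<^sub>R u) - f (x + h *\<^sub>R v) - f (x + h *\<^sub>R u) + f x
      = h * h * ddir u (ddir v f) (x + c *\<^sub>R v + d *\<^sub>R u)"
    using second_difference_mean_value[OF S f h seg'] by blast
  have "x + h *\<^sub>R v + h *\<^sub>R u = x + h *\<^sub>R u + h *\<^sub>R v" by (simp add: algebra_simps)
  then have "h * h * ddir v (ddir u f) (x + a *\<^sub>R u + b *\<^sub>R v) = h * h * ddir u (ddir v f) (x + c *\<^sub>R v + d *\<^sub>R u)"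
    using ab(5) cd(5) by (simp add: algebra_simps)
  then have eq: "ddir v (ddir u f) (x + a *\<^sub>R u + b *\<^sub>R v) = ddir u (ddir v f) (x + d *\<^sub>R u + c *\<^sub>R v)"
    using h by (simp add: algebra_simps)
  have "dist (ddir v (ddir u f) (x + a *\<^sub>R u + b *\<^sub>R v)) (ddir v (ddir u f) x) < e"
    using near[OF ab(1-4)] by (intro r2 seg ab) (simp add: r_def)
  moreover have "dist (ddir u (ddir v f) (x + d *\<^sub>R u + c *\<^sub>R v)) (ddir u (ddir v f) x) < e"
    using near[OF cd(3,4,1,2)] by (intro r1 seg cd) (simp add: r_def)
  ultimately have "\<bar>ddir u (ddir v f) x - ddir v (ddir u f) x\<bar> < 2 * e"
    unfolding eq by (simp add: dist_real_def abs_if split: if_splits)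
  then show False by (simp add: e_def)
qed

lemma ddir_commute:
  fixes f :: "'v::real_normed_vector \<Rightarrow> 'w::euclidean_space"
  assumes S: "open S" and f: "smooth_on S f" and x: "x \<in> S"
  shows "ddir u (ddir v f) x = ddir v (ddir u f) x"
proof (rule euclidean_eqI)
  fix b :: 'w assume "b \<in> Basis"
  have fb: "smooth_on S (\<lambda>y. f y \<bullet> b)"
    by (rule smooth_on_linear[OF bounded_linear_inner_left S f])
  have *: "ddir p (ddir q f) x \<bullet> b = ddir p (ddir q (\<lambda>y. f y \<bullet> b)) x" for p q
  proof -
    have "ddir p (ddir q f) x \<bullet> b = ddir p (\<lambda>y. ddir q f y \<bullet> b) x"
      by (rule ddir_linear[symmetric, OF bounded_linear_inner_left
            smooth_on_differentiable[OF S smooth_on_ddir[OF f] x]])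
    also have "\<dots> = ddir p (ddir q (\<lambda>y. f y \<bullet> b)) x"
      by (rule ddir_transform[OF S x])
        (simp add: ddir_linear[OF bounded_linear_inner_left smooth_on_differentiable[OF S f]])
    finally show ?thesis .
  qed
  show "ddir u (ddir v f) x \<bullet> b = ddir v (ddir u f) x \<bullet> b"
    unfolding * by (rule ddir_commute_real[OF S fb x])
qed

section \<open>Smooth families of linear and bilinear maps\<close>

lemma linear_basis_expansion:
  fixes f :: "'v::euclidean_space \<Rightarrow> 'w::real_vector"
  assumes "linear f"
  shows "f v = (\<Sum>b\<in>Basis. (v \<bullet> b) *\<^sub>R f b)"
proof -
  have "f (\<Sum>b\<in>Basis. (v \<bullet> b) *\<^sub>R b) = (\<Sum>b\<in>Basis. (v \<bullet> b) *\<^sub>R f b)"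
    by (subst linear_sum[OF assms]) (simp add: linear_cmul[OF assms])
  then show ?thesis by (simp only: euclidean_representation)
qed

text \<open>Smoothness is asked for constant arguments only. Linearity and a basis expansion extend
  it to smoothly varying arguments, see \<open>smooth_on_apply\<close>.\<close>

definition tens1 :: "'v::euclidean_space set \<Rightarrow> ('v \<Rightarrow> 'v \<Rightarrow> 'w::real_normed_vector) \<Rightarrow> bool" where
  "tens1 S T \<longleftrightarrow> (\<forall>x\<in>S. linear (T x)) \<and> (\<forall>u. smooth_on S (\<lambda>x. T x u))"

definition tens2 :: "'v::euclidean_space set \<Rightarrow> ('v \<Rightarrow> 'v \<Rightarrow> 'v \<Rightarrow> 'w::real_normed_vector) \<Rightarrow> bool" where
  "tens2 S T \<longleftrightarrow> (\<forall>u. tens1 S (\<lambda>x. T x u)) \<and> (\<forall>v. tens1 S (\<lambda>x u. T x u v))"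

lemma tens1I:
  "\<lbrakk>\<And>x. x \<in> S \<Longrightarrow> linear (T x); \<And>u. smooth_on S (\<lambda>x. T x u)\<rbrakk> \<Longrightarrow> tens1 S T"
  by (simp add: tens1_def)

lemma tens1_linear: "tens1 S T \<Longrightarrow> x \<in> S \<Longrightarrow> linear (T x)"
  by (simp add: tens1_def)

lemma tens1_smooth: "tens1 S T \<Longrightarrow> smooth_on S (\<lambda>x. T x u)"
  by (simp add: tens1_def)

lemma tens2_right: "tens2 S T \<Longrightarrow> tens1 S (\<lambda>x. T x u)"
  by (simp add: tens2_def)

lemma tens2_left: "tens2 S T \<Longrightarrow> tens1 S (\<lambda>x u. T x u v)"
  by (simp add: tens2_def)

lemma tens2_smooth: "tens2 S T \<Longrightarrow> smooth_on S (\<lambda>x. T x u v)"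
  by (simp add: tens2_def tens1_def)

lemma tens2_bilinear: "tens2 S T \<Longrightarrow> x \<in> S \<Longrightarrow> bilinear (T x)"
  by (simp add: tens2_def tens1_def bilinear_def)

context
  fixes S :: "'v::euclidean_space set"
  assumes S: "open S"
begin

lemma tens1_apply_expansion:
  assumes "tens1 S T" "x \<in> S"
  shows "T x (V x) = (\<Sum>b\<in>Basis. (V x \<bullet> b) *\<^sub>R T x b)"
  using linear_basis_expansion tens1_linear[OF assms] by blast

lemma smooth_on_apply:
  assumes T: "tens1 S T" and V: "smooth_on S V"
  shows "smooth_on S (\<lambda>x. T x (V x))"
proof (rule smooth_on_cong[OF S])
  show "(\<Sum>b\<in>Basis. (V x \<bullet> b) *\<^sub>R T x b) = T x (V x)" if "x \<in> S" for x
    using tens1_apply_expansion[OF T that] by simp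
  show "smooth_on S (\<lambda>x. \<Sum>b\<in>Basis. (V x \<bullet> b) *\<^sub>R T x b)"
    by (intro smooth_on_sum smooth_on_scaleR S tens1_smooth[OF T]
        smooth_on_linear[OF bounded_linear_inner_left S V])
qed

lemma linear_ddir_tens1:
  assumes T: "tens1 S T" and x: "x \<in> S"
  shows "linear (\<lambda>u. ddir w (\<lambda>y. T y u) x)"
proof (rule linearI)
  have d: "(\<lambda>y. T y u) differentiable (at x)" for u
    by (rule smooth_on_differentiable[OF S tens1_smooth[OF T] x])
  show "ddir w (\<lambda>y. T y (u + v)) x = ddir w (\<lambda>y. T y u) x + ddir w (\<lambda>y. T y v) x" for u v
    by (subst ddir_add[symmetric, OF d d], rule ddir_transform[OF S x])
      (simp add: linear_add tens1_linear[OF T])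
  show "ddir w (\<lambda>y. T y (c *\<^sub>R u)) x = c *\<^sub>R ddir w (\<lambda>y. T y u) x" for c u
    by (subst ddir_linear[symmetric, OF bounded_linear_scaleR_right d], rule ddir_transform[OF S x])
      (simp add: linear_cmul tens1_linear[OF T])
qed

text \<open>The Leibniz rule for evaluation: one term freezes the argument at x, the other the
  tensor. Thus only derivatives of tensors on constant vectors ever have to be handled.\<close>

lemma ddir_apply:
  assumes T: "tens1 S T" and V: "smooth_on S V" and x: "x \<in> S"
  shows "ddir w (\<lambda>y. T y (V y)) x = ddir w (\<lambda>y. T y (V x)) x + T x (ddir w V x)"
proof -
  have dT: "(\<lambda>y. T y u) differentiable (at x)" for u
    by (rule smooth_on_differentiable[OF S tens1_smooth[OF T] x])
  have dV: "V differentiable (at x)"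
    by (rule smooth_on_differentiable[OF S V x])
  have dVb: "(\<lambda>y. V y \<bullet> b) differentiable (at x)" for b
    by (rule smooth_on_differentiable[OF S smooth_on_linear[OF bounded_linear_inner_left S V] x])
  have "ddir w (\<lambda>y. T y (V y)) x = ddir w (\<lambda>y. \<Sum>b\<in>Basis. (V y \<bullet> b) *\<^sub>R T y b) x"
    by (rule ddir_transform[OF S x]) (rule tens1_apply_expansion[OF T])
  also have "\<dots> = (\<Sum>b\<in>Basis. (V x \<bullet> b) *\<^sub>R ddir w (\<lambda>y. T y b) x + (ddir w V x \<bullet> b) *\<^sub>R T x b)"
  proof (subst ddir_sum)
    show "(\<lambda>y. (V y \<bullet> b) *\<^sub>R T y b) differentiable at x" for b
      using dT dVb by (rule_tac differentiable_scaleR)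
    show "(\<Sum>b\<in>Basis. ddir w (\<lambda>y. (V y \<bullet> b) *\<^sub>R T y b) x) =
      (\<Sum>b\<in>Basis. (V x \<bullet> b) *\<^sub>R ddir w (\<lambda>y. T y b) x + (ddir w V x \<bullet> b) *\<^sub>R T x b)"
      by (simp add: ddir_scaleR[OF dVb dT] ddir_linear[OF bounded_linear_inner_left dV])
  qed
  also have "\<dots> = ddir w (\<lambda>y. T y (V x)) x + T x (ddir w V x)"
    unfolding sum.distrib linear_basis_expansion[OF linear_ddir_tens1[OF T x], of w "V x"]
      linear_basis_expansion[OF tens1_linear[OF T x], of "ddir w V x"] ..
  finally show ?thesis .
qed

lemma tens1_ddir: "tens1 S T \<Longrightarrow> tens1 S (\<lambda>x u. ddir w (\<lambda>y. T y u) x)"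
  by (rule tens1I, rule linear_ddir_tens1, assumption+, rule smooth_on_ddir, rule tens1_smooth)

lemma tens1_dir: "smooth_on S f \<Longrightarrow> tens1 S (\<lambda>x w. ddir w f x)"
  by (rule tens1I, rule linear_ddir, rule smooth_on_differentiable[OF S], assumption+, rule smooth_on_ddir)

lemma tens1_comp: "\<lbrakk>tens1 S T; tens1 S V\<rbrakk> \<Longrightarrow> tens1 S (\<lambda>x u. T x (V x u))"
  by (rule tens1I, rule linear_compose[unfolded o_def, OF tens1_linear tens1_linear], assumption+,
      rule smooth_on_apply[OF _ tens1_smooth])

lemma tens1_add: "\<lbrakk>tens1 S T; tens1 S V\<rbrakk> \<Longrightarrow> tens1 S (\<lambda>x u. T x u + V x u)"
  by (rule tens1I, rule linear_compose_add; simp add: tens1_def smooth_on_add[OF S])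

lemma tens1_diff: "\<lbrakk>tens1 S T; tens1 S V\<rbrakk> \<Longrightarrow> tens1 S (\<lambda>x u. T x u - V x u)"
  by (rule tens1I, rule linear_compose_sub; simp add: tens1_def smooth_on_diff[OF S])

lemma tens1_scaleR: "\<lbrakk>smooth_on S f; tens1 S T\<rbrakk> \<Longrightarrow> tens1 S (\<lambda>x u. f x *\<^sub>R T x u)"
  by (rule tens1I, rule linear_compose_scale_right; simp add: tens1_def smooth_on_scaleR[OF S])

lemma tens1_mult: "\<lbrakk>smooth_on S f; tens1 S T\<rbrakk> \<Longrightarrow> tens1 S (\<lambda>x u. f x * T x u :: real)"
  using tens1_scaleR[of f T] by simp

lemma tens1_mult_right: "\<lbrakk>smooth_on S f; tens1 S T\<rbrakk> \<Longrightarrow> tens1 S (\<lambda>x u. T x u * f x :: real)"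
  using tens1_mult[of f T] by (simp add: mult.commute)

lemma tens2_apply_right:
  assumes T: "tens2 S T" and V: "smooth_on S V"
  shows "tens1 S (\<lambda>x u. T x u (V x))"
proof (rule tens1I)
  show "linear (\<lambda>u. T x u (V x))" if "x \<in> S" for x
    by (rule tens1_linear[OF tens2_left[OF T] that])
  show "smooth_on S (\<lambda>x. T x u (V x))" for u
    by (rule smooth_on_apply[OF tens2_right[OF T] V])
qed

lemma tens2_smooth_apply:
  assumes T: "tens2 S T" and U: "smooth_on S U" and V: "smooth_on S V"
  shows "smooth_on S (\<lambda>x. T x (U x) (V x))"
  by (rule smooth_on_apply[OF tens2_apply_right[OF T V] U])

lemma tens2_apply_left:
  assumes T: "tens2 S T" and U: "smooth_on S U"
  shows "tens1 S (\<lambda>x v. T x (U x) v)"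
proof (rule tens1I)
  show "linear (T x (U x))" if "x \<in> S" for x
    by (rule tens1_linear[OF tens2_right[OF T] that])
  show "smooth_on S (\<lambda>x. T x (U x) v)" for v
    by (rule smooth_on_apply[OF tens2_left[OF T] U])
qed

lemma ddir_apply2:
  assumes T: "tens2 S T" and U: "smooth_on S U" and V: "smooth_on S V" and x: "x \<in> S"
  shows "ddir w (\<lambda>y. T y (U y) (V y)) x =
    ddir w (\<lambda>y. T y (U x) (V x)) x + T x (ddir w U x) (V x) + T x (U x) (ddir w V x)"
  using ddir_apply[OF tens2_apply_right[OF T V] U x, of w]
    ddir_apply[OF tens2_right[OF T] V x, of w "U x"] by simp

lemma tens2I:
  "\<lbrakk>\<And>u. tens1 S (\<lambda>x v. T x u v); \<And>v. tens1 S (\<lambda>x u. T x u v)\<rbrakk> \<Longrightarrow> tens2 S T"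
  by (simp add: tens2_def)

end

lemma tens1_sum:
  assumes "open S" "\<And>i. i \<in> I \<Longrightarrow> tens1 S (T i)"
  shows "tens1 S (\<lambda>x u. \<Sum>i\<in>I. T i x u)"
proof (rule tens1I)
  show "linear (\<lambda>u. \<Sum>i\<in>I. T i x u)" if "x \<in> S" for x
    by (rule linear_compose_sum) (use assms(2) tens1_linear that in blast)
  show "smooth_on S (\<lambda>x. \<Sum>i\<in>I. T i x u)" for u
    by (rule smooth_on_sum[OF assms(1)]) (use assms(2) tens1_smooth in blast)
qed

lemma tens1_nth: "smooth_on S F \<Longrightarrow> open S \<Longrightarrow> tens1 S (\<lambda>x u. u $ i *\<^sub>R F x)"
  by (rule tens1I, rule linearI; simp add: scaleR_add_left smooth_on_scaleR smooth_on_const)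

lemma tens1_subset: "\<lbrakk>tens1 S T; S' \<subseteq> S\<rbrakk> \<Longrightarrow> tens1 S' T"
  unfolding tens1_def using smooth_on_subset by blast

lemma tens2_subset: "\<lbrakk>tens2 S T; S' \<subseteq> S\<rbrakk> \<Longrightarrow> tens2 S' T"
  unfolding tens2_def using tens1_subset by blast

section \<open>Orthonormal frames\<close>

locale inner_form =
  fixes h :: "real^'m::finite \<Rightarrow> real^'m \<Rightarrow> real"
  assumes bil: "bilinear h" and sym: "h u v = h v u" and pos: "v \<noteq> 0 \<Longrightarrow> 0 < h v v"
begin

lemma linear_left: "linear (\<lambda>u. h u v)"
  using bil by (auto simp: bilinear_def)

text \<open>Gram-Schmidt, by induction over the index set: as long as an index is missing, fewer
  vectors than the dimension have been chosen, so some \<open>v\<close> lies outside their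
  span.\<close>

lemma orthonormal_extend:
  fixes I :: "'m set"
  shows "\<exists>e. \<forall>i\<in>I. \<forall>j\<in>I. h (e i) (e j) = (if i = j then 1 else 0)"
proof (induction I rule: infinite_finite_induct)
  case (insert k I)
  then obtain e where e: "\<forall>i\<in>I. \<forall>j\<in>I. h (e i) (e j) = (if i = j then 1 else 0)" by blast
  have "dim (e ` I) \<le> card I"
    using dim_le_card'[of "e ` I"] card_image_le[of I e] insert.hyps(1) by force
  also have "card I < CARD('m)"
    using insert by (intro psubset_card_mono) auto
  finally have "dim (e ` I) \<noteq> DIM(real^'m)" by simp
  then have "span (e ` I) \<noteq> UNIV"
    by (metis dim_UNIV dim_span)
  then obtain v where v: "v \<notin> span (e ` I)" by blast
  define w where "w = v - (\<Sum>i\<in>I. h v (e i) *\<^sub>R e i)"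
  have "(\<Sum>i\<in>I. h v (e i) *\<^sub>R e i) \<in> span (e ` I)"
    by (intro span_sum span_scale span_base) auto
  then have "w \<noteq> 0" using v by (auto simp: w_def)
  then have hw: "h w w > 0" using pos by blast
  have hwe: "h w (e j) = 0" if "j \<in> I" for j
  proof -
    have "h w (e j) = h v (e j) - (\<Sum>i\<in>I. h v (e i) * h (e i) (e j))"
      unfolding w_def
      by (simp add: linear_diff[OF linear_left] linear_sum[OF linear_left] linear_cmul[OF linear_left])
    also have "(\<Sum>i\<in>I. h v (e i) * h (e i) (e j)) = (\<Sum>i\<in>I. if i = j then h v (e i) else 0)"
      using e that by (intro sum.cong) auto
    finally show ?thesis using insert that by simp
  qed
  define w' where "w' = (1 / sqrt (h w w)) *\<^sub>R w"
  have "h w' w' = 1" "\<And>j. j \<in> I \<Longrightarrow> h w' (e j) = 0" "\<And>j. j \<in> I \<Longrightarrow> h (e j) w' = 0"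
    using hw hwe sym[of "e _" w]
    by (simp_all add: w'_def bilinear_lmul[OF bil] bilinear_rmul[OF bil])
  then show ?case
    using e insert by (intro exI[of _ "e(k := w')"]) auto
qed auto

lemma orthonormal_some_frame: "orthonormal_frame h (some_frame h)"
proof -
  obtain e :: "'m \<Rightarrow> _" where "\<forall>i\<in>UNIV. \<forall>j\<in>UNIV. h (e i) (e j) = (if i = j then 1 else 0)"
    using orthonormal_extend[of UNIV] by blast
  then have "orthonormal_frame h e" by (simp add: orthonormal_frame_def)
  then show ?thesis unfolding some_frame_def by (rule someI[where P = "orthonormal_frame h"])
qed

context
  fixes e :: "'m \<Rightarrow> real^'m"
  assumes e: "orthonormal_frame h e"
begin

lemma frame_inner: "h (e i) (e j) = (if i = j then 1 else 0)"
  using e by (simp add: orthonormal_frame_def)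

lemma frame_coeff: "h (\<Sum>i\<in>UNIV. c i *\<^sub>R e i) (e j) = c j"
proof -
  have "h (\<Sum>i\<in>UNIV. c i *\<^sub>R e i) (e j) = (\<Sum>i\<in>UNIV. c i * h (e i) (e j))"
    by (subst linear_sum[OF linear_left]) (simp add: linear_cmul[OF linear_left])
  also have "\<dots> = (\<Sum>i\<in>UNIV. if i = j then c i else 0)"
    by (intro sum.cong) (auto simp: frame_inner)
  finally show ?thesis by simp
qed

text \<open>Orthonormal vectors are independent, and \<open>CARD('m)\<close> of them span; the
  coefficients are then read off by \<open>frame_coeff\<close>.\<close>

lemma frame_expansion: "(\<Sum>i\<in>UNIV. h v (e i) *\<^sub>R e i) = v"
proof -
  have inj: "inj e"
    using frame_inner by (intro injI) (metis zero_neq_one)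
  have "independent (range e)"
  proof (rule independent_if_scalars_zero)
    fix f x assume s: "(\<Sum>y\<in>range e. f y *\<^sub>R y) = 0" and "x \<in> range e"
    then obtain j where j: "x = e j" by blast
    have "(\<Sum>i\<in>UNIV. f (e i) *\<^sub>R e i) = 0"
      using s by (simp add: sum.reindex[OF inj])
    then show "f x = 0"
      using frame_coeff[of "\<lambda>i. f (e i)" j] linear_0[OF linear_left, of "e j"] j by simp
  qed simp
  moreover have "dim (UNIV :: (real^'m) set) \<le> card (range e)"
    using card_image[OF inj] by simp
  ultimately have "v \<in> span (range e)"
    using card_ge_dim_independent[of "range e" UNIV] by blast
  then obtain f where "v = (\<Sum>y\<in>range e. f y *\<^sub>R y)"
    unfolding span_finite[OF finite_imageI[OF finite]] by blast
  then have "v = (\<Sum>i\<in>UNIV. f (e i) *\<^sub>R e i)"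
    by (simp add: sum.reindex[OF inj])
  then show ?thesis using frame_coeff by simp
qed

lemma frame_linear:
  assumes "linear f"
  shows "(\<Sum>i\<in>UNIV. h v (e i) *\<^sub>R f (e i)) = f v"
proof -
  have "f (\<Sum>i\<in>UNIV. h v (e i) *\<^sub>R e i) = (\<Sum>i\<in>UNIV. h v (e i) *\<^sub>R f (e i))"
    by (subst linear_sum[OF assms]) (simp add: linear_cmul[OF assms])
  then show ?thesis by (simp add: frame_expansion)
qed

lemma frame_linear_real: "linear f \<Longrightarrow> (\<Sum>i\<in>UNIV. h v (e i) * f (e i)) = f v"
  using frame_linear[of f v] by simp

end

text \<open>The first slot is expanded in the frame \<open>e\<close>, the sums are swapped, and the
  second slot is recollected from its expansion in \<open>e'\<close>.\<close>

lemma trace_frame_independent: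
  assumes e: "orthonormal_frame h e" and e': "orthonormal_frame h e'"
    and T: "bilinear (T :: _ \<Rightarrow> _ \<Rightarrow> real)"
  shows "(\<Sum>i\<in>UNIV. T (e' i) (e' i)) = (\<Sum>i\<in>UNIV. T (e i) (e i))"
proof -
  have Tl: "linear (\<lambda>u. T u v)" and Tr: "linear (T u)" for u v
    using T by (auto simp: bilinear_def)
  have "(\<Sum>i\<in>UNIV. T (e' i) (e' i)) = (\<Sum>i\<in>UNIV. \<Sum>j\<in>UNIV. h (e' i) (e j) * T (e j) (e' i))"
    using frame_linear_real[OF e Tl] by simp
  also have "\<dots> = (\<Sum>j\<in>UNIV. \<Sum>i\<in>UNIV. h (e j) (e' i) * T (e j) (e' i))"
    by (subst sum.swap) (simp add: sym)
  also have "\<dots> = (\<Sum>j\<in>UNIV. T (e j) (e j))"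
    using frame_linear_real[OF e' Tr] by simp
  finally show ?thesis .
qed

lemma trace_isometry:
  assumes e: "orthonormal_frame h e" and T: "bilinear (T :: _ \<Rightarrow> _ \<Rightarrow> real)"
    and j: "\<And>u v. h (j u) (j v) = h u v"
  shows "(\<Sum>i\<in>UNIV. T (j (e i)) (j (e i))) = (\<Sum>i\<in>UNIV. T (e i) (e i))"
proof -
  have "orthonormal_frame h (\<lambda>i. j (e i))"
    using e j by (simp add: orthonormal_frame_def)
  from trace_frame_independent[OF e this T] show ?thesis .
qed

end

section \<open>Kaehler structures on an open set of coordinates\<close>

lemma linear_axis_expansion:
  fixes f :: "real^'m::finite \<Rightarrow> 'w::real_vector"
  assumes "linear f"
  shows "f v = (\<Sum>i\<in>UNIV. v $ i *\<^sub>R f (axis i 1))"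
proof -
  have "f (\<Sum>i\<in>UNIV. v $ i *\<^sub>R axis i 1) = (\<Sum>i\<in>UNIV. v $ i *\<^sub>R f (axis i 1))"
    by (subst linear_sum[OF assms]) (simp add: linear_cmul[OF assms])
  then show ?thesis using basis_expansion[of v] by (simp add: scalar_mult_eq_scaleR)
qed

text \<open>The coordinate picture of a Kaehler structure. \<open>Gam\<close> holds the Christoffel
  symbols: \<open>Gam_sym\<close> is vanishing torsion, while \<open>ddir_G\<close> and
  \<open>ddir_J\<close> are \<nabla>g = 0 and \<nabla>J = 0 evaluated on constant vectors.\<close>

locale kaehler_chart =
  fixes S :: "(real^'m::finite) set"
    and G :: "real^'m \<Rightarrow> real^'m \<Rightarrow> real^'m \<Rightarrow> real"
    and Gam :: "real^'m \<Rightarrow> real^'m \<Rightarrow> real^'m \<Rightarrow> real^'m"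
    and J :: "real^'m \<Rightarrow> real^'m \<Rightarrow> real^'m"
  assumes S: "open S"
    and G: "tens2 S G"
    and G_sym: "x \<in> S \<Longrightarrow> G x u v = G x v u"
    and G_pos: "x \<in> S \<Longrightarrow> v \<noteq> 0 \<Longrightarrow> 0 < G x v v"
    and Gam: "tens2 S Gam"
    and Gam_sym: "x \<in> S \<Longrightarrow> Gam x u v = Gam x v u"
    and ddir_G: "x \<in> S \<Longrightarrow> ddir w (\<lambda>y. G y u v) x = G x (Gam x w u) v + G x u (Gam x w v)"
    and J: "tens1 S J"
    and JJ: "x \<in> S \<Longrightarrow> J x (J x v) = - v"
    and G_J: "x \<in> S \<Longrightarrow> G x (J x u) (J x v) = G x u v"
    and ddir_J: "x \<in> S \<Longrightarrow> ddir w (\<lambda>y. J y v) x = J x (Gam x w v) - Gam x w (J x v)"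
begin

lemma inner_form_G: "x \<in> S \<Longrightarrow> inner_form (G x)"
  using G_sym G_pos tens2_bilinear[OF G] by unfold_locales auto

abbreviation frame :: "real^'m \<Rightarrow> 'm \<Rightarrow> real^'m" where
  "frame x \<equiv> some_frame (G x)"

lemma frame_orthonormal: "x \<in> S \<Longrightarrow> orthonormal_frame (G x) (frame x)"
  using inner_form.orthonormal_some_frame[OF inner_form_G] .

text \<open>The two slots stay separate arguments although the sum puts the same frame vector into
  both: only so is the argument a bilinear form, which frame independence and differentiation
  require.\<close>

definition trace :: "real^'m \<Rightarrow> (real^'m \<Rightarrow> real^'m \<Rightarrow> real) \<Rightarrow> real" where
  "trace x T = (\<Sum>i\<in>UNIV. T (frame x i) (frame x i))"

lemma trace_add: "trace x (\<lambda>u v. T u v + T' u v) = trace x T + trace x T'"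
  by (simp add: trace_def sum.distrib)

lemma trace_diff: "trace x (\<lambda>u v. T u v - T' u v) = trace x T - trace x T'"
  by (simp add: trace_def sum_subtractf)

lemma trace_minus: "trace x (\<lambda>u v. - T u v) = - trace x T"
  by (simp add: trace_def sum_negf)

lemma trace_mult: "trace x (\<lambda>u v. c * T u v) = c * trace x T"
  by (simp add: trace_def sum_distrib_left)

lemma trace_G_left:
  assumes "x \<in> S" "linear f"
  shows "trace x (\<lambda>u v. G x p u * f v) = f p"
  using inner_form.frame_linear_real[OF inner_form_G frame_orthonormal] assms
  by (simp add: trace_def)

lemma trace_swap: "trace x (\<lambda>u v. T v u) = trace x T"
  by (simp add: trace_def)

lemma trace_dim: "x \<in> S \<Longrightarrow> trace x (G x) = real CARD('m)"
  using inner_form.frame_inner[OF inner_form_G frame_orthonormal] by (simp add: trace_def)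

lemma trace_frame:
  assumes "x \<in> S" "bilinear T" "orthonormal_frame (G x) e"
  shows "(\<Sum>i\<in>UNIV. T (e i) (e i)) = trace x T"
  unfolding trace_def
  using inner_form.trace_frame_independent[OF inner_form_G frame_orthonormal] assms by blast

lemma trace_J:
  assumes "x \<in> S" "bilinear T"
  shows "trace x (\<lambda>u v. T (J x u) (J x v)) = trace x T"
  unfolding trace_def
  using inner_form.trace_isometry[OF inner_form_G frame_orthonormal, of x T "J x"] assms G_J by blast

text \<open>\<open>trace_J\<close> for the form T u (J v) produces T (J u) (J (J v)), and J squared
  gives the sign.\<close>

lemma trace_J_left:
  assumes x: "x \<in> S" and T: "bilinear T"
  shows "trace x (\<lambda>u v. T (J x u) v) = - trace x (\<lambda>u v. T u (J x v))"
proof -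
  have lin: "linear (T u)" for u using T by (simp add: bilinear_def)
  have "bilinear (\<lambda>u v. T u (J x v))"
    using T linear_compose[OF tens1_linear[OF J x] lin] unfolding bilinear_def by (simp add: o_def)
  from trace_J[OF x this] show ?thesis
    by (simp add: JJ[OF x] linear_neg[OF lin] trace_minus)
qed

lemma G_J_left: "x \<in> S \<Longrightarrow> G x (J x u) v = - G x u (J x v)"
  using G_J[of x "J x u" v] JJ[of x u] by (simp add: bilinear_lneg[OF tens2_bilinear[OF G]])

lemma G_J_self: "x \<in> S \<Longrightarrow> G x u (J x u) = 0"
  using G_J_left[of x u u] G_sym[of x u "J x u"] by simp

lemma trace_G_J_left:
  assumes "x \<in> S" "linear f"
  shows "trace x (\<lambda>u v. G x p (J x u) * f v) = - f (J x p)"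
proof -
  have "G x p (J x u) = - G x (J x p) u" for u
    using G_J_left[OF assms(1)] by simp
  then show ?thesis using trace_G_left[OF assms, of "J x p"] by (simp add: trace_minus)
qed

section \<open>The inverse metric and derivatives of traces\<close>

text \<open>The components of the inverse metric. They replace \<open>frame x\<close> whenever a
  trace is differentiated, because the frames are chosen at each point independently.\<close>

definition cometric :: "real^'m \<Rightarrow> 'm \<Rightarrow> 'm \<Rightarrow> real" where
  "cometric x i j = (\<Sum>k\<in>UNIV. frame x k $ i * frame x k $ j)"

lemma trace_cometric:
  assumes T: "bilinear T"
  shows "trace x T = (\<Sum>i\<in>UNIV. \<Sum>j\<in>UNIV. cometric x i j * T (axis i 1) (axis j 1))"
proof -
  have Tl: "linear (\<lambda>u. T u v)" and Tr: "linear (T u)" for u v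
    using T by (auto simp: bilinear_def)
  have exp: "T u v = (\<Sum>i\<in>UNIV. \<Sum>j\<in>UNIV. u $ i * v $ j * T (axis i 1) (axis j 1))" for u v
  proof -
    have "T u v = (\<Sum>i\<in>UNIV. u $ i * T (axis i 1) v)"
      using linear_axis_expansion[OF Tl[of v], of u] by simp
    also have "\<dots> = (\<Sum>i\<in>UNIV. u $ i * (\<Sum>j\<in>UNIV. v $ j * T (axis i 1) (axis j 1)))"
      using linear_axis_expansion[OF Tr, of _ v] by simp
    finally show ?thesis by (simp add: sum_distrib_left mult.assoc)
  qed
  have "trace x T = (\<Sum>k\<in>UNIV. \<Sum>i\<in>UNIV. \<Sum>j\<in>UNIV. frame x k $ i * frame x k $ j * T (axis i 1) (axis j 1))"
    unfolding trace_def by (intro sum.cong refl exp)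
  also have "\<dots> = (\<Sum>i\<in>UNIV. \<Sum>j\<in>UNIV. \<Sum>k\<in>UNIV. frame x k $ i * frame x k $ j * T (axis i 1) (axis j 1))"
    by (subst sum.swap) (intro sum.cong refl sum.swap)
  finally show ?thesis by (simp add: cometric_def sum_distrib_right)
qed

text \<open>Summing over j assembles the components of each frame vector; what remains is component
  \<open>l\<close> of the frame expansion of \<open>axis i 1\<close>.\<close>

lemma metric_cometric:
  assumes x: "x \<in> S"
  shows "(\<Sum>j\<in>UNIV. G x (axis i 1) (axis j 1) * cometric x j l) = (if i = l then 1 else 0)"
proof -
  have lin: "linear (G x u)" for u using tens2_bilinear[OF G x] by (simp add: bilinear_def)
  have "(\<Sum>j\<in>UNIV. G x (axis i 1) (axis j 1) * cometric x j l)
      = (\<Sum>k\<in>UNIV. \<Sum>j\<in>UNIV. frame x k $ j * G x (axis i 1) (axis j 1) * frame x k $ l)"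
    unfolding cometric_def sum_distrib_left by (subst sum.swap) (simp add: algebra_simps)
  also have "\<dots> = (\<Sum>k\<in>UNIV. G x (axis i 1) (frame x k) * frame x k $ l)"
  proof (intro sum.cong refl)
    fix k
    have "G x (axis i 1) (\<Sum>j\<in>UNIV. frame x k $ j *\<^sub>R axis j 1)
        = (\<Sum>j\<in>UNIV. frame x k $ j * G x (axis i 1) (axis j 1))"
      by (simp add: linear_sum[OF lin] linear_cmul[OF lin])
    then have "G x (axis i 1) (frame x k) = (\<Sum>j\<in>UNIV. frame x k $ j * G x (axis i 1) (axis j 1))"
      using basis_expansion[of "frame x k"] by (simp add: scalar_mult_eq_scaleR)
    then show "(\<Sum>j\<in>UNIV. frame x k $ j * G x (axis i 1) (axis j 1) * frame x k $ l)
        = G x (axis i 1) (frame x k) * frame x k $ l"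
      by (simp add: sum_distrib_right)
  qed
  also have "\<dots> = axis i 1 $ l"
    using inner_form.frame_linear_real[OF inner_form_G[OF x] frame_orthonormal[OF x],
        of "\<lambda>v. v $ l" "axis i 1"]
    by (simp add: linear_iff)
  finally show ?thesis by (simp add: axis_def)
qed

lemma smooth_det:
  fixes A :: "real^'m \<Rightarrow> real^'n^'n"
  assumes "\<And>i j. smooth_on S (\<lambda>x. A x $ i $ j)"
  shows "smooth_on S (\<lambda>x. det (A x))"
  unfolding det_def
  by (intro smooth_on_sum smooth_on_mult smooth_on_prod S assms smooth_on_const)

text \<open>The columns of \<open>cometric\<close> solve linear systems with the Gram matrix, so
  Cramer's rule writes each entry as a quotient of determinants in smooth entries, whatever frame
  was chosen.\<close>

lemma smooth_cometric: "smooth_on S (\<lambda>x. cometric x k l)"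
proof -
  define M where "M x = (\<chi> i j. G x (axis i 1) (axis j 1))" for x
  \<comment> \<open>The Gram matrix with column \<open>k\<close> replaced by the right-hand side
    \<open>axis l 1\<close>: the numerator in Cramer's rule.\<close>
  define N where "N x = (\<chi> i j. if j = k then axis l 1 $ i else M x $ i $ j)" for x
  have detM: "det (M x) \<noteq> 0" if x: "x \<in> S" for x
  proof -
    have "M x ** (\<chi> i j. cometric x i j) = mat 1"
      using metric_cometric[OF x] by (simp add: matrix_matrix_mult_def mat_def M_def vec_eq_iff)
    then show ?thesis using invertible_det_nz invertible_right_inverse by blast
  qed
  have eq: "det (N x) * inverse (det (M x)) = cometric x k l" if x: "x \<in> S" for x
  proof -
    have "M x *v (\<chi> i. cometric x i l) = axis l 1"
      using metric_cometric[OF x] by (simp add: matrix_vector_mult_def M_def vec_eq_iff axis_def)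
    then have "(\<chi> i. cometric x i l) $ k = det (\<chi> i j. if j = k then axis l 1 $ i else M x $ i $ j) / det (M x)"
      using cramer[OF detM[OF x], of "\<chi> i. cometric x i l" "axis l 1"] by simp
    then show ?thesis by (simp add: N_def divide_inverse)
  qed
  have sM: "smooth_on S (\<lambda>x. M x $ i $ j)" for i j
    by (simp add: M_def tens2_smooth[OF G])
  have sN: "smooth_on S (\<lambda>x. N x $ i $ j)" for i j
    using sM by (cases "j = k") (simp_all add: N_def smooth_on_const)
  show ?thesis
    by (rule smooth_on_cong[OF S eq])
      (assumption, intro smooth_on_mult smooth_on_inverse smooth_det sM sN detM S)
qed

lemma smooth_trace:
  assumes T: "tens2 S T"
  shows "smooth_on S (\<lambda>x. trace x (T x))"
proof (rule smooth_on_cong[OF S])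
  show "(\<Sum>i\<in>UNIV. \<Sum>j\<in>UNIV. cometric x i j * T x (axis i 1) (axis j 1)) = trace x (T x)" if "x \<in> S" for x
    using trace_cometric[OF tens2_bilinear[OF T that]] by simp
  show "smooth_on S (\<lambda>x. \<Sum>i\<in>UNIV. \<Sum>j\<in>UNIV. cometric x i j * T x (axis i 1) (axis j 1))"
    by (intro smooth_on_sum smooth_on_mult S smooth_cometric tens2_smooth[OF T])
qed

text \<open>The part of the derivative of a trace in which only the inverse metric is
  differentiated.\<close>

definition dcometric :: "real^'m \<Rightarrow> real^'m \<Rightarrow> (real^'m \<Rightarrow> real^'m \<Rightarrow> real) \<Rightarrow> real" where
  "dcometric w x T = (\<Sum>i\<in>UNIV. \<Sum>j\<in>UNIV. ddir w (\<lambda>y. cometric y i j) x * T (axis i 1) (axis j 1))"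

lemma dcometric_sum: "dcometric w x (\<lambda>u v. \<Sum>a\<in>A. F a u v) = (\<Sum>a\<in>A. dcometric w x (F a))"
proof -
  have "(\<Sum>j\<in>UNIV. \<Sum>a\<in>A. X j a) = (\<Sum>a\<in>A. \<Sum>j\<in>UNIV. X j a)" for X :: "'m \<Rightarrow> _ \<Rightarrow> real"
    by (rule sum.swap)
  then show ?thesis by (simp add: dcometric_def sum_distrib_left)
qed

lemma dcometric_mult: "dcometric w x (\<lambda>u v. c * F u v) = c * dcometric w x F"
  by (simp add: dcometric_def sum_distrib_left mult_ac)

lemma trace_sum: "trace x (\<lambda>u v. \<Sum>a\<in>A. F a u v) = (\<Sum>a\<in>A. trace x (F a))"
  unfolding trace_def by (rule sum.swap)

lemma ddir_trace_raw:
  assumes T: "tens2 S T" and x: "x \<in> S"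
  shows "ddir w (\<lambda>y. trace y (T y)) x = dcometric w x (T x) + trace x (\<lambda>u v. ddir w (\<lambda>y. T y u v) x)"
proof -
  have dc: "(\<lambda>y. cometric y i j) differentiable (at x)" for i j
    by (rule smooth_on_differentiable[OF S smooth_cometric x])
  have dT: "(\<lambda>y. T y u v) differentiable (at x)" for u v
    by (rule smooth_on_differentiable[OF S tens2_smooth[OF T] x])
  have bil: "bilinear (\<lambda>u v. ddir w (\<lambda>y. T y u v) x)"
    unfolding bilinear_def
    using linear_ddir_tens1[OF S tens2_right[OF T] x] linear_ddir_tens1[OF S tens2_left[OF T] x] by blast
  have "ddir w (\<lambda>y. trace y (T y)) x
      = ddir w (\<lambda>y. \<Sum>i\<in>UNIV. \<Sum>j\<in>UNIV. cometric y i j * T y (axis i 1) (axis j 1)) x"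
    by (rule ddir_transform[OF S x]) (rule trace_cometric[OF tens2_bilinear[OF T]])
  also have "\<dots> = (\<Sum>i\<in>UNIV. \<Sum>j\<in>UNIV. cometric x i j * ddir w (\<lambda>y. T y (axis i 1) (axis j 1)) x
        + ddir w (\<lambda>y. cometric y i j) x * T x (axis i 1) (axis j 1))"
    by (simp add: ddir_sum smooth_on_differentiable[OF S _ x] smooth_on_sum S smooth_on_mult
        smooth_cometric tens2_smooth[OF T] ddir_mult[OF dc dT])
  finally show ?thesis
    unfolding trace_cometric[OF bil] dcometric_def by (simp add: sum.distrib)
qed

text \<open>The derivative of the inverse metric is obtained by differentiating the identity
  \<open>trace (G p \<otimes> G q) = G p q\<close>; these rank one tensors span all bilinear forms.\<close>

lemma dcometric_rank_one:
  assumes x: "x \<in> S"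
  shows "dcometric w x (\<lambda>u v. G x p u * G x q v)
    = - trace x (\<lambda>u v. G x p (Gam x w u) * G x q v + G x p u * G x q (Gam x w v))"
proof -
  have lin: "linear (G x u)" "linear (\<lambda>u. G x u v)" for u v
    using tens2_bilinear[OF G x] by (auto simp: bilinear_def)
  have ling: "linear (Gam x w)" using tens1_linear[OF tens2_right[OF Gam] x] .
  have linG: "linear (\<lambda>v. G x q (Gam x w v))" for q
    using linear_compose[OF ling lin(1)] by (simp add: o_def)
  define T where "T y u v = G y p u * G y q v" for y u v
  have T: "tens2 S T"
    unfolding T_def by (intro tens2I tens1_mult tens1_mult_right S tens2_smooth[OF G] tens2_right[OF G])
  have d: "(\<lambda>y. G y u v) differentiable (at x)" for u v
    by (rule smooth_on_differentiable[OF S tens2_smooth[OF G] x])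
  have "G x (Gam x w p) q + G x p (Gam x w q) = ddir w (\<lambda>y. trace y (T y)) x"
  proof -
    have "ddir w (\<lambda>y. trace y (T y)) x = ddir w (\<lambda>y. G y q p) x"
      unfolding T_def
      by (rule ddir_transform[OF S x]) (rule trace_G_left[OF _ tens1_linear[OF tens2_right[OF G]]])
    then show ?thesis using G_sym[OF x] by (simp add: ddir_G[OF x])
  qed
  also have "\<dots> = dcometric w x (T x) + trace x (\<lambda>u v. ddir w (\<lambda>y. T y u v) x)"
    by (rule ddir_trace_raw[OF T x])
  also have "trace x (\<lambda>u v. ddir w (\<lambda>y. T y u v) x)
      = trace x (\<lambda>u v. G x (Gam x w p) u * G x q v) + trace x (\<lambda>u v. G x p u * G x (Gam x w q) v)
        + trace x (\<lambda>u v. G x p (Gam x w u) * G x q v + G x p u * G x q (Gam x w v))"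
    unfolding trace_add[symmetric] T_def
    by (simp add: ddir_mult[OF d d] ddir_G[OF x] algebra_simps)
  also have "trace x (\<lambda>u v. G x (Gam x w p) u * G x q v) = G x q (Gam x w p)"
    by (rule trace_G_left[OF x lin(1)])
  also have "trace x (\<lambda>u v. G x p u * G x (Gam x w q) v) = G x (Gam x w q) p"
    by (rule trace_G_left[OF x lin(1)])
  finally show ?thesis using G_sym[OF x] by (simp add: T_def)
qed

text \<open>At a fixed x both sides are linear in \<open>T\<close>, and \<open>T\<close> is a
  combination of rank one forms in which the frame vectors at x serve as the constants p and
  q.\<close>

lemma dcometric:
  assumes x: "x \<in> S" and T: "bilinear T"
  shows "dcometric w x T = - trace x (\<lambda>u v. T (Gam x w u) v + T u (Gam x w v))"
proof -
  let ?e = "frame x"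
  note expand = inner_form.frame_linear_real[OF inner_form_G[OF x] frame_orthonormal[OF x]]
  have Tl: "linear (\<lambda>u. T u v)" and Tr: "linear (T u)" for u v
    using T by (auto simp: bilinear_def)
  have exp: "T u v = (\<Sum>a\<in>UNIV. \<Sum>b\<in>UNIV. T (?e a) (?e b) * (G x (?e a) u * G x (?e b) v))" for u v
  proof -
    have "T u v = (\<Sum>a\<in>UNIV. G x u (?e a) * (\<Sum>b\<in>UNIV. G x v (?e b) * T (?e a) (?e b)))"
      unfolding expand[OF Tr] expand[OF Tl] ..
    then show ?thesis by (simp add: sum_distrib_left G_sym[OF x, of u] G_sym[OF x, of v] mult_ac)
  qed
  have "dcometric w x T = (\<Sum>a\<in>UNIV. \<Sum>b\<in>UNIV. T (?e a) (?e b) * dcometric w x (\<lambda>u v. G x (?e a) u * G x (?e b) v))"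
  proof -
    have "T = (\<lambda>u v. \<Sum>a\<in>UNIV. \<Sum>b\<in>UNIV. T (?e a) (?e b) * (G x (?e a) u * G x (?e b) v))"
      by (intro ext exp)
    then have "dcometric w x T = dcometric w x
        (\<lambda>u v. \<Sum>a\<in>UNIV. \<Sum>b\<in>UNIV. T (?e a) (?e b) * (G x (?e a) u * G x (?e b) v))"
      by (rule arg_cong)
    then show ?thesis by (simp only: dcometric_sum dcometric_mult)
  qed
  also have "\<dots> = - trace x (\<lambda>u v. (\<Sum>a\<in>UNIV. \<Sum>b\<in>UNIV. T (?e a) (?e b) *
      (G x (?e a) (Gam x w u) * G x (?e b) v)) + (\<Sum>a\<in>UNIV. \<Sum>b\<in>UNIV. T (?e a) (?e b) *
      (G x (?e a) u * G x (?e b) (Gam x w v))))"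
  proof -
    show ?thesis
      unfolding dcometric_rank_one[OF x] trace_add trace_sum trace_mult
      by (simp add: sum_negf right_diff_distrib sum_subtractf)
  qed
  also have "\<dots> = - trace x (\<lambda>u v. T (Gam x w u) v + T u (Gam x w v))"
    by (simp only: exp[symmetric])
  finally show ?thesis .
qed

text \<open>Contraction commutes with covariant differentiation: the derivative of the inverse
  metric supplies exactly the two connection terms of \<nabla>T.\<close>

lemma ddir_trace:
  assumes T: "tens2 S T" and x: "x \<in> S"
  shows "ddir w (\<lambda>y. trace y (T y)) x =
    trace x (\<lambda>u v. ddir w (\<lambda>y. T y u v) x - T x (Gam x w u) v - T x u (Gam x w v))"
  unfolding ddir_trace_raw[OF assms] dcometric[OF x tens2_bilinear[OF T x]]
  by (simp add: trace_def sum_negf sum.distrib sum_subtractf)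

end

context kaehler_chart
begin

section \<open>Covariant derivatives and curvature in a chart\<close>

text \<open>In \<open>nab1\<close> to \<open>nab4\<close> the vector after the point is the
  direction of differentiation. A covariant derivative is thus a tensor with one more slot in front,
  and \<open>nab2 (nab1 T) x a b u\<close> is the second covariant derivative with \<open>a\<close>
  the outer direction.\<close>

definition nab1 :: "(real^'m \<Rightarrow> real^'m \<Rightarrow> real) \<Rightarrow> real^'m \<Rightarrow> real^'m \<Rightarrow> real^'m \<Rightarrow> real" where
  "nab1 T x w u = ddir w (\<lambda>y. T y u) x - T x (Gam x w u)"

definition nab2 :: "(real^'m \<Rightarrow> real^'m \<Rightarrow> real^'m \<Rightarrow> real) \<Rightarrow>
    real^'m \<Rightarrow> real^'m \<Rightarrow> real^'m \<Rightarrow> real^'m \<Rightarrow> real" where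
  "nab2 T x w u v = ddir w (\<lambda>y. T y u v) x - T x (Gam x w u) v - T x u (Gam x w v)"

definition nab3 :: "(real^'m \<Rightarrow> real^'m \<Rightarrow> real^'m \<Rightarrow> real^'m \<Rightarrow> real) \<Rightarrow>
    real^'m \<Rightarrow> real^'m \<Rightarrow> real^'m \<Rightarrow> real^'m \<Rightarrow> real^'m \<Rightarrow> real" where
  "nab3 T x w a u v = ddir w (\<lambda>y. T y a u v) x
    - T x (Gam x w a) u v - T x a (Gam x w u) v - T x a u (Gam x w v)"

definition nab4 :: "(real^'m \<Rightarrow> real^'m \<Rightarrow> real^'m \<Rightarrow> real^'m \<Rightarrow> real^'m \<Rightarrow> real) \<Rightarrow>
    real^'m \<Rightarrow> real^'m \<Rightarrow> real^'m \<Rightarrow> real^'m \<Rightarrow> real^'m \<Rightarrow> real^'m \<Rightarrow> real" where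
  "nab4 T x w a b c d = ddir w (\<lambda>y. T y a b c d) x
    - T x (Gam x w a) b c d - T x a (Gam x w b) c d - T x a b (Gam x w c) d - T x a b c (Gam x w d)"

text \<open>The curvature operator on constant coordinate fields, whose Lie brackets vanish.\<close>

definition Riem :: "real^'m \<Rightarrow> real^'m \<Rightarrow> real^'m \<Rightarrow> real^'m \<Rightarrow> real^'m" where
  "Riem x a b v = ddir a (\<lambda>y. Gam y b v) x - ddir b (\<lambda>y. Gam y a v) x
    + Gam x a (Gam x b v) - Gam x b (Gam x a v)"

definition Rm :: "real^'m \<Rightarrow> real^'m \<Rightarrow> real^'m \<Rightarrow> real^'m \<Rightarrow> real^'m \<Rightarrow> real" where
  "Rm x a b c d = G x (Riem x a b c) d"

definition Ric :: "real^'m \<Rightarrow> real^'m \<Rightarrow> real^'m \<Rightarrow> real" where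
  "Ric x y z = trace x (\<lambda>u v. Rm x u y z v)"

definition Scal :: "real^'m \<Rightarrow> real" where
  "Scal x = trace x (Ric x)"

lemmas G_right = tens2_right[OF G] and G_left = tens2_left[OF G] and G_smooth = tens2_smooth[OF G]
lemmas Gam_right = tens2_right[OF Gam] and Gam_left = tens2_left[OF Gam]
  and Gam_smooth = tens2_smooth[OF Gam]
lemmas G_bilinear = tens2_bilinear[OF G] and Gam_bilinear = tens2_bilinear[OF Gam]
lemmas linear_J = tens1_linear[OF J] and J_smooth = tens1_smooth[OF J]
lemmas differentiable = smooth_on_differentiable[OF S]

section \<open>Linearity and smoothness of the curvature in each slot\<close>

lemma tens1_neg: "tens1 S T \<Longrightarrow> tens1 S (\<lambda>x u. - T x u :: 'w::real_normed_vector)"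
  using tens1_scaleR[OF S smooth_on_const[of S "- 1"], of T] by simp

lemma Riem_skew: "Riem x b a v = - Riem x a b v"
  by (simp add: Riem_def)

lemma tens1_Riem3: "tens1 S (\<lambda>x v. Riem x a b v)"
  unfolding Riem_def
  by (intro tens1_diff[OF S] tens1_add[OF S] tens1_ddir[OF S, OF Gam_right]
      tens1_comp[OF S, OF Gam_right Gam_right])

lemma tens1_Riem2: "tens1 S (\<lambda>x b. Riem x a b v)"
  unfolding Riem_def
  by (intro tens1_diff[OF S] tens1_add[OF S] tens1_ddir[OF S, OF Gam_left] tens1_dir[OF S] Gam_smooth
      tens1_comp[OF S, OF Gam_right Gam_left] tens2_apply_right[OF S Gam])

lemma tens1_Riem1: "tens1 S (\<lambda>x a. Riem x a b v)"
  using tens1_neg[OF tens1_Riem2[of b v]] Riem_skew[of _ _ b v] by simp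

lemma tens1_Rm1: "tens1 S (\<lambda>x a. Rm x a b c d)"
  unfolding Rm_def by (rule tens1_comp[OF S, OF G_left tens1_Riem1])

lemma tens1_Rm2: "tens1 S (\<lambda>x b. Rm x a b c d)"
  unfolding Rm_def by (rule tens1_comp[OF S, OF G_left tens1_Riem2])

lemma tens1_Rm3: "tens1 S (\<lambda>x c. Rm x a b c d)"
  unfolding Rm_def by (rule tens1_comp[OF S, OF G_left tens1_Riem3])

lemma tens1_Rm4: "tens1 S (\<lambda>x d. Rm x a b c d)"
  unfolding Rm_def by (rule tens2_apply_left[OF S G tens1_smooth[OF tens1_Riem3]])

lemmas tens2_Rm = tens2I[OF S tens1_Rm2 tens1_Rm1] tens2I[OF S tens1_Rm4 tens1_Rm1]
  tens2I[OF S tens1_Rm4 tens1_Rm2] tens2I[OF S tens1_Rm4 tens1_Rm3]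

lemma ricci_identity1:
  assumes T: "tens1 S T" and x: "x \<in> S"
  shows "nab2 (nab1 T) x a b u - nab2 (nab1 T) x b a u = - T x (Riem x a b u)"
proof -
  \<comment> \<open>After exchanging \<open>a\<close> and \<open>b\<close>, the second partial
    derivatives of \<open>T\<close> cancel, and so do the terms with one derivative of
    \<open>T\<close>, by symmetry of \<open>Gam\<close>. Only derivatives and products of
    \<open>Gam\<close> survive, and they form \<open>Riem\<close>.\<close>
  have D: "ddir a (\<lambda>y. nab1 T y b u) x = ddir a (ddir b (\<lambda>y. T y u)) x
      - (ddir a (\<lambda>y. T y (Gam x b u)) x + T x (ddir a (\<lambda>y. Gam y b u) x))" for a b
    unfolding nab1_def
    by (simp add: ddir_diff differentiable[OF _ x] smooth_on_ddir tens1_smooth[OF T]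
        smooth_on_apply[OF S T] Gam_smooth ddir_apply[OF S T Gam_smooth x])
  note lin = tens1_linear[OF T x]
  show ?thesis
    unfolding nab2_def[of "nab1 T"] D
    using ddir_commute_real[OF S tens1_smooth[OF T] x, of a b u] Gam_sym[OF x, of a b]
    by (simp add: nab1_def Riem_def linear_add[OF lin] linear_diff[OF lin])
qed

text \<open>The same cancellation in each slot. The mixed terms T (Gam a u) (Gam b v) + T (Gam b u)
  (Gam a v) are symmetric in a and b and drop out too.\<close>

lemma ricci_identity2:
  assumes T: "tens2 S T" and x: "x \<in> S"
  shows "nab3 (nab2 T) x a b u v - nab3 (nab2 T) x b a u v
    = - T x (Riem x a b u) v - T x u (Riem x a b v)"
proof -
  have D: "ddir a (\<lambda>y. nab2 T y b u v) x = ddir a (ddir b (\<lambda>y. T y u v)) x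
      - (ddir a (\<lambda>y. T y (Gam x b u) v) x + T x (ddir a (\<lambda>y. Gam y b u) x) v)
      - (ddir a (\<lambda>y. T y u (Gam x b v)) x + T x u (ddir a (\<lambda>y. Gam y b v) x))" for a b
    unfolding nab2_def
    by (simp add: ddir_diff differentiable[OF _ x] smooth_on_ddir tens2_smooth[OF T] smooth_on_diff[OF S]
        smooth_on_apply[OF S tens2_left[OF T]] smooth_on_apply[OF S tens2_right[OF T]] Gam_smooth
        ddir_apply[OF S tens2_left[OF T] Gam_smooth x] ddir_apply[OF S tens2_right[OF T] Gam_smooth x])
  note bil = tens2_bilinear[OF T x]
  show ?thesis
    unfolding nab3_def[of "nab2 T"] D
    using ddir_commute_real[OF S tens2_smooth[OF T] x, of a b u v] Gam_sym[OF x, of a b]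
    by (simp add: nab2_def Riem_def bilinear_ladd[OF bil] bilinear_radd[OF bil]
        bilinear_lsub[OF bil] bilinear_rsub[OF bil])
qed

lemma Riem_bianchi:
  assumes x: "x \<in> S"
  shows "Riem x a b c + Riem x b c a + Riem x c a b = 0"
proof -
  have "ddir a (\<lambda>y. Gam y b c) x = ddir a (\<lambda>y. Gam y c b) x" for a b c
    by (rule ddir_transform[OF S x]) (rule Gam_sym)
  from this[of a b c] this[of b c a] this[of c a b] show ?thesis
    unfolding Riem_def Gam_sym[OF x, of c b] Gam_sym[OF x, of c a] Gam_sym[OF x, of b a] by simp
qed

lemma nab2_G: "x \<in> S \<Longrightarrow> nab2 G x w u v = 0"
  by (simp add: nab2_def ddir_G)

lemma nab3_zero:
  assumes "x \<in> S" "\<And>x a u v. x \<in> S \<Longrightarrow> T x a u v = 0"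
  shows "nab3 T x w a u v = 0"
  using ddir_transform[OF S assms(1), of "\<lambda>y. T y a u v" "\<lambda>y. 0" w] assms by (simp add: nab3_def)

lemma Rm_skew12: "x \<in> S \<Longrightarrow> Rm x b a c d = - Rm x a b c d"
  unfolding Rm_def by (subst Riem_skew) (simp add: bilinear_lneg[OF G_bilinear])

text \<open>The Ricci identity for the metric itself: its left side vanishes because \<nabla>G =
  0.\<close>

lemma Rm_skew34: "x \<in> S \<Longrightarrow> Rm x a b d c = - Rm x a b c d"
  using ricci_identity2[OF G, of x a b c d] nab3_zero[of x "nab2 G", OF _ nab2_G]
    G_sym[of x "Riem x a b d" c]
  by (simp add: Rm_def)

lemma Rm_bianchi: "x \<in> S \<Longrightarrow> Rm x a b c d + Rm x b c a d + Rm x c a b d = 0"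
  unfolding Rm_def
  by (simp add: bilinear_ladd[OF G_bilinear, symmetric] Riem_bianchi bilinear_lzero[OF G_bilinear])

text \<open>The octahedron argument: the four first Bianchi identities arising from rotations of a,
  b, c, d, combined with both skew symmetries.\<close>

lemma Rm_pair_sym:
  assumes x: "x \<in> S"
  shows "Rm x c d a b = Rm x a b c d"
  using Rm_bianchi[OF x, of a b c d] Rm_bianchi[OF x, of b c d a] Rm_bianchi[OF x, of c d a b]
    Rm_bianchi[OF x, of d a b c]
    Rm_skew12[OF x, of a b c d] Rm_skew34[OF x, of a b c d]
    Rm_skew34[OF x, of b c a d]  Rm_skew34[OF x, of c a b d] Rm_skew34[OF x, of c d b a]
    Rm_skew34[OF x, of d b c a] Rm_skew34[OF x, of d a c b] Rm_skew34[OF x, of a c d b]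
    Rm_skew34[OF x, of b d a c] Rm_skew34[OF x, of a b d c] Rm_skew12[OF x, of a c d b] Rm_skew12[OF x, of b d a c]
    Rm_skew12[OF x, of b d c a]  Rm_skew12[OF x, of a c b d] 
  by linarith

text \<open>Second derivatives of J commute. With \<nabla>J = 0 substituted twice, their difference
  is the commutator of the curvature with J.\<close>

lemma Riem_J:
  assumes x: "x \<in> S"
  shows "Riem x a b (J x v) = J x (Riem x a b v)"
proof -
  have lG: "linear (Gam x a)" for a using tens1_linear[OF Gam_right x] .
  have D: "ddir a (ddir b (\<lambda>y. J y v)) x =
      J x (Gam x a (Gam x b v)) - Gam x a (J x (Gam x b v)) + J x (ddir a (\<lambda>y. Gam y b v) x)
      - (ddir a (\<lambda>y. Gam y b (J x v)) x + Gam x b (J x (Gam x a v)) - Gam x b (Gam x a (J x v)))" for a b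
  proof -
    have "ddir a (ddir b (\<lambda>y. J y v)) x = ddir a (\<lambda>y. J y (Gam y b v) - Gam y b (J y v)) x"
      by (rule ddir_transform[OF S x]) (rule ddir_J)
    also have "\<dots> = ddir a (\<lambda>y. J y (Gam y b v)) x - ddir a (\<lambda>y. Gam y b (J y v)) x"
      by (rule ddir_diff) (intro differentiable[OF _ x] smooth_on_apply[OF S J] smooth_on_apply[OF S Gam_right]
          Gam_smooth J_smooth)+
    finally show ?thesis
      unfolding ddir_apply[OF S J Gam_smooth x] ddir_apply[OF S Gam_right J_smooth x]
      by (simp add: ddir_J[OF x] linear_diff[OF lG])
  qed
  have "ddir a (ddir b (\<lambda>y. J y v)) x = ddir b (ddir a (\<lambda>y. J y v)) x"
    by (rule ddir_commute[OF S J_smooth x])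
  then show ?thesis
    unfolding D Riem_def by (simp add: linear_add[OF linear_J[OF x]] linear_diff[OF linear_J[OF x]] algebra_simps)
qed

lemma Rm_J34: "x \<in> S \<Longrightarrow> Rm x a b (J x c) (J x d) = Rm x a b c d"
  by (simp add: Rm_def Riem_J G_J)

lemma Rm_J12: "x \<in> S \<Longrightarrow> Rm x (J x a) (J x b) c d = Rm x a b c d"
  using Rm_J34[of x c d a b] Rm_pair_sym by simp

section \<open>The Ricci tensor and the scalar curvature\<close>

lemma Ric_sym: "x \<in> S \<Longrightarrow> Ric x z y = Ric x y z"
proof -
  assume x: "x \<in> S"
  have "Rm x v z y u = Rm x u y z v" for u v
    using Rm_pair_sym[OF x, of v z y u] Rm_skew12[OF x, of u y v z] Rm_skew34[OF x, of u y z v] by simp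
  then have "Ric x z y = trace x (\<lambda>u v. Rm x v y z u)" by (simp add: Ric_def)
  also have "\<dots> = Ric x y z" unfolding Ric_def by (rule trace_swap)
  finally show ?thesis .
qed

lemma Ric_J: 
  assumes x: "x \<in> S"
  shows "Ric x (J x y) (J x z) = Ric x y z"
proof -
  have "Ric x (J x y) (J x z) = trace x (\<lambda>u v. Rm x (J x u) (J x y) (J x z) (J x v))"
    unfolding Ric_def
    by (rule trace_J[OF x tens2_bilinear[OF tens2_Rm(2) x], symmetric])
  then show ?thesis by (simp add: Ric_def Rm_J12[OF x] Rm_J34[OF x])
qed

lemma tens2_Ric: "tens2 S Ric"
proof -
  have "smooth_on S (\<lambda>x. Ric x y z)" for y z
    unfolding Ric_def by (rule smooth_trace[OF tens2_Rm(2)])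
  moreover have "linear (Ric x y)" "linear (\<lambda>y. Ric x y z)" if x: "x \<in> S" for x y z
    using linear_add[OF tens1_linear[OF tens1_Rm3 x]] linear_cmul[OF tens1_linear[OF tens1_Rm3 x]]
      linear_add[OF tens1_linear[OF tens1_Rm2 x]] linear_cmul[OF tens1_linear[OF tens1_Rm2 x]]
    by (auto intro!: linearI simp: Ric_def trace_add trace_mult)
  ultimately show ?thesis by (auto intro!: tens2I[OF S] tens1I)
qed

lemma smooth_Scal: "smooth_on S Scal"
  using smooth_trace[OF tens2_Ric] by (simp add: Scal_def[abs_def])

section \<open>The covariant derivative of the curvature and its contractions\<close>

lemma nab4_Rm:
  assumes x: "x \<in> S"
  shows "nab4 Rm x a b c z w = G x (ddir a (\<lambda>y. Riem y b c z) x + Gam x a (Riem x b c z)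
    - Riem x (Gam x a b) c z - Riem x b (Gam x a c) z - Riem x b c (Gam x a z)) w"
  unfolding nab4_def Rm_def ddir_apply[OF S G_left tens1_smooth[OF tens1_Riem3] x]
  by (simp add: ddir_G[OF x] bilinear_ladd[OF G_bilinear[OF x]] bilinear_lsub[OF G_bilinear[OF x]])

lemma nab4_Rm_bianchi:
  assumes x: "x \<in> S"
  shows "nab4 Rm x a b c z w + nab4 Rm x b c a z w + nab4 Rm x c a b z w = 0"
proof -
  \<comment> \<open>\<nabla>Riem before pairing with \<open>w\<close>. The cyclic sum vanishes
    already here: second derivatives of \<open>Gam\<close> commute, and the remaining products
    cancel through torsion freeness.\<close>
  define N where "N a b c = ddir a (\<lambda>y. Riem y b c z) x + Gam x a (Riem x b c z)
    - Riem x (Gam x a b) c z - Riem x b (Gam x a c) z - Riem x b c (Gam x a z)" for a b c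
  have lG: "linear (Gam x a)" for a using tens1_linear[OF Gam_right x] .
  have D: "ddir a (\<lambda>y. Riem y b c z) x =
      ddir a (ddir b (\<lambda>y. Gam y c z)) x - ddir a (ddir c (\<lambda>y. Gam y b z)) x
      + (ddir a (\<lambda>y. Gam y b (Gam x c z)) x + Gam x b (ddir a (\<lambda>y. Gam y c z) x))
      - (ddir a (\<lambda>y. Gam y c (Gam x b z)) x + Gam x c (ddir a (\<lambda>y. Gam y b z) x))" for a b c
    unfolding Riem_def
    by (simp add: ddir_diff ddir_add differentiable[OF _ x] smooth_on_ddir smooth_on_diff[OF S] smooth_on_add[OF S]
        smooth_on_apply[OF S Gam_right] Gam_smooth ddir_apply[OF S Gam_right Gam_smooth x])
  note comm = ddir_commute[OF S Gam_smooth x]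
  have "N a b c + N b c a + N c a b = 0"
    unfolding N_def D comm[of b a] comm[of c a] comm[of c b] Riem_skew[of x "Gam x _ _"]
      Gam_sym[OF x, of b a] Gam_sym[OF x, of c a] Gam_sym[OF x, of c b]
    by (simp add: Riem_def linear_add[OF lG] linear_diff[OF lG] )
  then show ?thesis
    unfolding nab4_Rm[OF x] N_def[symmetric] bilinear_ladd[OF G_bilinear[OF x], symmetric]
    by (simp add: bilinear_lzero[OF G_bilinear[OF x]])
qed

lemma nab4_Rm_skew12:
  assumes x: "x \<in> S"
  shows "nab4 Rm x w b a c d = - nab4 Rm x w a b c d"
proof -
  have "ddir w (\<lambda>y. Rm y b a c d) x = ddir w (\<lambda>y. - Rm y a b c d) x"
    by (rule ddir_transform[OF S x]) (rule Rm_skew12)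
  also have "\<dots> = - ddir w (\<lambda>y. Rm y a b c d) x"
    by (rule ddir_linear[OF bounded_linear_minus[OF bounded_linear_ident]])
      (rule differentiable[OF tens1_smooth[OF tens1_Rm3] x])
  finally show ?thesis
    by (simp add: nab4_def Rm_skew12[OF x, of b a] Rm_skew12[OF x, of "Gam x w b" a]
        Rm_skew12[OF x, of b "Gam x w a"])
qed

lemma nab4_Rm_skew34:
  assumes x: "x \<in> S"
  shows "nab4 Rm x w a b d c = - nab4 Rm x w a b c d"
proof -
  have "ddir w (\<lambda>y. Rm y a b d c) x = ddir w (\<lambda>y. - Rm y a b c d) x"
    by (rule ddir_transform[OF S x]) (rule Rm_skew34)
  also have "\<dots> = - ddir w (\<lambda>y. Rm y a b c d) x"
    by (rule ddir_linear[OF bounded_linear_minus[OF bounded_linear_ident]])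
      (rule differentiable[OF tens1_smooth[OF tens1_Rm3] x])
  finally show ?thesis
    by (simp add: nab4_def Rm_skew34[OF x, of _ _ d c] Rm_skew34[OF x, of _ _ "Gam x w d" c]
        Rm_skew34[OF x, of _ _ d "Gam x w c"])
qed

lemma nab4_Rm_minus3:
  assumes x: "x \<in> S"
  shows "nab4 Rm x w a b (- c) d = - nab4 Rm x w a b c d"
  by (simp add: nab4_def linear_neg[OF tens1_linear[OF tens1_Rm3 x]]
      linear_neg[OF linear_ddir_tens1[OF S tens1_Rm3 x]] linear_neg[OF tens1_linear[OF Gam_right x]])

text \<open>As J is parallel, inserting it into both slots commutes with covariant differentiation.
  On the left J varies with y under the derivative, on the right it is frozen at x.\<close>

lemma ddir_J2:
  assumes T: "tens2 S T" and x: "x \<in> S"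
  shows "ddir w (\<lambda>y. T y (J y a) (J y b)) x - T x (J x (Gam x w a)) (J x b) - T x (J x a) (J x (Gam x w b))
    = ddir w (\<lambda>y. T y (J x a) (J x b)) x - T x (Gam x w (J x a)) (J x b) - T x (J x a) (Gam x w (J x b))"
  unfolding ddir_apply2[OF S T J_smooth J_smooth x]
  by (simp add: ddir_J[OF x] bilinear_lsub[OF tens2_bilinear[OF T x]] bilinear_rsub[OF tens2_bilinear[OF T x]])

lemma nab2_J:
  assumes T: "tens2 S T" and x: "x \<in> S" and TJ: "\<And>x u v. x \<in> S \<Longrightarrow> T x (J x u) (J x v) = T x u v"
  shows "nab2 T x w (J x a) (J x b) = nab2 T x w a b"
  using ddir_J2[OF T x, of w a b] TJ[OF x]
    ddir_transform[OF S x, of "\<lambda>y. T y (J y a) (J y b)" "\<lambda>y. T y a b" w, OF TJ]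
  by (simp add: nab2_def)

lemma nab4_Rm_J12:
  assumes x: "x \<in> S"
  shows "nab4 Rm x w (J x a) (J x b) c d = nab4 Rm x w a b c d"
  using ddir_J2[OF tens2_Rm(1) x, of w a b c d] 
    ddir_transform[OF S x, of "\<lambda>y. Rm y (J y a) (J y b) c d" "\<lambda>y. Rm y a b c d" w] Rm_J12
  by (simp add: nab4_def Rm_J12[OF x])

lemma nab4_Rm_J34:
  assumes x: "x \<in> S"
  shows "nab4 Rm x w a b (J x c) (J x d) = nab4 Rm x w a b c d"
  using ddir_J2[OF tens2_Rm(4) x, of w a b c d] 
    ddir_transform[OF S x, of "\<lambda>y. Rm y a b (J y c) (J y d)" "\<lambda>y. Rm y a b c d" w] Rm_J34
  by (simp add: nab4_def Rm_J34[OF x])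

lemma nab2_Ric:
  assumes x: "x \<in> S"
  shows "nab2 Ric x w y z = trace x (\<lambda>u v. nab4 Rm x w u y z v)"
proof -
  have "ddir w (\<lambda>q. Ric q y z) x = trace x (\<lambda>u v. ddir w (\<lambda>q. Rm q u y z v) x
      - Rm x (Gam x w u) y z v - Rm x u y z (Gam x w v))"
    unfolding Ric_def by (rule ddir_trace[OF tens2_Rm(2) x])
  then show ?thesis
    by (simp add: nab2_def nab4_def Ric_def trace_diff)
qed

lemma nab2_sym:
  assumes x: "x \<in> S" and T: "\<And>x u v. x \<in> S \<Longrightarrow> T x u v = T x v u"
  shows "nab2 T x w u v = nab2 T x w v u"
  using ddir_transform[OF S x, of "\<lambda>y. T y u v" "\<lambda>y. T y v u" w, OF T] T[OF x] by (simp add: nab2_def)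

text \<open>The second Bianchi identity contracted once: the failure of \<nabla>Ric to be symmetric
  in its first two arguments is a divergence of the curvature.\<close>

lemma nab2_Ric_commute:
  assumes x: "x \<in> S"
  shows "nab2 Ric x w y z - nab2 Ric x y w z = trace x (\<lambda>u v. nab4 Rm x u w y z v)"
proof -
  have "nab4 Rm x u w y z v = nab4 Rm x w u y z v - nab4 Rm x y u w z v" for u v
    using nab4_Rm_bianchi[OF x, of w u y z v] nab4_Rm_skew12[OF x, of u y w z v] nab4_Rm_skew12[OF x, of y u w z v]
    by simp
  then show ?thesis by (simp add: nab2_Ric[OF x] trace_diff)
qed

lemma linear_nab2:
  assumes T: "tens2 S T" and x: "x \<in> S"
  shows "linear (\<lambda>w. nab2 T x w u v)" "linear (\<lambda>u. nab2 T x w u v)" "linear (\<lambda>v. nab2 T x w u v)"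
  unfolding nab2_def
  by (intro linear_compose_sub linear_ddir[OF differentiable[OF tens2_smooth[OF T] x]]
      linear_ddir_tens1[OF S tens2_left[OF T] x] linear_ddir_tens1[OF S tens2_right[OF T] x]
      tens1_linear[OF tens2_left[OF T] x] tens1_linear[OF tens2_right[OF T] x]
      linear_compose[unfolded o_def, OF tens1_linear[OF Gam_left x] tens1_linear[OF tens2_left[OF T] x]]
      linear_compose[unfolded o_def, OF tens1_linear[OF Gam_left x] tens1_linear[OF tens2_right[OF T] x]]
      linear_compose[unfolded o_def, OF tens1_linear[OF Gam_right x] tens1_linear[OF tens2_left[OF T] x]]
      linear_compose[unfolded o_def, OF tens1_linear[OF Gam_right x] tens1_linear[OF tens2_right[OF T] x]])+

lemma trace_nab2: "x \<in> S \<Longrightarrow> tens2 S T \<Longrightarrow> trace x (nab2 T x w) = ddir w (\<lambda>y. trace y (T y)) x"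
  by (simp add: ddir_trace nab2_def[abs_def])

text \<open>The once contracted Bianchi identity is contracted again. Exchanging both skew pairs
  costs two signs and turns its right side into the divergence of \<open>Ric\<close> once more,
  whence the factor 2.\<close>

lemma div_Ric:
  assumes x: "x \<in> S"
  shows "2 * trace x (\<lambda>u v. nab2 Ric x u w v) = ddir w Scal x"
proof -
  have "trace x (nab2 Ric x w) - trace x (\<lambda>u v. nab2 Ric x u w v)
      = trace x (\<lambda>p q. trace x (\<lambda>u v. nab4 Rm x u w p q v))"
    by (simp add: trace_diff[symmetric] nab2_Ric_commute[OF x])
  also have "\<dots> = trace x (\<lambda>u v. trace x (\<lambda>p q. nab4 Rm x u p w v q))"
  proof -
    have "nab4 Rm x u w p q v = nab4 Rm x u p w v q" for u v p q
      using nab4_Rm_skew12[OF x, of u w p v q] nab4_Rm_skew34[OF x, of u w p v q] by simp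
    then show ?thesis
      unfolding trace_def by simp (rule sum.swap)
  qed
  also have "\<dots> = trace x (\<lambda>u v. nab2 Ric x u w v)"
    by (simp add: nab2_Ric[OF x])
  finally show ?thesis
    using trace_nab2[OF x tens2_Ric, of w] by (simp add: Scal_def[abs_def])
qed

end

section \<open>Bochner-flat charts\<close>

text \<open>The right side of the Bochner condition with real vectors in the slots of the basis
  elements. It is compared with \<open>Rm\<close> only after subtracting the same expression with J
  applied to b and d.\<close>

definition (in kaehler_chart) bochner_form ::
  "nat \<Rightarrow> real^'m \<Rightarrow> real^'m \<Rightarrow> real^'m \<Rightarrow> real^'m \<Rightarrow> real^'m \<Rightarrow> real" where
  "bochner_form n x a b c d =
    1 / (real n + 2) * (G x a b * Ric x c d + G x c b * Ric x a d + G x c d * Ric x a b + G x a d * Ric x c b)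
    - 1 / (2 * (real n + 1) * (real n + 2)) * (Scal x * (G x a b * G x c d + G x c b * G x a d))"

text \<open>The real part of the Bochner-Kaehler condition on the vectors \<open>a - iJa\<close>, \<open>b + iJb\<close>,
  \<open>c - iJc\<close>, \<open>d + iJd\<close>, divided by 4.\<close>

locale bochner_chart = kaehler_chart S G Gam J
  for S :: "(real^'m::finite) set" and G Gam J +
  fixes n :: nat
  assumes dim: "CARD('m) = 2 * n" and n: "n \<ge> 2"
    and bochner: "x \<in> S \<Longrightarrow> Rm x a b c d - Rm x a (J x b) c (J x d)
      = bochner_form n x a b c d - bochner_form n x a (J x b) c (J x d)"
begin

abbreviation "P \<equiv> nab2 Ric"
abbreviation "dS x w \<equiv> ddir w Scal x"

text \<open>The metric is parallel, so the derivative falls on \<open>Ric\<close> and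
  \<open>Scal\<close> alone.\<close>

lemma nab4_bochner_form:
  assumes x: "x \<in> S"
  shows "nab4 (bochner_form n) x w a b c d =
    1 / (real n + 2) * (G x a b * P x w c d + G x c b * P x w a d + G x c d * P x w a b + G x a d * P x w c b)
    - 1 / (2 * (real n + 1) * (real n + 2)) * (dS x w * (G x a b * G x c d + G x c b * G x a d))"
proof -
  define k1 where "k1 = 1 / (real n + 2)"
  define k2 where "k2 = 1 / (2 * (real n + 1) * (real n + 2))"
  show ?thesis
    unfolding nab4_def bochner_form_def k1_def[symmetric] k2_def[symmetric]
    by (simp add: ddir_diff ddir_add ddir_mult differentiable[OF _ x] smooth_on_mult S smooth_on_add
      smooth_on_const G_smooth tens2_smooth[OF tens2_Ric] smooth_Scal nab2_def ddir_G[OF x] algebra_simps)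
qed

lemma tens2_bochner_form: "tens2 S (\<lambda>x b d. bochner_form n x a b c d)"
  unfolding bochner_form_def
  by (intro tens2I[OF S] tens1_diff[OF S] tens1_add[OF S] tens1_mult[OF S] smooth_on_const
      smooth_on_mult smooth_on_add S G_smooth smooth_Scal
      tens1_mult_right[OF S, of _ "\<lambda>x b. G x _ b"] tens1_mult_right[OF S, of _ "\<lambda>x b. Ric x _ b"]
      tens2_smooth[OF tens2_Ric] G_right tens2_right[OF tens2_Ric])

text \<open>The Bochner identity is differentiated. \<open>ddir_J2\<close> absorbs the derivative of
  J, and the connection terms are instances of the identity with one argument replaced by its image
  under \<open>Gam x w\<close>.\<close>

lemma nab4_bochner:
  assumes x: "x \<in> S"
  shows "nab4 Rm x w a b c d - nab4 Rm x w a (J x b) c (J x d)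
    = nab4 (bochner_form n) x w a b c d - nab4 (bochner_form n) x w a (J x b) c (J x d)"
proof -
  have d: "ddir w (\<lambda>y. T y a b c d - T y a (J y b) c (J y d)) x
      = ddir w (\<lambda>y. T y a b c d) x - ddir w (\<lambda>y. T y a (J y b) c (J y d)) x"
    if "tens2 S (\<lambda>x b d. T x a b c d)" for T :: "real^'m \<Rightarrow> real^'m \<Rightarrow> real^'m \<Rightarrow> real^'m \<Rightarrow> real^'m \<Rightarrow> real"
    using differentiable[OF tens2_smooth[OF that] x] 
      differentiable[OF tens2_smooth_apply[OF S that J_smooth J_smooth] x] by (rule ddir_diff)
  have "ddir w (\<lambda>y. Rm y a b c d - Rm y a (J y b) c (J y d)) x
    = ddir w (\<lambda>y. bochner_form n y a b c d - bochner_form n y a (J y b) c (J y d)) x"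
    by (rule ddir_transform[OF S x]) (rule bochner)
  then show ?thesis
    unfolding d[of Rm, OF tens2_Rm(3)] d[of "bochner_form n", OF tens2_bochner_form]
    using ddir_J2[OF tens2_Rm(3) x, of w a b c d] ddir_J2[OF tens2_bochner_form x, of w a b c d]
      bochner[OF x, of "Gam x w a" b c d] bochner[OF x, of a "Gam x w b" c d]
      bochner[OF x, of a b "Gam x w c" d] bochner[OF x, of a b c "Gam x w d"]
    unfolding nab4_def by linarith
qed

lemma P_sym: "x \<in> S \<Longrightarrow> P x w u v = P x w v u"
  by (rule nab2_sym[OF _ Ric_sym])

lemma P_J: "x \<in> S \<Longrightarrow> P x w (J x u) (J x v) = P x w u v"
  by (rule nab2_J[OF tens2_Ric _ Ric_J])

lemmas linear_P = linear_nab2[OF tens2_Ric]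

lemma P_J_right: "x \<in> S \<Longrightarrow> P x w u (J x v) = - P x w (J x u) v"
  using P_J[of x w u "J x v"] by (simp add: JJ linear_neg[OF linear_P(3)])

text \<open>Both sides are divergences of the curvature, which does not change when J acts on its
  first pair.\<close>

lemma P_commute_J:
  assumes x: "x \<in> S"
  shows "P x w y z - P x y w z = P x (J x w) (J x y) z - P x (J x y) (J x w) z"
  using nab2_Ric_commute[OF x, of w y z] nab2_Ric_commute[OF x, of "J x w" "J x y" z]
  by (simp add: nab4_Rm_J12[OF x])

lemma linear_dS: "x \<in> S \<Longrightarrow> linear (dS x)"
  by (rule linear_ddir[OF differentiable[OF smooth_Scal]])

text \<open>The divergence of the Bochner identity: its left side is computed with the second Bianchi
  identity, its right side with \<open>div Ric = dScal / 2\<close>.\<close>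

lemma bochner_nab_Ric_J:
  assumes x: "x \<in> S"
  shows "P x w z y + P x (J x w) z (J x y) = 1 / (2 * (real n + 1)) *
    (G x w y * dS x z + G x z y * dS x w + G x w (J x y) * dS x (J x z) + G x z (J x y) * dS x (J x w))"
proof -
  define k1 where "k1 = 1 / (real n + 2)"
  define k2 where "k2 = 1 / (2 * (real n + 1) * (real n + 2))"
  \<comment> \<open>The unknown of the computation: both sides of the traced identity are expressed
    through this J-twisted sum.\<close>
  define s where "s w z y = P x w z y + P x (J x w) z (J x y)" for w z y
  have R1: "trace x (\<lambda>u v. nab4 Rm x u w y z v) = P x w y z - P x y w z"
    by (simp add: nab2_Ric_commute[OF x])
  \<comment> \<open>J moves from the traced slot to \<open>z\<close> at the price of a sign, after
    which the contracted Bianchi identity applies.\<close>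
  have R2: "trace x (\<lambda>u v. nab4 Rm x u w (J x y) z (J x v)) = - (P x w (J x y) (J x z) - P x (J x y) w (J x z))"
  proof -
    have "nab4 Rm x u w (J x y) z (J x v) = - nab4 Rm x u w (J x y) (J x z) v" for u v
      using nab4_Rm_J34[OF x, of u w "J x y" "J x z" v] by (simp add: JJ[OF x] nab4_Rm_minus3[OF x])
    then show ?thesis by (simp add: nab2_Ric_commute[OF x] trace_minus)
  qed
  have tg: "trace x (\<lambda>u v. f u * G x p v) = f p" "trace x (\<lambda>u v. G x p v * f u) = f p" if "linear f" for f p
    using trace_G_left[OF x that, of p] trace_swap[of x "\<lambda>u v. G x p u * f v"] by (simp_all add: mult.commute)
  have tJ: "trace x (\<lambda>u v. f u * G x p (J x v)) = - f (J x p)" "trace x (\<lambda>u v. G x p (J x v) * f u) = - f (J x p)"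
    if "linear f" for f p
    using trace_G_J_left[OF x that, of p] trace_swap[of x "\<lambda>u v. G x p (J x u) * f v"] by (simp_all add: mult.commute)
  have div: "trace x (\<lambda>u v. P x u p v) = dS x p / 2" for p
    using div_Ric[OF x, of p] by simp
  have divJ: "trace x (\<lambda>u v. P x u p (J x v)) = - dS x (J x p) / 2" for p
    using div[of "J x p"] by (simp add: P_J_right[OF x] trace_minus)
  have K1: "trace x (\<lambda>u v. nab4 (bochner_form n) x u w y z v) =
    k1 * (G x w y * (dS x z / 2) + G x z y * (dS x w / 2) + P x z w y + P x w z y)
    - k2 * (G x w y * dS x z + G x z y * dS x w)"
    unfolding nab4_bochner_form[OF x] k1_def[symmetric] k2_def[symmetric]
    by (simp add: trace_diff trace_mult trace_add div tg linear_P[OF x] linear_dS[OF x] distrib_left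
       mult.left_commute[of "dS x _"])
  have K2: "trace x (\<lambda>u v. nab4 (bochner_form n) x u w (J x y) z (J x v)) =
    k1 * (G x w (J x y) * (- dS x (J x z) / 2) + G x z (J x y) * (- dS x (J x w) / 2)
      - P x (J x z) w (J x y) - P x (J x w) z (J x y))
    - k2 * (- (G x w (J x y) * dS x (J x z)) - G x z (J x y) * dS x (J x w))"
    unfolding nab4_bochner_form[OF x] k1_def[symmetric] k2_def[symmetric]
    by (simp add: trace_diff trace_mult trace_add divJ tJ linear_P[OF x] linear_dS[OF x] distrib_left
       right_diff_distrib mult.left_commute[of "dS x _"])
  have "(P x w y z - P x y w z) + (P x w (J x y) (J x z) - P x (J x y) w (J x z)) =
     k1 * (G x w y * (dS x z / 2) + G x z y * (dS x w / 2) + P x z w y + P x w z y)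
    - k2 * (G x w y * dS x z + G x z y * dS x w)
    - (k1 * (G x w (J x y) * (- dS x (J x z) / 2) + G x z (J x y) * (- dS x (J x w) / 2)
      - P x (J x z) w (J x y) - P x (J x w) z (J x y))
    - k2 * (- (G x w (J x y) * dS x (J x z)) - G x z (J x y) * dS x (J x w)))"
    unfolding K1[symmetric] K2[symmetric] trace_diff[symmetric] nab4_bochner[OF x, symmetric]
    unfolding trace_diff R1 R2 by simp
  \<comment> \<open>J-invariance of \<open>Ric\<close> doubles the first term, and
    \<open>P_commute_J\<close> trades the two terms differentiated along \<open>y\<close> and
    \<open>J x y\<close> for the twisted half of \<open>s\<close>.\<close>
  moreover have "(P x w y z - P x y w z) + (P x w (J x y) (J x z) - P x (J x y) w (J x z)) = s w z y"
    using P_commute_J[OF x, of w y z] P_J_right[OF x, of "J x w" y z] P_J_right[OF x, of "J x y" w z]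
      P_J[OF x, of w y z] P_sym[OF x, of w y z] P_sym[OF x, of "J x w" z "J x y"]
    unfolding s_def by linarith
  \<comment> \<open>This symmetry merges the two values of \<open>s\<close> on the right side,
    leaving a linear equation for a single unknown.\<close>
  moreover have "s z w y = s w z y"
    using P_commute_J[OF x, of w z y] P_J_right[OF x, of "J x w" z y] P_J_right[OF x, of "J x z" w y]
    unfolding s_def by linarith
  moreover have "k1 * (G x w y * (dS x z / 2) + G x z y * (dS x w / 2) + P x z w y + P x w z y)
    - k2 * (G x w y * dS x z + G x z y * dS x w)
    - (k1 * (G x w (J x y) * (- dS x (J x z) / 2) + G x z (J x y) * (- dS x (J x w) / 2)
      - P x (J x z) w (J x y) - P x (J x w) z (J x y))
    - k2 * (- (G x w (J x y) * dS x (J x z)) - G x z (J x y) * dS x (J x w)))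
    = k1 * (s w z y + s z w y) + (k1 / 2 - k2) *
     (G x w y * dS x z + G x z y * dS x w + G x w (J x y) * dS x (J x z) + G x z (J x y) * dS x (J x w))"
    unfolding s_def by (simp add: algebra_simps)
  ultimately have e: "s w z y = k1 * (2 * s w z y) + (k1 / 2 - k2) *
     (G x w y * dS x z + G x z y * dS x w + G x w (J x y) * dS x (J x z) + G x z (J x y) * dS x (J x w))"
    (is "_ = _ + _ * ?Y") by simp
  \<comment> \<open>Multiplying by n + 2 turns \<open>k1\<close> into 1 and
    \<open>k1 / 2 - k2\<close> into n / (2 (n + 1)). Subtracting 2 s from (n + 2) s leaves n s, so n
    cancels on both sides.\<close>
  have k: "(real n + 2) * k1 = 1" "(real n + 2) * k2 = 1 / (2 * (real n + 1))"
  proof -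
    show k1: "(real n + 2) * k1 = 1" by (simp add: k1_def)
    have "k2 = k1 * (1 / (2 * (real n + 1)))" by (simp add: k1_def k2_def mult_ac)
    then show "(real n + 2) * k2 = 1 / (2 * (real n + 1))"
      by (metis k1 mult.assoc mult_1)
  qed
  have "N * X = (N * k1) * A + ((N * k1) / 2 - N * k2) * Y" if "X = k1 * A + (k1 / 2 - k2) * Y" for N X A Y :: real
    unfolding that by (simp add: algebra_simps)
  from this[OF e, of "real n + 2"]
  have "(real n + 2) * s w z y = 2 * s w z y + (1 / 2 - 1 / (2 * (real n + 1))) * ?Y"
    unfolding k by simp
  moreover have "1 / 2 - 1 / (2 * (real n + 1)) = real n / (2 * (real n + 1))"
    by (simp add: field_simps)
  ultimately have "(real n + 2) * s w z y = 2 * s w z y + real n / (2 * (real n + 1)) * ?Y"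
    by (simp only:)
  then have "real n * s w z y = real n / (2 * (real n + 1)) * ?Y"
    by (simp only: distrib_right)
  then have "real n * s w z y = real n * (1 / (2 * (real n + 1)) * ?Y)"
    by simp
  moreover have "real n \<noteq> 0" using n by simp
  ultimately show ?thesis unfolding s_def using mult_left_cancel by blast
qed

text \<open>Add \<open>bochner_nab_Ric_J\<close> to its copy with y and z exchanged: by symmetry and
  J-invariance of \<open>Ric\<close> the twisted terms cancel, and twice \<nabla>Ric
  remains.\<close>

lemma nab_Ric:
  assumes x: "x \<in> S"
  shows "P x w y z = 1 / (4 * (real n + 1)) * (2 * (G x y z * dS x w) + G x w y * dS x z + G x w z * dS x y
    + G x w (J x y) * dS x (J x z) + G x w (J x z) * dS x (J x y))"
proof -
  have "2 * P x w y z = (P x w z y + P x (J x w) z (J x y)) + (P x w y z + P x (J x w) y (J x z))"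
    using P_J_right[OF x, of "J x w" z y] P_sym[OF x, of w y z] P_sym[OF x, of "J x w" y "J x z"] by linarith
  also have "\<dots> = 1 / (2 * (real n + 1)) * (2 * (G x y z * dS x w) + G x w y * dS x z + G x w z * dS x y
    + G x w (J x y) * dS x (J x z) + G x w (J x z) * dS x (J x y))"
    unfolding bochner_nab_Ric_J[OF x] using G_J_left[OF x, of z y] G_sym[OF x, of z y] G_sym[OF x, of "J x z" y]
    by (simp add: algebra_simps)
  finally show ?thesis by (simp add: field_simps)
qed

section \<open>The Hessian of the scalar curvature\<close>

definition "Hess = nab1 dS"

lemma tens1_dS: "tens1 S dS"
  by (rule tens1_dir[OF S smooth_Scal])

lemma Hess_eq: "Hess x w u = ddir w (ddir u Scal) x - dS x (Gam x w u)"
  by (simp add: Hess_def nab1_def)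

lemma Hess_sym: "x \<in> S \<Longrightarrow> Hess x w u = Hess x u w"
  by (simp add: Hess_eq Gam_sym[of x w u] ddir_commute_real[OF S smooth_Scal, of x w u])

lemma tens2_Hess: "tens2 S Hess"
  unfolding Hess_def nab1_def
  by (intro tens2I[OF S] tens1_diff[OF S] tens1_ddir[OF S tens1_dS] tens1_dir[OF S smooth_on_ddir[OF smooth_Scal]]
      tens1_comp[OF S tens1_dS Gam_right] tens1_comp[OF S tens1_dS Gam_left])

text \<open>\<open>nab_Ric\<close> differentiated covariantly: metric and J are parallel, so every
  factor d\<tau> becomes \<open>Hess\<close> and nothing else changes.\<close>

lemma nab3_P:
  assumes x: "x \<in> S"
  shows "nab3 P x v w y z = 1 / (4 * (real n + 1)) * (2 * (G x y z * Hess x v w) + G x w y * Hess x v z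
    + G x w z * Hess x v y + G x w (J x y) * Hess x v (J x z) + G x w (J x z) * Hess x v (J x y))"
proof -
  define k where "k = 1 / (4 * (real n + 1))"
  note eq = nab_Ric[folded k_def]
  have sJ: "smooth_on S (\<lambda>y. G y a (J y b))" "smooth_on S (\<lambda>y. dS y (J y b))" for a b
    by (rule smooth_on_apply[OF S G_right J_smooth], rule smooth_on_apply[OF S tens1_dS J_smooth])
  have dGJ: "ddir v (\<lambda>y. G y a (J y b)) x = G x (Gam x v a) (J x b) + G x a (J x (Gam x v b))" for a b
    unfolding ddir_apply[OF S G_right J_smooth x]
    by (simp add: ddir_G[OF x] ddir_J[OF x] bilinear_rsub[OF G_bilinear[OF x]])
  have dSJ: "ddir v (\<lambda>y. dS y (J y b)) x = Hess x v (J x b) + dS x (J x (Gam x v b))" for b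
    unfolding ddir_apply[OF S tens1_dS J_smooth x]
    by (simp add: ddir_J[OF x] Hess_eq linear_diff[OF linear_dS[OF x]])
  have dSd: "ddir v (ddir b Scal) x = Hess x v b + dS x (Gam x v b)" for b
    by (simp add: Hess_eq)
  have "ddir v (\<lambda>q. P q w y z) x = ddir v (\<lambda>x. k * (2 * (G x y z * dS x w) + G x w y * dS x z + G x w z * dS x y
    + G x w (J x y) * dS x (J x z) + G x w (J x z) * dS x (J x y))) x"
    by (rule ddir_transform[OF S x]) (rule eq)
  then show ?thesis
    unfolding nab3_def eq[OF x] k_def[symmetric]
    by (simp add: ddir_diff ddir_add ddir_mult differentiable[OF _ x] smooth_on_mult S smooth_on_add
      smooth_on_const G_smooth tens1_smooth[OF tens1_dS] sJ dGJ dSJ dSd ddir_G[OF x] algebra_simps)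
qed

text \<open>Contraction of the Ricci identity for \<open>Ric\<close>, whose curvature terms do not change when
  \<open>J\<close> is applied to both directions of differentiation.\<close>

lemma Hess_J:
  assumes x: "x \<in> S"
  shows "Hess x (J x u) (J x v) = Hess x u v"
proof -
  note lin = tens2_bilinear[OF tens2_Hess x]
  have Hl: "linear (Hess x u)" "linear (\<lambda>u. Hess x u v)" for u v
    using lin by (auto simp: bilinear_def)
  have lJ: "linear (\<lambda>v. f (J x v))" if "linear f" for f :: "_ \<Rightarrow> real"
    using linear_compose[OF linear_J[OF x] that] by (simp add: o_def)
  \<comment> \<open>4 (n + 1) times the commutator of two covariant derivatives of
    \<open>Ric\<close>. The term with \<open>G x y z\<close> is absent because \<open>Hess\<close>
    is symmetric.\<close>
  define A where "A a w y z = (G x w y * Hess x a z + G x w z * Hess x a y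
      + G x w (J x y) * Hess x a (J x z) + G x w (J x z) * Hess x a (J x y))
    - (G x a y * Hess x w z + G x a z * Hess x w y
      + G x a (J x y) * Hess x w (J x z) + G x a (J x z) * Hess x w (J x y))" for a w y z
  have A: "A a w y z = 4 * (real n + 1) * (nab3 P x a w y z - nab3 P x w a y z)" for a w y z
  proof -
    have "4 * (real n + 1) * (1 / (4 * (real n + 1)) * X) = X" for X by simp
    then show ?thesis
      unfolding nab3_P[OF x] A_def right_diff_distrib[of "4 * (real n + 1)"]
      by (simp only: Hess_sym[OF x, of w a])
  qed
  have comm: "nab3 P x a w y z - nab3 P x w a y z = - Ric x (Riem x a w y) z - Ric x y (Riem x a w z)" for a w y z
    by (rule ricci_identity2[OF tens2_Ric x])
  \<comment> \<open>Nondegeneracy of the metric, tested on the difference itself, carries the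
    invariance from \<open>Rm\<close> to \<open>Riem\<close>.\<close>
  have RJ: "Riem x (J x a) (J x b) c = Riem x a b c" for a b c
  proof -
    have "G x (Riem x (J x a) (J x b) c - Riem x a b c) d = 0" for d
      using Rm_J12[OF x, of a b c d] by (simp add: Rm_def bilinear_lsub[OF G_bilinear[OF x]])
    from this[of "Riem x (J x a) (J x b) c - Riem x a b c"] show ?thesis
      using G_pos[OF x, of "Riem x (J x a) (J x b) c - Riem x a b c"] by fastforce
  qed
  have AJ: "A (J x a) (J x w) y z = A a w y z" for a w y z
    unfolding A comm RJ ..
  have neg: "J x (- v) = - J x v" "Hess x (- u) v = - Hess x u v" "Hess x u (- v) = - Hess x u v"
     "G x (- u) v = - G x u v" "G x u (- v) = - G x u v" for u v
    by (simp_all add: linear_neg[OF linear_J[OF x]] linear_neg[OF Hl(1)] linear_neg[OF Hl(2)]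
        bilinear_lneg[OF G_bilinear[OF x]] bilinear_rneg[OF G_bilinear[OF x]])
  have tg: "trace x (\<lambda>a b. G x p a * f b) = f p" if "linear f" for f p
    using trace_G_left[OF x that, of p] .
  have tg': "trace x (\<lambda>a b. G x p b * f a) = f p" if "linear f" for f p
    using trace_G_left[OF x that, of p] trace_swap[of x "\<lambda>u v. G x p u * f v"] by simp
  have tJ: "trace x (\<lambda>a b. G x p (J x a) * f b) = - f (J x p)" if "linear f" for f p
    using trace_G_J_left[OF x that, of p] .
  have tJ': "trace x (\<lambda>a b. G x p (J x b) * f a) = - f (J x p)" if "linear f" for f p
    using trace_G_J_left[OF x that, of p] trace_swap[of x "\<lambda>u v. G x p (J x u) * f v"] by simp
  have t0: "trace x (\<lambda>a b. G x a (J x b) * c) = 0" for c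
    by (simp add: trace_def G_J_self[OF x])
  have tm: "trace x (\<lambda>a b. G x a b * c) = 2 * real n * c" for c
    using trace_dim[OF x] trace_mult[of x c "G x"] by (simp add: dim mult.commute)
  have HJ0: "trace x (\<lambda>a b. Hess x a (J x b)) = 0"
    using trace_J_left[OF x lin] trace_swap[of x "\<lambda>a b. Hess x a (J x b)"] Hess_sym[OF x]
    by simp
  have G1: "G x a p = G x p a" for a p by (rule G_sym[OF x])
  have GJ1: "G x (J x a) p = - G x a (J x p)" for a p by (rule G_J_left[OF x])
  \<comment> \<open>\<open>A\<close> is contracted over its second and third arguments. The trace of
    the metric contributes the dimension 2n, and the trace of \<open>Hess x a (J x b)\<close>
    vanishes.\<close>
  have "A u a b v = (G x a b * Hess x u v + G x v a * Hess x u b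
      + G x a (J x b) * Hess x u (J x v) + G x (J x v) a * Hess x u (J x b))
    - (G x u b * Hess x a v + G x u v * Hess x a b
      + G x u (J x b) * Hess x a (J x v) + G x u (J x v) * Hess x a (J x b))" for a b
    unfolding A_def by (simp add: G1[of a v] G1[of a "J x v"])
  then have "trace x (\<lambda>a b. A u a b v)
      = (2 * real n - 1) * Hess x u v + Hess x (J x u) (J x v) - G x u v * trace x (Hess x)"
    by (simp only: trace_diff trace_add tm t0 tg[OF Hl(1)] tg[OF lJ[OF Hl(1)]] tg'[OF Hl(2)] tJ'[OF Hl(2)]
        trace_mult HJ0 JJ[OF x] neg) (simp add: algebra_simps)
  \<comment> \<open>With J on the first two arguments the contraction gives the same expression,
    except that \<open>Hess x u v\<close> and \<open>Hess x (J x u) (J x v)\<close> trade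
    places.\<close>
  moreover have "A (J x u) (J x a) b v = (- (G x a (J x b) * Hess x (J x u) v) + G x v (J x a) * Hess x (J x u) b
      + G x a b * Hess x (J x u) (J x v) + G x v a * Hess x (J x u) (J x b))
    - (G x (J x u) b * Hess x (J x a) v + G x (J x u) v * Hess x (J x a) b
      + G x u b * Hess x (J x a) (J x v) + G x u v * Hess x (J x a) (J x b))" for a b
    unfolding A_def by (simp add: G_J[OF x] GJ1[of a b] G1[of "J x a" v] G1[of a v])
  then have "trace x (\<lambda>a b. A (J x u) (J x a) b v)
      = (2 * real n - 1) * Hess x (J x u) (J x v) + Hess x u v - G x u v * trace x (Hess x)"
    by (simp only: trace_diff trace_add trace_minus tm t0 tg[OF Hl(1)] tg[OF lJ[OF Hl(1)]] tJ[OF Hl(1)]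
        tg'[OF lJ[OF Hl(2)]] trace_mult HJ0 trace_J_left[OF x lin] trace_J[OF x lin] JJ[OF x] neg) (simp add: algebra_simps)
  \<comment> \<open>The two contractions agree by \<open>AJ\<close>, so the exchanged terms differ
    by nothing; \<open>n\<close> makes the factor 2n - 2 nonzero.\<close>
  ultimately have "(2 * real n - 2) * (Hess x (J x u) (J x v) - Hess x u v) = 0"
    unfolding AJ by (simp add: algebra_simps)
  then show ?thesis using n by simp
qed

section \<open>The differentials of the Laplacian and of the squared Ricci norm\<close>

definition "Lap x = trace x (Hess x)"

definition "grad x = (\<Sum>i\<in>UNIV. dS x (frame x i) *\<^sub>R frame x i)"

lemma G_grad:
  assumes x: "x \<in> S"
  shows "G x (grad x) v = dS x v"
proof -
  have "G x (grad x) v = (\<Sum>i\<in>UNIV. G x v (frame x i) * dS x (frame x i))"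
    unfolding grad_def
    by (simp add: linear_sum[OF tens1_linear[OF G_left x]] linear_cmul[OF tens1_linear[OF G_left x]]
        G_sym[OF x, of v] mult.commute)
  then show ?thesis
    using inner_form.frame_linear_real[OF inner_form_G[OF x] frame_orthonormal[OF x] linear_dS[OF x]] by simp
qed

lemma ddir_Lap:
  assumes x: "x \<in> S"
  shows "ddir w Lap x = - 2 * Ric x w (grad x)"
proof -
  let ?N = "nab2 Hess x"
  have NJ: "?N w (J x u) (J x v) = ?N w u v" for w u v
    by (rule nab2_J[OF tens2_Hess x Hess_J])
  have Nsym: "?N w u v = ?N w v u" for w u v
    by (rule nab2_sym[OF x Hess_sym])
  have comm: "?N a b u - ?N b a u = - dS x (Riem x a b u)" for a b u
    unfolding Hess_def by (rule ricci_identity1[OF tens1_dS x])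
  note lin = linear_nab2[OF tens2_Hess x]
  have Nanti: "?N w (J x u) v = - ?N w u (J x v)" for w u v
    using NJ[of w u "J x v"] by (simp add: JJ[OF x] linear_neg[OF lin(3)])
  have Nskew: "?N w (J x u) u = 0" for w u
    using Nanti[of w u u] Nsym[of w u "J x u"] by simp
  have lap: "ddir w Lap x = trace x (?N w)"
    using trace_nab2[OF x tens2_Hess, of w] by (simp add: Lap_def[abs_def])
  have "Rm x w u v (grad x) = Rm x u w (grad x) v" for u v
    using Rm_skew12[OF x, of u w "grad x" v] Rm_skew34[OF x, of w u v "grad x"] by simp
  moreover have "dS x (Riem x w u v) = Rm x w u v (grad x)" for u v
    using G_grad[OF x, of "Riem x w u v"] G_sym[OF x, of "grad x"] by (simp add: Rm_def)
  ultimately have R: "trace x (\<lambda>u v. dS x (Riem x w u v)) = Ric x w (grad x)"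
    by (simp add: Ric_def)
  \<comment> \<open>First evaluation of the difference between the differential of
    \<open>Lap\<close> and the divergence of \<open>Hess\<close>: it is the traced commutator of
    derivatives of d\<tau>.\<close>
  have d1: "trace x (?N w) - trace x (\<lambda>u v. ?N u w v) = - Ric x w (grad x)"
    unfolding R[symmetric] trace_minus[symmetric] trace_diff[symmetric] comm ..
  have "dS x (Riem x (J x w) (J x u) v) = dS x (Riem x w u v)" for u v
    using G_grad[OF x, of "Riem x w u v"] G_grad[OF x, of "Riem x (J x w) (J x u) v"]
      Rm_J12[OF x, of w u v "grad x"] G_sym[OF x, of "grad x"] by (simp add: Rm_def)
  then have "?N (J x w) (J x u) v - ?N (J x u) (J x w) v = ?N w u v - ?N u w v" for u v
    using comm[of "J x w" "J x u" v] comm[of w u v] by simp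
  \<comment> \<open>Second evaluation: the commutator is unchanged when J acts on both directions.
    After that twist the first trace is zero and the second is minus the divergence, so the
    difference equals the divergence itself.\<close>
  then have "trace x (?N w) - trace x (\<lambda>u v. ?N u w v)
      = trace x (\<lambda>u v. ?N (J x w) (J x u) v) - trace x (\<lambda>u v. ?N (J x u) (J x w) v)"
    unfolding trace_diff[symmetric] by simp
  also have "trace x (\<lambda>u v. ?N (J x w) (J x u) v) = 0"
    by (simp add: trace_def Nskew)
  also have "trace x (\<lambda>u v. ?N (J x u) (J x w) v) = - trace x (\<lambda>u v. ?N u w v)"
  proof -
    have "bilinear (\<lambda>u v. ?N u w v)" unfolding bilinear_def using lin by blast
    from trace_J[OF x this] show ?thesis by (simp add: Nanti trace_minus)
  qed
  finally show ?thesis using d1 unfolding lap by simp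
qed

text \<open>The squared norm as an iterated trace of a form with four separate arguments. It is
  bilinear in each traced pair, so \<open>ddir_trace\<close> can be used once per pair.\<close>

definition "RicN x = trace x (\<lambda>a a'. trace x (\<lambda>b b'. Ric x a b * Ric x a' b'))"

lemma ddir_RicN:
  assumes x: "x \<in> S"
  shows "ddir w RicN x = (Scal x * dS x w + 2 * Ric x w (grad x)) / (real n + 1)"
    and "RicN differentiable (at x)"
proof -
  note RR = tens2_right[OF tens2_Ric] and RL = tens2_left[OF tens2_Ric] and RS = tens2_smooth[OF tens2_Ric]
  have T: "tens2 S (\<lambda>x b b'. Ric x a b * Ric x a' b')" for a a'
    by (intro tens2I[OF S] tens1_mult[OF S] tens1_mult_right[OF S] RR RS)
  have l: "linear (Ric x u)" "linear (\<lambda>u. Ric x u v)" if "x \<in> S" for x u v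
    using tens1_linear[OF RR that] tens1_linear[OF RL that] by auto
  have T': "tens2 S (\<lambda>x a a'. trace x (\<lambda>b b'. Ric x a b * Ric x a' b'))"
  proof (intro tens2I[OF S] tens1I linearI smooth_trace[OF T])
    fix y a assume y: "y \<in> S"
    show "trace y (\<lambda>b b'. Ric y a b * Ric y (u + v) b')
        = trace y (\<lambda>b b'. Ric y a b * Ric y u b') + trace y (\<lambda>b b'. Ric y a b * Ric y v b')" for u v
      by (simp add: linear_add[OF l(2)[OF y]] distrib_left trace_add)
    show "trace y (\<lambda>b b'. Ric y (u + v) b * Ric y a b')
        = trace y (\<lambda>b b'. Ric y u b * Ric y a b') + trace y (\<lambda>b b'. Ric y v b * Ric y a b')" for u v
      by (simp add: linear_add[OF l(2)[OF y]] distrib_right trace_add)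
    show "trace y (\<lambda>b b'. Ric y a b * Ric y (r *\<^sub>R v) b') = r *\<^sub>R trace y (\<lambda>b b'. Ric y a b * Ric y v b')" for r v
      by (simp add: linear_cmul[OF l(2)[OF y]] mult.left_commute[of _ r] trace_mult)
    show "trace y (\<lambda>b b'. Ric y (r *\<^sub>R v) b * Ric y a b') = r *\<^sub>R trace y (\<lambda>b b'. Ric y v b * Ric y a b')" for r v
      by (simp add: linear_cmul[OF l(2)[OF y]] mult.assoc trace_mult)
  qed
  show "RicN differentiable (at x)"
    using differentiable[OF smooth_trace[OF T'] x] by (simp add: RicN_def[abs_def])
  have dR: "ddir w (\<lambda>y. Ric y a b) x = P x w a b + Ric x (Gam x w a) b + Ric x a (Gam x w b)" for a b
    by (simp add: nab2_def)
  \<comment> \<open>The two subtracted terms are the corrections that the outer trace asks for;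
    together with those of the inner trace they complete both factors to covariant
    derivatives.\<close>
  have inner: "ddir w (\<lambda>y. trace y (\<lambda>b b'. Ric y a b * Ric y a' b')) x
      - trace x (\<lambda>b b'. Ric x (Gam x w a) b * Ric x a' b')
      - trace x (\<lambda>b b'. Ric x a b * Ric x (Gam x w a') b')
      = trace x (\<lambda>b b'. P x w a b * Ric x a' b' + Ric x a b * P x w a' b')" for a a'
    unfolding ddir_trace[OF T x] trace_diff[symmetric]
    by (simp add: ddir_mult differentiable[OF RS x] dR algebra_simps)
  have "ddir w RicN x = trace x (\<lambda>a a'. trace x (\<lambda>b b'. P x w a b * Ric x a' b' + Ric x a b * P x w a' b'))"
    unfolding RicN_def[abs_def] ddir_trace[OF T' x] inner ..
  also have "\<dots> = 2 * trace x (\<lambda>a a'. trace x (\<lambda>b b'. P x w a b * Ric x a' b'))"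
    by (simp add: trace_add trace_def mult.commute sum_distrib_left)
  also have "trace x (\<lambda>a a'. trace x (\<lambda>b b'. P x w a b * Ric x a' b')) =
      1 / (4 * (real n + 1)) * (2 * Scal x * dS x w + 4 * Ric x w (grad x))"
  proof -
    define k where "k = 1 / (4 * (real n + 1))"
    define g where "g = grad x"
    have tg: "trace x (\<lambda>u v. G x p u * f v) = f p" "trace x (\<lambda>u v. G x p (J x u) * f v) = - f (J x p)"
      if "linear f" for f p
      by (rule trace_G_left[OF x that], rule trace_G_J_left[OF x that])
    note l = l[OF x]
    have e: "trace x (\<lambda>a a'. trace x (\<lambda>b b'. F a b * Ric x a' b')) = trace x (\<lambda>a a'. trace x (\<lambda>b b'. F a b * Ric x a b'))" for F
      by (simp add: trace_def)
    have t1: "trace x (\<lambda>a a'. trace x (\<lambda>b b'. G x a b * dS x w * Ric x a' b')) = Scal x * dS x w"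
    proof -
      have "trace x (\<lambda>b b'. G x a b * dS x w * Ric x a' b') = dS x w * Ric x a' a" for a a'
        using tg(1)[OF l(1), of a a'] trace_mult[of x "dS x w" "\<lambda>b b'. G x a b * Ric x a' b'"] by (simp add: mult_ac)
      then show ?thesis using trace_swap[of x "Ric x"] by (simp add: trace_mult Scal_def)
    qed
    have t2: "trace x (\<lambda>a a'. trace x (\<lambda>b b'. G x w a * dS x b * Ric x a' b')) = Ric x w g"
    proof -
      have "trace x (\<lambda>b b'. G x w a * dS x b * Ric x a' b') = G x w a * Ric x a' g" for a a'
        using tg(1)[OF l(1), of g a'] trace_mult[of x "G x w a" "\<lambda>b b'. G x g b * Ric x a' b'"]
        by (simp add: G_grad[OF x] g_def mult_ac)
      then show ?thesis using tg(1)[OF l(2), of w g] by simp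
    qed
    have t3: "trace x (\<lambda>a a'. trace x (\<lambda>b b'. G x w b * dS x a * Ric x a' b')) = Ric x w g"
    proof -
      have "trace x (\<lambda>b b'. G x w b * dS x a * Ric x a' b') = G x g a * Ric x a' w" for a a'
        using tg(1)[OF l(1), of w a'] trace_mult[of x "dS x a" "\<lambda>b b'. G x w b * Ric x a' b'"]
        by (simp add: G_grad[OF x] g_def mult_ac)
      then show ?thesis using tg(1)[OF l(2), of g w] Ric_sym[OF x] by simp
    qed
    \<comment> \<open>Moving J out of \<open>G x w\<close> and out of d\<tau> costs two signs, and
      the two resulting factors J disappear by J-invariance of \<open>Ric\<close>. The same happens
      in \<open>t5\<close>.\<close>
    have t4: "trace x (\<lambda>a a'. trace x (\<lambda>b b'. G x w (J x a) * dS x (J x b) * Ric x a' b')) = Ric x w g"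
    proof -
      have "trace x (\<lambda>b b'. G x w (J x a) * dS x (J x b) * Ric x a' b') = - (G x w (J x a) * Ric x a' (J x g))" for a a'
        using tg(2)[OF l(1), of g a'] trace_mult[of x "G x w (J x a)" "\<lambda>b b'. G x g (J x b) * Ric x a' b'"]
        by (simp add: G_grad[OF x] g_def mult_ac)
      then show ?thesis using tg(2)[OF l(2), of w "J x g"] by (simp add: trace_minus Ric_J[OF x])
    qed
    have t5: "trace x (\<lambda>a a'. trace x (\<lambda>b b'. G x w (J x b) * dS x (J x a) * Ric x a' b')) = Ric x w g"
    proof -
      have "trace x (\<lambda>b b'. G x w (J x b) * dS x (J x a) * Ric x a' b') = - (G x g (J x a) * Ric x a' (J x w))" for a a'
        using tg(2)[OF l(1), of w a'] trace_mult[of x "dS x (J x a)" "\<lambda>b b'. G x w (J x b) * Ric x a' b'"]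
        by (simp add: G_grad[OF x] g_def mult_ac)
      then show ?thesis using tg(2)[OF l(2), of g "J x w"] Ric_sym[OF x] by (simp add: trace_minus Ric_J[OF x])
    qed
    \<comment> \<open>The five terms of \<open>nab_Ric\<close> in the order of \<open>t1\<close> to
      \<open>t5\<close>: the first yields Scal d\<tau>(w) with weight 2, each of the others Ric(w,
      grad).\<close>
    have "P x w a b * r = k * (2 * (G x a b * dS x w * r) + G x w a * dS x b * r + G x w b * dS x a * r
      + G x w (J x a) * dS x (J x b) * r + G x w (J x b) * dS x (J x a) * r)" for a b r
      unfolding nab_Ric[OF x] k_def[symmetric] by (simp add: algebra_simps)
    then show ?thesis
      unfolding k_def[symmetric] g_def[symmetric]
      by (simp only: trace_mult trace_add t1 t2 t3 t4 t5) (simp add: algebra_simps)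
  qed
  finally show "ddir w RicN x = (Scal x * dS x w + 2 * Ric x w (grad x)) / (real n + 1)"
    by (simp add: field_simps)
qed

text \<open>The square contributes -\<tau> d\<tau> / (n + 1) and the Laplacian -2 \<rho>(w, grad
  \<tau>) / (n + 1): the negatives of the two terms in \<open>ddir_RicN\<close>.\<close>

theorem ddir_bochner_invariant:
  assumes x: "x \<in> S"
  shows "((\<lambda>x. RicN x - (Scal x)\<^sup>2 / (2 * (real n + 1)) + Lap x / (real n + 1)) has_derivative (\<lambda>w. 0)) (at x)"
proof -
  have dS: "(Scal has_derivative dS x) (at x)"
    by (rule has_derivative_ddir[OF differentiable[OF smooth_Scal x]])
  have "smooth_on S Lap"
    using smooth_trace[OF tens2_Hess] by (simp add: Lap_def[abs_def])
  then have "(Lap has_derivative (\<lambda>w. ddir w Lap x)) (at x)"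
    by (rule has_derivative_ddir[OF differentiable[OF _ x]])
  then have dL: "(Lap has_derivative (\<lambda>w. - 2 * Ric x w (grad x))) (at x)"
    by (simp add: ddir_Lap[OF x])
  have dN: "(RicN has_derivative (\<lambda>w. (Scal x * dS x w + 2 * Ric x w (grad x)) / (real n + 1))) (at x)"
    using has_derivative_ddir[OF ddir_RicN(2)[OF x]] by (simp add: ddir_RicN(1)[OF x])
  have dQ: "((\<lambda>x. (Scal x)\<^sup>2) has_derivative (\<lambda>w. 2 * (Scal x * dS x w))) (at x)"
    using has_derivative_mult[OF dS dS] by (simp add: power2_eq_square mult_ac)
  note div = bounded_linear.has_derivative[OF bounded_linear_divide]
  show ?thesis
    by (rule has_derivative_eq_rhs[OF has_derivative_add[OF has_derivative_diff[OF dN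
          div[OF dQ, of "2 * (real n + 1)"]] div[OF dL, of "real n + 1"]]])
      (simp add: fun_eq_iff add_divide_distrib del: distrib_left_numeral)
qed

end

section \<open>Charts and tangent maps\<close>

text \<open>The derivative at \<open>p\<close> of the coordinate change from \<open>c\<close> to
  \<open>d\<close>. \<open>tangent_to_chart\<close> and \<open>tangent_of_chart\<close> are the
  instances with \<open>chart_at A p\<close> at one end, so their algebra reduces to the cocycle
  rule \<open>tmap_compose\<close>.\<close>

definition tmap :: "('a, 'm::finite) chart \<Rightarrow> ('a, 'm) chart \<Rightarrow> 'a \<Rightarrow> real^'m \<Rightarrow> real^'m" where
  "tmap c d p v = ddir v (\<lambda>x. snd d (chart_inv c x)) (snd c p)"

lemma tangent_to_chart_tmap: "tangent_to_chart A c p v = tmap (chart_at A p) c p v"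
  by (simp add: tangent_to_chart_def tmap_def ddir_def o_def)

lemma tangent_of_chart_tmap: "tangent_of_chart A c p v = tmap c (chart_at A p) p v"
  by (simp add: tangent_of_chart_def tmap_def ddir_def o_def)

lemma differential_ddir:
  "differential A f p v = ddir v (\<lambda>x. f (chart_inv (chart_at A p) x)) (snd (chart_at A p) p)"
  by (simp add: differential_def ddir_def o_def)

locale smooth_mfd =
  fixes M :: "'a topology" and A :: "('a, 'm::finite) chart set"
  assumes mfd: "smooth_manifold M A"
begin

lemma chart_open: "c \<in> A \<Longrightarrow> openin M (fst c)"
  and chart_on: "c \<in> A \<Longrightarrow> chart_on M c"
  using mfd by (auto simp: smooth_manifold_def smooth_atlas_def chart_on_def)

lemma chart_cover: "(\<Union>c\<in>A. fst c) = topspace M"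
  using mfd by (auto simp: smooth_manifold_def smooth_atlas_def)

lemma chart_inj: "c \<in> A \<Longrightarrow> inj_on (snd c) (fst c)"
proof -
  assume c: "c \<in> A"
  then have "homeomorphic_map (subtopology M (fst c)) (top_of_set (snd c ` fst c)) (snd c)"
    using chart_on chart_on_def by blast
  then have "inj_on (snd c) (topspace (subtopology M (fst c)))"
    by (rule homeomorphic_imp_injective_map)
  then show ?thesis
    using openin_subset[OF chart_open[OF c]] by (simp add: topspace_subtopology Int_absorb1)
qed

lemma chart_inv_chart [simp]: "\<lbrakk>c \<in> A; p \<in> fst c\<rbrakk> \<Longrightarrow> chart_inv c (snd c p) = p"
  using chart_inj by (simp add: inv_into_f_f)

lemma open_chart_image:
  assumes c: "c \<in> A" and U: "openin M U"
  shows "open (snd c ` (fst c \<inter> U))"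
proof -
  have h: "homeomorphic_map (subtopology M (fst c)) (top_of_set (snd c ` fst c)) (snd c)"
    and o: "open (snd c ` fst c)"
    using chart_on[OF c] chart_on_def by blast+
  have "openin (subtopology M (fst c)) (fst c \<inter> U)"
    using U by (auto simp: openin_subtopology)
  then have "openin (top_of_set (snd c ` fst c)) (snd c ` (fst c \<inter> U))"
    using homeomorphic_imp_open_map[OF h] by (simp add: open_map_def)
  then show ?thesis using o openin_open_trans by blast
qed

lemma open_chart_range: "c \<in> A \<Longrightarrow> open (snd c ` fst c)"
  using chart_on chart_on_def by blast

lemma open_chart_sub: "\<lbrakk>c \<in> A; openin M U; U \<subseteq> fst c\<rbrakk> \<Longrightarrow> open (snd c ` U)"
  using open_chart_image[of c U] by (simp add: Int_absorb1)

lemma open_chart_inter: "\<lbrakk>c \<in> A; d \<in> A\<rbrakk> \<Longrightarrow> open (snd c ` (fst c \<inter> fst d))"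
  using open_chart_image chart_open by blast

lemma transition_smooth:
  "\<lbrakk>c \<in> A; d \<in> A\<rbrakk> \<Longrightarrow> smooth_on (snd c ` (fst c \<inter> fst d)) (\<lambda>x. snd d (chart_inv c x))"
  using mfd by (simp add: smooth_manifold_def smooth_atlas_def o_def)

lemma transition_differentiable:
  "\<lbrakk>c \<in> A; d \<in> A; p \<in> fst c; p \<in> fst d\<rbrakk> \<Longrightarrow> (\<lambda>x. snd d (chart_inv c x)) differentiable (at (snd c p))"
  by (rule smooth_on_differentiable[OF open_chart_inter transition_smooth]) auto

lemma chart_at: "p \<in> topspace M \<Longrightarrow> chart_at A p \<in> A \<and> p \<in> fst (chart_at A p)"
  unfolding chart_at_def using chart_cover by (intro someI_ex[where P = "\<lambda>c. c \<in> A \<and> p \<in> fst c"]) blast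

lemma chart_topspace: "c \<in> A \<Longrightarrow> p \<in> fst c \<Longrightarrow> p \<in> topspace M"
  using chart_cover by blast

lemma chart_at_chart: "\<lbrakk>c \<in> A; p \<in> fst c\<rbrakk> \<Longrightarrow> chart_at A p \<in> A"
    "\<lbrakk>c \<in> A; p \<in> fst c\<rbrakk> \<Longrightarrow> p \<in> fst (chart_at A p)"
  using chart_at chart_topspace by blast+

lemma linear_tmap: "\<lbrakk>c \<in> A; d \<in> A; p \<in> fst c; p \<in> fst d\<rbrakk> \<Longrightarrow> linear (tmap c d p)"
  unfolding tmap_def by (rule linear_ddir[OF transition_differentiable])

lemma tmap_compose:
  assumes "b \<in> A" "c \<in> A" "d \<in> A" "p \<in> fst b" "p \<in> fst c" "p \<in> fst d"
  shows "tmap c d p (tmap b c p v) = tmap b d p v"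
proof -
  have o: "open (snd b ` (fst b \<inter> (fst c \<inter> fst d)))"
    using assms chart_open by (intro open_chart_image openin_Int) auto
  have "tmap c d p (tmap b c p v) = ddir v (\<lambda>x. snd d (chart_inv c (snd c (chart_inv b x)))) (snd b p)"
    unfolding tmap_def
    using ddir_compose[OF transition_differentiable[of b c p], of "\<lambda>x. snd d (chart_inv c x)" v]
      transition_differentiable[of c d p] assms by simp
  also have "\<dots> = ddir v (\<lambda>x. snd d (chart_inv b x)) (snd b p)"
    by (rule ddir_transform[OF o]) (use assms in auto)
  finally show ?thesis by (simp add: tmap_def)
qed

lemma tmap_self: 
  assumes "c \<in> A" "p \<in> fst c"
  shows "tmap c c p v = v"
proof -
  have "tmap c c p v = ddir v (\<lambda>x. x) (snd c p)"
    unfolding tmap_def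
    by (rule ddir_transform[OF open_chart_range[OF assms(1)]]) (use assms in auto)
  also have "\<dots> = v" by (rule ddir_eqI) (rule has_derivative_ident)
  finally show ?thesis .
qed

section \<open>Tangent components in an arbitrary chart\<close>

abbreviation "to_chart \<equiv> tangent_to_chart A"
abbreviation "of_chart \<equiv> tangent_of_chart A"

lemma linear_to_chart: "\<lbrakk>c \<in> A; p \<in> fst c\<rbrakk> \<Longrightarrow> linear (to_chart c p)"
  using linear_tmap chart_at_chart by (simp add: tangent_to_chart_tmap[abs_def])

lemma linear_of_chart: "\<lbrakk>c \<in> A; p \<in> fst c\<rbrakk> \<Longrightarrow> linear (of_chart c p)"
  using linear_tmap chart_at_chart by (simp add: tangent_of_chart_tmap[abs_def])

lemma to_of_chart [simp]: "\<lbrakk>c \<in> A; p \<in> fst c\<rbrakk> \<Longrightarrow> to_chart c p (of_chart c p v) = v"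
  by (simp add: tangent_of_chart_tmap tangent_to_chart_tmap tmap_compose chart_at_chart tmap_self)

lemma of_to_chart [simp]: "\<lbrakk>c \<in> A; p \<in> fst c\<rbrakk> \<Longrightarrow> of_chart c p (to_chart c p v) = v"
  using tmap_compose[of "chart_at A p" c "chart_at A p" p v] chart_at_chart[of c p]
  by (simp add: tangent_of_chart_tmap tangent_to_chart_tmap tmap_self)

lemma to_chart_tmap: "\<lbrakk>c \<in> A; d \<in> A; p \<in> fst c; p \<in> fst d\<rbrakk> \<Longrightarrow> tmap c d p (to_chart c p v) = to_chart d p v"
  by (simp add: tangent_to_chart_tmap tmap_compose chart_at_chart)

lemma field_in_chart_at [simp]:
  "\<lbrakk>c \<in> A; p \<in> fst c\<rbrakk> \<Longrightarrow> field_in_chart A c X (snd c p) = to_chart c p (X p)"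
  by (simp add: field_in_chart_def)

section \<open>Smoothness of fields and functions tested in one chart\<close>

lemma smooth_fieldD:
  "\<lbrakk>smooth_field A U X; c \<in> A; U \<subseteq> fst c\<rbrakk> \<Longrightarrow> smooth_on (snd c ` U) (field_in_chart A c X)"
  by (metis Int_absorb1 smooth_field_def)

lemma smooth_funD:
  "\<lbrakk>smooth_fun A U f; c \<in> A; U \<subseteq> fst c\<rbrakk> \<Longrightarrow> smooth_on (snd c ` U) (\<lambda>x. f (chart_inv c x))"
  by (metis (no_types, lifting) Int_absorb1 smooth_fun_def comp_apply ext)

lemma smooth_field_cong:
  assumes "openin M U" "\<And>p. p \<in> U \<Longrightarrow> X p = Y p" "smooth_field A U X"
  shows "smooth_field A U Y"
  unfolding smooth_field_def
proof
  fix c assume c: "c \<in> A"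
  show "smooth_on (snd c ` (fst c \<inter> U)) (field_in_chart A c Y)"
  proof (rule smooth_on_cong[OF open_chart_image[OF c assms(1)]])
    show "smooth_on (snd c ` (fst c \<inter> U)) (field_in_chart A c X)"
      using assms(3) c by (simp add: smooth_field_def)
  qed (use assms(2) c in auto)
qed

text \<open>In any other chart the components are the derivative of the transition map applied to
  the given components, precomposed with the reverse transition; all three ingredients are
  smooth.\<close>

lemma smooth_field_local:
  assumes c: "c \<in> A" and U: "openin M U" "U \<subseteq> fst c"
    and X: "smooth_on (snd c ` U) (field_in_chart A c X)"
  shows "smooth_field A U X"
  unfolding smooth_field_def
proof
  fix d assume d: "d \<in> A"
  let ?\<phi> = "\<lambda>x. snd d (chart_inv c x)" and ?F = "field_in_chart A c X"
  have oc: "open (snd c ` (U \<inter> fst d))"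
    using U chart_open[OF d] by (intro open_chart_sub c) auto
  have od: "open (snd d ` (fst d \<inter> U))"
    by (rule open_chart_image[OF d U(1)])
  have "smooth_on (snd c ` (U \<inter> fst d)) ?\<phi>"
    by (rule smooth_on_subset[OF transition_smooth[OF c d]]) (use U in auto)
  then have s1: "smooth_on (snd c ` (U \<inter> fst d)) (\<lambda>x. ddir (?F x) ?\<phi> x)"
    by (intro smooth_on_apply[OF oc tens1_dir[OF oc]] smooth_on_subset[OF X]) auto
  have s2: "smooth_on (snd d ` (fst d \<inter> U)) (\<lambda>x. snd c (chart_inv d x))"
    by (rule smooth_on_subset[OF transition_smooth[OF d c]]) (use U in auto)
  have s3: "smooth_on (snd d ` (fst d \<inter> U))
      (\<lambda>y. ddir (?F (snd c (chart_inv d y))) ?\<phi> (snd c (chart_inv d y)))"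
    by (rule smooth_on_compose[OF od oc _ s1 s2]) (use d in auto)
  show "smooth_on (snd d ` (fst d \<inter> U)) (field_in_chart A d X)"
  proof (rule smooth_on_cong[OF od _ s3])
    fix y assume "y \<in> snd d ` (fst d \<inter> U)"
    then obtain p where p: "y = snd d p" "p \<in> fst d" "p \<in> U" "p \<in> fst c" using U by blast
    show "ddir (?F (snd c (chart_inv d y))) ?\<phi> (snd c (chart_inv d y)) = field_in_chart A d X y"
      using p c d to_chart_tmap[OF c d p(4) p(2), of "X p"] by (simp add: tmap_def)
  qed
qed

lemma smooth_fun_local:
  assumes c: "c \<in> A" and U: "openin M U" "U \<subseteq> fst c"
    and f: "smooth_on (snd c ` U) (\<lambda>x. f (chart_inv c x))"
  shows "smooth_fun A U f"
  unfolding smooth_fun_def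
proof
  fix d assume d: "d \<in> A"
  have oc: "open (snd c ` U)"
    using U by (intro open_chart_sub c) auto
  have od: "open (snd d ` (fst d \<inter> U))"
    by (rule open_chart_image[OF d U(1)])
  have s2: "smooth_on (snd d ` (fst d \<inter> U)) (\<lambda>x. snd c (chart_inv d x))"
    by (rule smooth_on_subset[OF transition_smooth[OF d c]]) (use U in auto)
  have s3: "smooth_on (snd d ` (fst d \<inter> U)) (\<lambda>y. f (chart_inv c (snd c (chart_inv d y))))"
    by (rule smooth_on_compose[OF od oc _ f s2]) (use d in auto)
  show "smooth_on (snd d ` (fst d \<inter> U)) (f \<circ> chart_inv d)"
    by (rule smooth_on_cong[OF od _ s3]) (use U c d in auto)
qed

lemma differential_chart:
  assumes c: "c \<in> A" "p \<in> fst c" and f: "(\<lambda>x. f (chart_inv c x)) differentiable (at (snd c p))"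
  shows "differential A f p v = ddir (to_chart c p v) (\<lambda>x. f (chart_inv c x)) (snd c p)"
proof -
  let ?d = "chart_at A p"
  have d: "?d \<in> A" "p \<in> fst ?d" using chart_at_chart[OF c] by auto
  have "ddir v (\<lambda>x. f (chart_inv ?d x)) (snd ?d p) = ddir v (\<lambda>x. f (chart_inv c (snd c (chart_inv ?d x)))) (snd ?d p)"
    by (rule ddir_transform[OF open_chart_inter[OF d(1) c(1)]]) (use c d in auto)
  also have "\<dots> = ddir (tmap ?d c p v) (\<lambda>x. f (chart_inv c x)) (snd c p)"
    using ddir_compose[OF transition_differentiable[OF d(1) c(1) d(2) c(2)], of "\<lambda>x. f (chart_inv c x)" v]
      f c d by (simp add: tmap_def)
  finally show ?thesis by (simp add: differential_ddir tangent_to_chart_tmap)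
qed

text \<open>The coordinate field with constant components \<open>v\<close> in the chart
  \<open>c\<close>. Unlike \<open>extend\<close>, it is tied to a chart that stays fixed as the
  point moves.\<close>

abbreviation "E c v \<equiv> (\<lambda>q. of_chart c q v)"

lemma field_E: "\<lbrakk>c \<in> A; x \<in> snd c ` fst c\<rbrakk> \<Longrightarrow> field_in_chart A c (E c v) x = v"
  by auto

lemma smooth_E:
  assumes "c \<in> A" "openin M U" "U \<subseteq> fst c"
  shows "smooth_field A U (E c v)"
  by (rule smooth_field_local[OF assms], rule smooth_on_cong[OF open_chart_sub[OF assms] _ smooth_on_const[of _ v]])
    (use assms field_E in auto)

lemma smooth_field_sum:
  assumes c: "c \<in> A" and U: "openin M U" "U \<subseteq> fst c" and X: "\<And>i. i \<in> I \<Longrightarrow> smooth_field A U (X i)"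
  shows "smooth_field A U (\<lambda>q. \<Sum>i\<in>I. X i q)"
proof (rule smooth_field_local[OF c U], rule smooth_on_cong[OF open_chart_sub[OF c U]])
  show "smooth_on (snd c ` U) (\<lambda>x. \<Sum>i\<in>I. field_in_chart A c (X i) x)"
    using X by (intro smooth_on_sum open_chart_sub[OF c U] smooth_fieldD[OF _ c U(2)]) auto
  show "(\<Sum>i\<in>I. field_in_chart A c (X i) y) = field_in_chart A c (\<lambda>q. \<Sum>i\<in>I. X i q) y" if y: "y \<in> snd c ` U" for y
  proof -
    obtain p where p: "y = snd c p" "p \<in> fst c" using y U by blast
    show ?thesis using c p by (simp add: linear_sum[OF linear_to_chart[OF c p(2)]])
  qed
qed

lemma smooth_field_diff:
  assumes c: "c \<in> A" and U: "openin M U" "U \<subseteq> fst c" and X: "smooth_field A U X" "smooth_field A U Y"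
  shows "smooth_field A U (\<lambda>q. X q - Y q)"
proof (rule smooth_field_local[OF c U], rule smooth_on_cong[OF open_chart_sub[OF c U]])
  show "smooth_on (snd c ` U) (\<lambda>x. field_in_chart A c X x - field_in_chart A c Y x)"
    using X by (intro smooth_on_diff open_chart_sub[OF c U] smooth_fieldD[OF _ c U(2)]) auto
  show "field_in_chart A c X y - field_in_chart A c Y y = field_in_chart A c (\<lambda>q. X q - Y q) y" if y: "y \<in> snd c ` U" for y
  proof -
    obtain p where p: "y = snd c p" "p \<in> fst c" using y U by blast
    show ?thesis using c p by (simp add: linear_diff[OF linear_to_chart[OF c p(2)]])
  qed
qed

lemma smooth_field_scale:
  assumes c: "c \<in> A" and U: "openin M U" "U \<subseteq> fst c" and f: "smooth_fun A U f" and X: "smooth_field A U X"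
  shows "smooth_field A U (\<lambda>q. f q *\<^sub>R X q)"
proof (rule smooth_field_local[OF c U], rule smooth_on_cong[OF open_chart_sub[OF c U]])
  show "smooth_on (snd c ` U) (\<lambda>x. f (chart_inv c x) *\<^sub>R field_in_chart A c X x)"
    by (intro smooth_on_scaleR open_chart_sub[OF c U] smooth_fieldD[OF X c U(2)] smooth_funD[OF f c U(2)])
  show "f (chart_inv c y) *\<^sub>R field_in_chart A c X y = field_in_chart A c (\<lambda>q. f q *\<^sub>R X q) y" if y: "y \<in> snd c ` U" for y
  proof -
    obtain p where p: "y = snd c p" "p \<in> fst c" using y U by blast
    show ?thesis using c p by (simp add: linear_cmul[OF linear_to_chart[OF c p(2)]])
  qed
qed

definition coord :: "('a, 'm) chart \<Rightarrow> ('a \<Rightarrow> real^'m) \<Rightarrow> 'm \<Rightarrow> 'a \<Rightarrow> real" where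
  "coord c X i q = to_chart c q (X q) $ i"

lemma field_coord:
  assumes "c \<in> A" "q \<in> fst c"
  shows "(\<Sum>i\<in>UNIV. coord c X i q *\<^sub>R E c (axis i 1) q) = X q"
  using linear_axis_expansion[OF linear_of_chart[OF assms], of "to_chart c q (X q)"] assms
  by (simp add: coord_def)

lemma smooth_coord:
  assumes c: "c \<in> A" and U: "openin M U" "U \<subseteq> fst c" and X: "smooth_field A U X"
  shows "smooth_on (snd c ` U) (\<lambda>x. coord c X i (chart_inv c x))" "smooth_fun A U (coord c X i)"
proof -
  show *: "smooth_on (snd c ` U) (\<lambda>x. coord c X i (chart_inv c x))"
    using smooth_on_nth[OF open_chart_sub[OF c U] smooth_fieldD[OF X c U(2)], of i]
    by (simp add: coord_def field_in_chart_def)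
  show "smooth_fun A U (coord c X i)" by (rule smooth_fun_local[OF c U *])
qed

end

section \<open>The Levi-Civita connection in a chart\<close>

locale kaehler_mfd =
  fixes M :: "'a topology" and A :: "('a, 'm::finite) chart set"
    and g :: "'a \<Rightarrow> real^'m \<Rightarrow> real^'m \<Rightarrow> real"
    and J :: "'a \<Rightarrow> real^'m \<Rightarrow> real^'m"
    and nab :: "('a \<Rightarrow> real^'m) \<Rightarrow> ('a \<Rightarrow> real^'m) \<Rightarrow> 'a \<Rightarrow> real^'m"
  assumes kaehler: "kaehler_manifold M A g J nab"
begin

sublocale smooth_mfd M A
  using kaehler by unfold_locales (simp add: kaehler_manifold_def)

lemma metric: "riemannian_metric M A g" and complex_structure: "almost_complex_structure M A J"
  and levi_civita: "levi_civita M A g nab" and connection: "affine_connection M A nab"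
  and parallel: "parallel_endomorphism M A nab J"
  using kaehler by (auto simp: kaehler_manifold_def levi_civita_def)

lemma inner_form_g: "p \<in> topspace M \<Longrightarrow> inner_form (g p)"
  using metric by unfold_locales (auto simp: riemannian_metric_def)

lemma linear_J: "p \<in> topspace M \<Longrightarrow> linear (J p)"
  and J_J: "p \<in> topspace M \<Longrightarrow> J p (J p v) = - v"
  and smooth_J: "\<lbrakk>openin M U; smooth_field A U X\<rbrakk> \<Longrightarrow> smooth_field A U (\<lambda>p. J p (X p))"
  using complex_structure by (auto simp: almost_complex_structure_def)

lemma g_J_J: "p \<in> topspace M \<Longrightarrow> g p (J p u) (J p v) = g p u v"
  using kaehler by (simp add: kaehler_manifold_def)

section \<open>The connection axioms on a fixed open set\<close>

context
  fixes U X Y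
  assumes U: "openin M U" and X: "smooth_field A U X" and Y: "smooth_field A U Y"
begin

lemmas connection_rules = connection[unfolded affine_connection_def, THEN spec, THEN spec, THEN spec,
    THEN mp, OF conjI[OF U conjI[OF X Y]]]

lemma smooth_nab: "smooth_field A U (nab X Y)"
  using connection_rules by (rule conjunct1)

lemma nab_add:
  "\<lbrakk>smooth_field A U X'; p \<in> U\<rbrakk> \<Longrightarrow> nab (\<lambda>q. X q + X' q) Y p = nab X Y p + nab X' Y p"
  "\<lbrakk>smooth_field A U Y'; p \<in> U\<rbrakk> \<Longrightarrow> nab X (\<lambda>q. Y q + Y' q) p = nab X Y p + nab X Y' p"
  using X Y connection_rules[THEN conjunct2, THEN conjunct1, THEN spec, THEN spec, THEN mp, THEN conjunct1]
  by simp_all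

lemma nab_cong:
  assumes "smooth_field A U X'" "smooth_field A U Y'" "\<And>p. p \<in> U \<Longrightarrow> X p = X' p"
    "\<And>p. p \<in> U \<Longrightarrow> Y p = Y' p" "p \<in> U"
  shows "nab X Y p = nab X' Y' p"
proof -
  have "(\<forall>p\<in>U. X p = X' p \<and> Y p = Y' p) \<longrightarrow> (\<forall>p\<in>U. nab X Y p = nab X' Y' p)"
    using connection_rules[THEN conjunct2, THEN conjunct1, THEN spec, THEN spec, THEN mp,
      OF conjI[OF assms(1,2)]] by (rule conjunct2)
  moreover have "\<forall>p\<in>U. X p = X' p \<and> Y p = Y' p"
    using assms(3,4) by (intro ballI conjI)
  ultimately have "\<forall>p\<in>U. nab X Y p = nab X' Y' p" by (rule mp)
  from bspec[OF this assms(5)] show ?thesis .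
qed

lemma nab_scale:
  "\<lbrakk>smooth_fun A U f; p \<in> U\<rbrakk> \<Longrightarrow> nab (\<lambda>q. f q *\<^sub>R X q) Y p = f p *\<^sub>R nab X Y p"
  "\<lbrakk>smooth_fun A U f; p \<in> U\<rbrakk> \<Longrightarrow>
    nab X (\<lambda>q. f q *\<^sub>R Y q) p = differential A f p (X p) *\<^sub>R Y p + f p *\<^sub>R nab X Y p"
  using connection_rules[THEN conjunct2, THEN conjunct2, THEN spec, THEN mp] by simp_all

lemma nab_torsion: "p \<in> U \<Longrightarrow> nab X Y p - nab Y X p = lie_bracket A X Y p"
  by (rule levi_civita[unfolded levi_civita_def, THEN conjunct2, THEN conjunct1, THEN spec, THEN spec,
      THEN spec, THEN mp, OF conjI[OF U conjI[OF X Y]], THEN bspec])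

lemma nab_metric:
  assumes Z: "smooth_field A U Z" and p: "p \<in> U"
  shows "differential A (\<lambda>q. g q (Y q) (Z q)) p (X p) = g p (nab X Y p) (Z p) + g p (Y p) (nab X Z p)"
  by (rule levi_civita[unfolded levi_civita_def, THEN conjunct2, THEN conjunct2, THEN spec, THEN spec,
      THEN spec, THEN spec, THEN mp, OF conjI[OF U conjI[OF X conjI[OF Y Z]]], THEN bspec, OF p])

lemma nab_parallel: "p \<in> U \<Longrightarrow> nab X (\<lambda>q. J q (Y q)) p = J p (nab X Y p)"
  by (rule parallel[unfolded parallel_endomorphism_def, THEN spec, THEN spec,
      THEN spec, THEN mp, OF conjI[OF U conjI[OF X Y]], THEN bspec])

end

lemma smooth_fun_const: "smooth_fun A U (\<lambda>q. r)"
  by (simp add: smooth_fun_def o_def smooth_on_const)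

context
  fixes c U
  assumes c: "c \<in> A" and U: "openin M U" "U \<subseteq> fst c"
begin

lemma nab_sum_left:
  assumes X: "\<And>i. i \<in> I \<Longrightarrow> smooth_field A U (X i)" and Y: "smooth_field A U Y" and p: "p \<in> U"
  shows "nab (\<lambda>q. \<Sum>i\<in>I. X i q) Y p = (\<Sum>i\<in>I. nab (X i) Y p)"
proof -
  \<comment> \<open>The empty sum needs the zero field, obtained by scaling with the constant
    function 0.\<close>
  have z: "nab (\<lambda>q. 0) Y p = 0"
    using nab_scale(1)[OF U(1) Y Y smooth_fun_const[of _ 0] p] by simp
  show ?thesis
    using X
  proof (induction I rule: infinite_finite_induct)
    case (insert i I)
    then show ?case
      using nab_add(1)[OF U(1) _ Y smooth_field_sum[OF c U, of I X] p, of "X i"] by simp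
  qed (simp_all add: z)
qed

lemma nab_sum_right:
  assumes X: "smooth_field A U X" and Y: "\<And>i. i \<in> I \<Longrightarrow> smooth_field A U (Y i)" and p: "p \<in> U"
  shows "nab X (\<lambda>q. \<Sum>i\<in>I. Y i q) p = (\<Sum>i\<in>I. nab X (Y i) p)"
proof -
  have d: "differential A (\<lambda>q. 0) p v = 0" for v
    by (simp add: differential_ddir)
  have z: "nab X (\<lambda>q. 0) p = 0"
    using nab_scale(2)[OF U(1) X X smooth_fun_const[of _ 0] p] by (simp add: d)
  show ?thesis
    using Y
  proof (induction I rule: infinite_finite_induct)
    case (insert i I)
    then show ?case
      using nab_add(2)[OF U(1) X _ smooth_field_sum[OF c U, of I Y] p, of "Y i"] by simp
  qed (simp_all add: z)
qed

end

text \<open>Extended bilinearly from the coordinate fields, so that \<open>tens2_christoffel\<close>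
  needs no tensoriality; that it computes the connection is the content of
  \<open>field_nab\<close>.\<close>

definition christoffel :: "('a, 'm) chart \<Rightarrow> real^'m \<Rightarrow> real^'m \<Rightarrow> real^'m \<Rightarrow> real^'m" where
  "christoffel c x u v = (\<Sum>i\<in>UNIV. \<Sum>j\<in>UNIV. u $ i *\<^sub>R v $ j *\<^sub>R
    field_in_chart A c (nab (E c (axis i 1)) (E c (axis j 1))) x)"

lemma tens2_christoffel:
  assumes c: "c \<in> A"
  shows "tens2 (snd c ` fst c) (christoffel c)"
proof -
  note o = open_chart_range[OF c]
  have F: "smooth_on (snd c ` fst c) (field_in_chart A c (nab (E c u) (E c v)))" for u v
    by (intro smooth_fieldD[OF smooth_nab] chart_open c smooth_E order_refl)
  show ?thesis
    unfolding christoffel_def[abs_def]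
    by (intro tens2I[OF o] tens1_sum[OF o] tens1_nth tens1_scaleR[OF o] smooth_on_scaleR[OF o] smooth_on_const F o)
qed

lemma field_nab:
  assumes c: "c \<in> A" and U: "openin M U" "U \<subseteq> fst c"
    and X: "smooth_field A U X" and Y: "smooth_field A U Y" and x: "x \<in> snd c ` U"
  shows "field_in_chart A c (nab X Y) x = ddir (field_in_chart A c X x) (field_in_chart A c Y) x
    + christoffel c x (field_in_chart A c X x) (field_in_chart A c Y x)"
proof -
  obtain p where p: "x = snd c p" "p \<in> U" "p \<in> fst c" using x U by blast
  note L = linear_to_chart[OF c p(3)]
  have sE: "smooth_field A U (E c v)" for v by (rule smooth_E[OF c U])
  have sYE: "smooth_field A U (\<lambda>q. coord c Y j q *\<^sub>R E c (axis j 1) q)" for j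
    by (rule smooth_field_scale[OF c U smooth_coord(2)[OF c U Y] sE])
  have sXE: "smooth_field A U (\<lambda>q. coord c X j q *\<^sub>R E c (axis j 1) q)" for j
    by (rule smooth_field_scale[OF c U smooth_coord(2)[OF c U X] sE])
  have oU: "open (snd c ` U)" by (rule open_chart_sub[OF c U])
  have sY: "smooth_on (snd c ` U) (field_in_chart A c Y)" by (rule smooth_fieldD[OF Y c U(2)])
  have diff: "differential A (coord c Y j) p v = ddir (to_chart c p v) (field_in_chart A c Y) x $ j" for j v
  proof -
    have "differential A (coord c Y j) p v = ddir (to_chart c p v) (\<lambda>x. coord c Y j (chart_inv c x)) (snd c p)"
      by (rule differential_chart[OF c p(3) smooth_on_differentiable[OF oU smooth_coord(1)[OF c U Y]]])
        (use p in blast)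
    also have "(\<lambda>x. coord c Y j (chart_inv c x)) = (\<lambda>x. field_in_chart A c Y x $ j)"
      by (simp add: coord_def field_in_chart_def)
    finally show ?thesis
      using ddir_nth[OF smooth_on_differentiable[OF oU sY]] x p by simp
  qed
  \<comment> \<open>The second argument is expanded in coordinate fields first; the Leibniz rule
    separates the derivative of its components from the connection on coordinate fields.\<close>
  have r: "nab (E c u) Y p = (\<Sum>j\<in>UNIV. ddir u (field_in_chart A c Y) x $ j *\<^sub>R E c (axis j 1) p
      + coord c Y j p *\<^sub>R nab (E c u) (E c (axis j 1)) p)" for u
  proof -
    have "nab (E c u) Y p = nab (E c u) (\<lambda>q. \<Sum>j\<in>UNIV. coord c Y j q *\<^sub>R E c (axis j 1) q) p"
      by (rule nab_cong[OF U(1) sE Y sE smooth_field_sum[OF c U sYE] _ _ p(2)])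
        (use field_coord[OF c] U in auto)
    also have "\<dots> = (\<Sum>j\<in>UNIV. nab (E c u) (\<lambda>q. coord c Y j q *\<^sub>R E c (axis j 1) q) p)"
      by (rule nab_sum_right[OF c U sE sYE p(2)])
    finally show ?thesis
      by (simp add: nab_scale(2)[OF U(1) sE sE smooth_coord(2)[OF c U Y] p(2)] diff c p)
  qed
  have tr: "to_chart c p (nab (E c u) Y p) = ddir u (field_in_chart A c Y) x
      + (\<Sum>j\<in>UNIV. coord c Y j p *\<^sub>R field_in_chart A c (nab (E c u) (E c (axis j 1))) x)" for u
    using linear_axis_expansion[of "\<lambda>v. v" "ddir u (field_in_chart A c Y) x"]
    by (simp add: r linear_sum[OF L] linear_add[OF L] linear_cmul[OF L] sum.distrib c p linear_id[unfolded id_def])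
  \<comment> \<open>The first argument is expanded next, where the connection is linear over
    functions.\<close>
  have "nab X Y p = nab (\<lambda>q. \<Sum>j\<in>UNIV. coord c X j q *\<^sub>R E c (axis j 1) q) Y p"
    by (rule nab_cong[OF U(1) X Y smooth_field_sum[OF c U sXE] Y _ _ p(2)])
      (use field_coord[OF c] U in auto)
  also have "\<dots> = (\<Sum>j\<in>UNIV. nab (\<lambda>q. coord c X j q *\<^sub>R E c (axis j 1) q) Y p)"
    by (rule nab_sum_left[OF c U sXE Y p(2)])
  also have "\<dots> = (\<Sum>j\<in>UNIV. coord c X j p *\<^sub>R nab (E c (axis j 1)) Y p)"
    by (simp add: nab_scale(1)[OF U(1) sE Y smooth_coord(2)[OF c U X] p(2)])
  finally have "to_chart c p (nab X Y p) = (\<Sum>i\<in>UNIV. coord c X i p *\<^sub>R (ddir (axis i 1) (field_in_chart A c Y) x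
      + (\<Sum>j\<in>UNIV. coord c Y j p *\<^sub>R field_in_chart A c (nab (E c (axis i 1)) (E c (axis j 1))) x)))"
    by (simp add: linear_sum[OF L] linear_cmul[OF L] tr)
  also have "\<dots> = ddir (to_chart c p (X p)) (field_in_chart A c Y) x
      + christoffel c x (to_chart c p (X p)) (to_chart c p (Y p))"
    using linear_axis_expansion[OF linear_ddir[OF smooth_on_differentiable[OF oU sY x]], of "to_chart c p (X p)"]
    by (simp add: christoffel_def coord_def scaleR_add_right sum.distrib scaleR_sum_right)
  finally show ?thesis by (simp add: c p)
qed

definition chart_metric :: "('a, 'm) chart \<Rightarrow> real^'m \<Rightarrow> real^'m \<Rightarrow> real^'m \<Rightarrow> real" where
  "chart_metric c x u v = (let q = chart_inv c x in g q (E c u q) (E c v q))"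

definition chart_J :: "('a, 'm) chart \<Rightarrow> real^'m \<Rightarrow> real^'m \<Rightarrow> real^'m" where
  "chart_J c x v = field_in_chart A c (\<lambda>q. J q (E c v q)) x"

text \<open>By definition the bracket is computed in \<open>chart_at A p\<close>, not in
  \<open>c\<close>. There the components of \<open>E c v\<close> are a directional derivative of the
  transition map, so the bracket is the difference of its mixed second derivatives.\<close>

lemma lie_bracket_E:
  assumes c: "c \<in> A" "p \<in> fst c"
  shows "lie_bracket A (E c u) (E c v) p = 0"
proof -
  let ?d = "chart_at A p" and ?S = "\<lambda>c d. snd c ` (fst c \<inter> fst d)"
  have d: "?d \<in> A" "p \<in> fst ?d" using chart_at_chart[OF c] by auto
  let ?\<phi> = "\<lambda>x. snd ?d (chart_inv c x)" and ?\<psi> = "\<lambda>x. snd c (chart_inv ?d x)"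
  have od: "open (?S ?d c)" and oc: "open (?S c ?d)" using open_chart_inter c d by auto
  have s\<phi>: "smooth_on (?S c ?d) ?\<phi>" by (rule transition_smooth[OF c(1) d(1)])
  have *: "frechet_derivative (field_in_chart A ?d (E c v)) (at (snd ?d p)) (E c u p)
      = ddir u (ddir v ?\<phi>) (snd c p)" for u v
  proof -
    have "ddir (E c u p) (field_in_chart A ?d (E c v)) (snd ?d p)
        = ddir (E c u p) (\<lambda>y. ddir v ?\<phi> (?\<psi> y)) (snd ?d p)"
    proof (rule ddir_transform[OF od])
      fix y assume "y \<in> ?S ?d c"
      then obtain q where q: "y = snd ?d q" "q \<in> fst ?d" "q \<in> fst c" by blast
      show "field_in_chart A ?d (E c v) y = ddir v ?\<phi> (?\<psi> y)"
        using q d c to_chart_tmap[OF c(1) d(1) q(3) q(2), of "E c v q"] by (simp add: tmap_def)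
    qed (use c d in auto)
    also have "\<dots> = ddir (ddir (E c u p) ?\<psi> (snd ?d p)) (ddir v ?\<phi>) (?\<psi> (snd ?d p))"
      using c d by (intro ddir_compose transition_differentiable smooth_on_differentiable[OF oc smooth_on_ddir[OF s\<phi>]]) auto
    also have "ddir (E c u p) ?\<psi> (snd ?d p) = u"
      using tmap_compose[OF c(1) d(1) c(1) c(2) d(2) c(2), of u] tmap_self[OF c]
      by (simp add: tangent_of_chart_tmap tmap_def)
    finally show ?thesis using c d by (simp add: ddir_def[abs_def])
  qed
  show ?thesis
    unfolding lie_bracket_def Let_def * using ddir_commute[OF oc s\<phi>, of "snd c p" u v] c d by simp
qed

lemma kaehler_chart:
  assumes c: "c \<in> A"
  shows "kaehler_chart (snd c ` fst c) (chart_metric c) (christoffel c) (chart_J c)"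
proof
  let ?S = "snd c ` fst c"
  show o: "open ?S" by (rule open_chart_range[OF c])
  note U = chart_open[OF c] order_refl[of "fst c"]
  have sE: "smooth_field A (fst c) (E c v)" for v by (rule smooth_E[OF c U])
  have gE: "smooth_on ?S (\<lambda>x. chart_metric c x u v)" for u v
  proof -
    have "smooth_fun A (fst c) (\<lambda>p. g p (E c u p) (E c v p))"
      using metric sE U unfolding riemannian_metric_def by blast
    from smooth_funD[OF this c order_refl] show ?thesis by (simp add: chart_metric_def Let_def)
  qed
  have JE: "smooth_on ?S (\<lambda>x. chart_J c x v)" for v
    unfolding chart_J_def by (rule smooth_fieldD[OF smooth_J[OF U(1) sE] c order_refl])
  have pt: "\<exists>p. x = snd c p \<and> p \<in> fst c \<and> p \<in> topspace M" if "x \<in> ?S" for x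
    using that chart_topspace[OF c] by blast
  have cm: "chart_metric c (snd c p) u v = g p (of_chart c p u) (of_chart c p v)" if "p \<in> fst c" for p u v
    using that c by (simp add: chart_metric_def)
  have cJ: "chart_J c (snd c p) v = to_chart c p (J p (of_chart c p v))" if "p \<in> fst c" for p v
    using that c by (simp add: chart_J_def)
  have bil: "bilinear (chart_metric c x)" if x: "x \<in> ?S" for x
  proof -
    obtain p where p: "x = snd c p" "p \<in> fst c" "p \<in> topspace M" using pt[OF x] by blast
    have "bilinear (g p)" using inner_form.bil[OF inner_form_g[OF p(3)]] .
    note b = bilinear_ladd[OF this] bilinear_radd[OF this] bilinear_lmul[OF this] bilinear_rmul[OF this]
    show ?thesis
      unfolding bilinear_def p(1) cm[OF p(2), abs_def]
      by (auto intro!: linearI simp: b linear_add[OF linear_of_chart[OF c p(2)]]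
          linear_cmul[OF linear_of_chart[OF c p(2)]])
  qed
  show "tens2 ?S (chart_metric c)"
    using bil gE by (auto simp: tens2_def tens1_def bilinear_def)
  show "tens1 ?S (chart_J c)"
  proof (rule tens1I)
    fix x assume "x \<in> ?S"
    then obtain p where p: "x = snd c p" "p \<in> fst c" "p \<in> topspace M" using pt by blast
    show "linear (chart_J c x)"
      unfolding p(1) cJ[OF p(2), abs_def]
      by (intro linearI) (simp_all add: linear_add[OF linear_of_chart[OF c p(2)]] linear_cmul[OF linear_of_chart[OF c p(2)]]
        linear_add[OF linear_J[OF p(3)]] linear_cmul[OF linear_J[OF p(3)]]
        linear_add[OF linear_to_chart[OF c p(2)]] linear_cmul[OF linear_to_chart[OF c p(2)]])
  qed (rule JE)
  show "tens2 ?S (christoffel c)" by (rule tens2_christoffel[OF c])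
  fix x assume x: "x \<in> ?S"
  then obtain p where p: "x = snd c p" "p \<in> fst c" "p \<in> topspace M" using pt by blast
  note L = linear_to_chart[OF c p(2)]
  \<comment> \<open>Constant components have no derivative, so \<open>field_nab\<close> on
    coordinate fields reduces to the Christoffel term.\<close>
  have E_const: "ddir w (field_in_chart A c (E c v)) x = 0" for w v
    using ddir_transform[OF o x, of "field_in_chart A c (E c v)" "\<lambda>x. v" w] field_E[OF c] by simp
  have nabE: "to_chart c p (nab (E c u) (E c v) p) = christoffel c x u v" for u v
    using field_nab[OF c U sE sE x, of u v] by (simp add: E_const field_E[OF c x]) (simp add: p c)
  have ofE: "nab (E c u) (E c v) p = of_chart c p (christoffel c x u v)" for u v
    unfolding nabE[symmetric] using c p by simp
  show "chart_metric c x u v = chart_metric c x v u" for u v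
    unfolding p(1) cm[OF p(2)] by (rule inner_form.sym[OF inner_form_g[OF p(3)]])
  show "0 < chart_metric c x v v" if "v \<noteq> 0" for v
  proof -
    have "of_chart c p v \<noteq> 0" using that to_of_chart[OF c p(2), of v] linear_0[OF L] by metis
    then show ?thesis unfolding p(1) cm[OF p(2)] by (rule inner_form.pos[OF inner_form_g[OF p(3)]])
  qed
  show "christoffel c x u v = christoffel c x v u" for u v
    using nab_torsion[OF U(1) sE sE p(2), of u v] lie_bracket_E[OF c p(2), of u v]
    by (simp add: nabE[symmetric])
  show "ddir w (\<lambda>y. chart_metric c y u v) x
      = chart_metric c x (christoffel c x w u) v + chart_metric c x u (christoffel c x w v)" for w u v
  proof -
    have "differential A (\<lambda>q. g q (E c u q) (E c v q)) p (E c w p)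
        = ddir (to_chart c p (E c w p)) (\<lambda>y. g (chart_inv c y) (E c u (chart_inv c y)) (E c v (chart_inv c y))) (snd c p)"
      using smooth_on_differentiable[OF o gE x] by (intro differential_chart[OF c p(2)]) (simp add: chart_metric_def Let_def p)
    then show ?thesis
      using nab_metric[OF U(1) sE sE sE p(2), of u v w] c p
      by (simp add: cm ofE) (simp add: chart_metric_def Let_def)
  qed
  show "chart_J c x (chart_J c x v) = - v" for v
    unfolding p(1) cJ[OF p(2)] using c p by (simp add: J_J linear_neg[OF linear_of_chart[OF c p(2)]] linear_neg[OF L])
  show "chart_metric c x (chart_J c x u) (chart_J c x v) = chart_metric c x u v" for u v
    unfolding p(1) cJ[OF p(2)] cm[OF p(2)] using c p by (simp add: g_J_J)
  show "ddir w (\<lambda>y. chart_J c y v) x = chart_J c x (christoffel c x w v) - christoffel c x w (chart_J c x v)" for w v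
  proof -
    have "field_in_chart A c (nab (E c w) (\<lambda>q. J q (E c v q))) x
        = ddir w (\<lambda>y. chart_J c y v) x + christoffel c x w (chart_J c x v)"
      using field_nab[OF c U sE smooth_J[OF U(1) sE] x, of w v] by (simp add: field_E[OF c x] chart_J_def[abs_def])
    moreover have "field_in_chart A c (nab (E c w) (\<lambda>q. J q (E c v q))) x = chart_J c x (christoffel c x w v)"
      using nab_parallel[OF U(1) sE sE p(2), of w v] c p by (simp add: cJ ofE)
    ultimately show ?thesis by simp
  qed
qed

end

section \<open>Curvature and Laplacian in a chart\<close>

context kaehler_mfd
begin

text \<open>Torsion freeness presents the bracket as a difference of two fields already known to be
  smooth.\<close>

lemma smooth_lie_bracket:
  assumes c: "c \<in> A" and U: "openin M U" "U \<subseteq> fst c"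
    and X: "smooth_field A U X" and Y: "smooth_field A U Y"
  shows "smooth_field A U (lie_bracket A X Y)"
  by (rule smooth_field_cong[OF U(1) _ smooth_field_diff[OF c U smooth_nab[OF U(1) X Y] smooth_nab[OF U(1) Y X]]])
    (rule nab_torsion[OF U(1) X Y])

lemma field_lie_bracket:
  assumes c: "c \<in> A" and U: "openin M U" "U \<subseteq> fst c"
    and X: "smooth_field A U X" and Y: "smooth_field A U Y" and x: "x \<in> snd c ` U"
  shows "field_in_chart A c (lie_bracket A X Y) x =
    ddir (field_in_chart A c X x) (field_in_chart A c Y) x - ddir (field_in_chart A c Y x) (field_in_chart A c X) x"
proof -
  obtain p where p: "x = snd c p" "p \<in> U" "p \<in> fst c" using x U by blast
  interpret kaehler_chart "snd c ` fst c" "chart_metric c" "christoffel c" "chart_J c"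
    by (rule kaehler_chart[OF c])
  have "field_in_chart A c (lie_bracket A X Y) x = field_in_chart A c (nab X Y) x - field_in_chart A c (nab Y X) x"
    using nab_torsion[OF U(1) X Y p(2)] linear_diff[OF linear_to_chart[OF c p(3)], of "nab X Y p" "nab Y X p"] c p
    by simp
  then show ?thesis
    unfolding field_nab[OF c U X Y x] field_nab[OF c U Y X x]
    using Gam_sym[of x "field_in_chart A c X x" "field_in_chart A c Y x"] p by simp
qed

lemma ddir_field_nab:
  assumes c: "c \<in> A" and U: "openin M U" "U \<subseteq> fst c"
    and X: "smooth_field A U X" and Y: "smooth_field A U Y" and x: "x \<in> snd c ` U"
  defines "X' \<equiv> field_in_chart A c X" and "Y' \<equiv> field_in_chart A c Y"
  shows "ddir w (field_in_chart A c (nab X Y)) x =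
    ddir w (ddir (X' x) Y') x + ddir (ddir w X' x) Y' x
    + ddir w (\<lambda>y. christoffel c y (X' x) (Y' x)) x
    + christoffel c x (ddir w X' x) (Y' x) + christoffel c x (X' x) (ddir w Y' x)"
proof -
  have o: "open (snd c ` U)" by (rule open_chart_sub[OF c U])
  have sX: "smooth_on (snd c ` U) X'" and sY: "smooth_on (snd c ` U) Y'"
    unfolding X'_def Y'_def using X Y smooth_fieldD c U by blast+
  have T: "tens2 (snd c ` U) (christoffel c)"
    by (rule tens2_subset[OF tens2_christoffel[OF c]]) (use U in blast)
  have T1: "tens1 (snd c ` U) (\<lambda>y w. ddir w Y' y)" by (rule tens1_dir[OF o sY])
  have "ddir w (field_in_chart A c (nab X Y)) x = ddir w (\<lambda>y. ddir (X' y) Y' y + christoffel c y (X' y) (Y' y)) x"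
    by (rule ddir_transform[OF o x]) (unfold X'_def Y'_def, rule field_nab[OF c U X Y])
  also have "\<dots> = ddir w (\<lambda>y. ddir (X' y) Y' y) x + ddir w (\<lambda>y. christoffel c y (X' y) (Y' y)) x"
    by (intro ddir_add smooth_on_differentiable[OF o _ x] smooth_on_apply[OF o T1 sX] tens2_smooth_apply[OF o T sX sY])
  finally show ?thesis
    unfolding ddir_apply[OF o T1 sX x] ddir_apply2[OF o T sX sY x] by simp
qed

text \<open>This contains the tensoriality of the curvature: second derivatives of the components of
  Z commute, derivatives of X and Y are absorbed by the bracket term, and only values at
  \<open>p\<close> remain.\<close>

lemma curvature_field_chart:
  assumes c: "c \<in> A" and U: "openin M U" "U \<subseteq> fst c"
    and X: "smooth_field A U X" and Y: "smooth_field A U Y" and Z: "smooth_field A U Z"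
    and p: "p \<in> U"
  shows "to_chart c p (curvature_field A nab X Y Z p) = kaehler_chart.Riem (christoffel c) (snd c p)
    (to_chart c p (X p)) (to_chart c p (Y p)) (to_chart c p (Z p))"
proof -
  interpret C: kaehler_chart "snd c ` fst c" "chart_metric c" "christoffel c" "chart_J c"
    by (rule kaehler_chart[OF c])
  have pc: "p \<in> fst c" using p U by blast
  let ?x = "snd c p" and ?F = "field_in_chart A c"
  have x: "?x \<in> snd c ` U" and x': "?x \<in> snd c ` fst c" using p pc by auto
  have o: "open (snd c ` U)" by (rule open_chart_sub[OF c U])
  have sZ: "smooth_on (snd c ` U) (?F Z)" by (rule smooth_fieldD[OF Z c U(2)])
  note lin = linear_to_chart[OF c pc]
  note add = linear_add[OF linear_ddir[OF smooth_on_differentiable[OF o sZ x]]]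
    linear_diff[OF linear_ddir[OF smooth_on_differentiable[OF o sZ x]]]
  note bil = bilinear_radd[OF C.Gam_bilinear[OF x']] bilinear_lsub[OF C.Gam_bilinear[OF x']]
  have "to_chart c p (curvature_field A nab X Y Z p)
     = ?F (nab X (nab Y Z)) ?x - ?F (nab Y (nab X Z)) ?x - ?F (nab (lie_bracket A X Y) Z) ?x"
    unfolding curvature_field_def using c pc by (simp add: linear_diff[OF lin])
  also have "\<dots> = C.Riem ?x (?F X ?x) (?F Y ?x) (?F Z ?x)"
    unfolding field_nab[OF c U X smooth_nab[OF U(1) Y Z] x] field_nab[OF c U Y smooth_nab[OF U(1) X Z] x]
      field_nab[OF c U smooth_lie_bracket[OF c U X Y] Z x] field_lie_bracket[OF c U X Y x]
      ddir_field_nab[OF c U Y Z x] ddir_field_nab[OF c U X Z x]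
    unfolding field_nab[OF c U X Z x] field_nab[OF c U Y Z x] C.Riem_def add bil
      ddir_commute[OF o sZ x, of "?F Y ?x" "?F X ?x"]
    by simp
  finally show ?thesis using c pc by simp
qed

section \<open>Transfer of the curvature quantities at one point\<close>

context
  fixes c p
  assumes c: "c \<in> A" and p: "p \<in> fst c"
begin

interpretation C: kaehler_chart "snd c ` fst c" "chart_metric c" "christoffel c" "chart_J c"
  by (rule kaehler_chart[OF c])

lemma point_in_chart: "snd c p \<in> snd c ` fst c"
  using p by auto

lemma g_chart: "g p u v = chart_metric c (snd c p) (to_chart c p u) (to_chart c p v)"
  using c p by (simp add: chart_metric_def)

lemma J_chart: "to_chart c p (J p v) = chart_J c (snd c p) (to_chart c p v)"
  using c p by (simp add: chart_J_def)

lemma to_chart_frame: 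
  assumes "orthonormal_frame (g p) e"
  shows "orthonormal_frame (chart_metric c (snd c p)) (\<lambda>i. to_chart c p (e i))"
  using assms by (simp add: orthonormal_frame_def g_chart)

text \<open>\<open>extend\<close> is built from \<open>chart_at A p\<close>, so its smoothness is
  obtained on that domain; computing in \<open>c\<close> forces the intersection.\<close>

lemma extend_overlap:
  shows "openin M (fst c \<inter> fst (chart_at A p))" "p \<in> fst c \<inter> fst (chart_at A p)"
    "smooth_field A (fst c \<inter> fst (chart_at A p)) (extend A p v)" "extend A p v p = v"
proof -
  note d = chart_at_chart[OF c p]
  show "openin M (fst c \<inter> fst (chart_at A p))" "p \<in> fst c \<inter> fst (chart_at A p)"
    using openin_Int[OF chart_open[OF c] chart_open[OF d(1)]] p d by auto
  then show "smooth_field A (fst c \<inter> fst (chart_at A p)) (extend A p v)"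
    unfolding extend_def by (intro smooth_E[OF d(1)]) auto
  show "extend A p v p = v" using d by (simp add: extend_def tangent_of_chart_tmap tmap_self)
qed

lemma curvature_chart:
  "curvature A g nab p x y z u = C.Rm (snd c p) (to_chart c p x) (to_chart c p y) (to_chart c p z) (to_chart c p u)"
  using curvature_field_chart[OF c extend_overlap(1) Int_lower1 extend_overlap(3) extend_overlap(3)
      extend_overlap(3) extend_overlap(2), of x y z]
  by (simp add: curvature_def g_chart C.Rm_def extend_overlap(4))

lemma frame_g: "orthonormal_frame (g p) (some_frame (g p))"
  by (rule inner_form.orthonormal_some_frame[OF inner_form_g[OF chart_topspace[OF c p]]])

text \<open>The frame chosen for \<open>g p\<close> and the one chosen for the coordinate metric are
  unrelated; frame independence of the trace bridges the two choices.\<close>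

lemmas trace_g = C.trace_frame[OF point_in_chart _ to_chart_frame[OF frame_g]]

lemma ricci_chart: "ricci A g nab p y z = C.Ric (snd c p) (to_chart c p y) (to_chart c p z)"
  unfolding ricci_def Let_def curvature_chart C.Ric_def
  by (rule trace_g[OF tens2_bilinear[OF C.tens2_Rm(2) point_in_chart]])

lemma scalar_curvature_chart: "scalar_curvature A g nab p = C.Scal (snd c p)"
  unfolding scalar_curvature_def Let_def ricci_chart C.Scal_def
  by (rule trace_g[OF tens2_bilinear[OF C.tens2_Ric point_in_chart]])

lemma ricci_norm_chart:
  "ricci_norm_squared A g nab p =
    C.trace (snd c p) (\<lambda>a a'. C.trace (snd c p) (\<lambda>b b'. C.Ric (snd c p) a b * C.Ric (snd c p) a' b'))"
proof -
  let ?R = "C.Ric (snd c p)"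
  have "bilinear ?R" by (rule tens2_bilinear[OF C.tens2_Ric point_in_chart])
  note b = bilinear_ladd[OF this] bilinear_radd[OF this] bilinear_lmul[OF this] bilinear_rmul[OF this]
  have i: "bilinear (\<lambda>v v'. ?R u v * ?R u' v')" for u u'
    unfolding bilinear_def by (auto intro!: linearI simp: b algebra_simps)
  have "bilinear (\<lambda>a a'. C.trace (snd c p) (\<lambda>b b'. ?R a b * ?R a' b'))"
    unfolding bilinear_def
    by (auto intro!: linearI simp: b distrib_left distrib_right C.trace_add C.trace_mult mult.assoc
        mult.left_commute[of _ "_ :: real" "?R _ _"])
  from trace_g[OF this] show ?thesis
    unfolding trace_g[OF i, symmetric]
    by (simp add: ricci_norm_squared_def Let_def ricci_chart power2_eq_square)
qed

end

text \<open>The components of \<open>extend A p v\<close> vary in the chart \<open>c\<close>. Their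
  derivative enters both terms of the covariant derivative and cancels, leaving the coordinate
  formula on constant vectors.\<close>

lemma laplacian_chart:
  assumes c: "c \<in> A" and p: "p \<in> fst c" and f: "smooth_on (snd c ` fst c) F"
    and fF: "\<And>q. q \<in> fst c \<Longrightarrow> f q = F (snd c q)"
  shows "laplacian A g nab f p = kaehler_chart.trace (chart_metric c) (snd c p)
    (kaehler_chart.nab1 (christoffel c) (\<lambda>x w. ddir w F x) (snd c p))"
proof -
  interpret C: kaehler_chart "snd c ` fst c" "chart_metric c" "christoffel c" "chart_J c"
    by (rule kaehler_chart[OF c])
  let ?x = "snd c p" and ?U = "fst c \<inter> fst (chart_at A p)"
  note ov = extend_overlap[OF c p]
  have x: "?x \<in> snd c ` ?U" and x': "?x \<in> snd c ` fst c" using ov(2) by auto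
  have o: "open (snd c ` ?U)" by (rule open_chart_sub[OF c ov(1)]) auto
  have diff: "differential A f q v = ddir (to_chart c q v) F (snd c q)" if q: "q \<in> fst c" for q v
  proof -
    have sm: "smooth_on (snd c ` fst c) (\<lambda>x. f (chart_inv c x))"
      by (rule smooth_on_cong[OF C.S _ f]) (use c fF in auto)
    have "differential A f q v = ddir (to_chart c q v) (\<lambda>x. f (chart_inv c x)) (snd c q)"
      using q by (intro differential_chart[OF c q] smooth_on_differentiable[OF C.S sm]) auto
    also have "\<dots> = ddir (to_chart c q v) F (snd c q)"
      by (rule ddir_transform[OF C.S]) (use c q fF in auto)
    finally show ?thesis .
  qed
  have sF: "smooth_on (snd c ` ?U) F" by (rule smooth_on_subset[OF f]) auto
  have cov: "covariant_derivative A nab (differential A f) p u v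
      = C.nab1 (\<lambda>x w. ddir w F x) ?x (to_chart c p u) (to_chart c p v)" for u v
  proof -
    let ?V = "field_in_chart A c (extend A p v)"
    have sV: "smooth_on (snd c ` ?U) ?V"
      by (rule smooth_fieldD[OF ov(3) c Int_lower1])
    note T1 = tens1_dir[OF o sF]
    have eq: "ddir (?V y) F y = differential A f (chart_inv c y) (extend A p v (chart_inv c y))"
      if "y \<in> snd c ` ?U" for y
      using that c diff by auto
    have s: "smooth_on (snd c ` ?U) (\<lambda>y. ddir (?V y) F y)" by (rule smooth_on_apply[OF o T1 sV])
    have "differential A (\<lambda>q. differential A f q (extend A p v q)) p u
       = ddir (to_chart c p u) (\<lambda>y. differential A f (chart_inv c y) (extend A p v (chart_inv c y))) ?x"
      by (rule differential_chart[OF c p smooth_on_differentiable[OF o smooth_on_cong[OF o eq s] x]])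
    also have "\<dots> = ddir (to_chart c p u) (\<lambda>y. ddir (?V y) F y) ?x"
      by (rule ddir_transform[OF o x]) (simp add: eq)
    also have "\<dots> = ddir (to_chart c p u) (ddir (to_chart c p v) F) ?x + ddir (ddir (to_chart c p u) ?V ?x) F ?x"
      unfolding ddir_apply[OF o T1 sV x] using c p ov(4) by simp
    finally have d: "differential A (\<lambda>q. differential A f q (extend A p v q)) p u = \<dots>" .
    have "to_chart c p (nab (extend A p u) (extend A p v) p)
        = ddir (to_chart c p u) ?V ?x + christoffel c ?x (to_chart c p u) (to_chart c p v)"
      using field_nab[OF c ov(1) Int_lower1 ov(3) ov(3) x, of u v] c p ov(4) by simp
    then show ?thesis
      unfolding covariant_derivative_def d diff[OF p] C.nab1_def
      by (simp add: linear_add[OF linear_ddir[OF smooth_on_differentiable[OF o sF x]]])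
  qed
  have "tens2 (snd c ` fst c) (C.nab1 (\<lambda>x w. ddir w F x))"
    unfolding C.nab1_def
    by (intro tens2I[OF C.S] tens1_diff[OF C.S] tens1_ddir[OF C.S tens1_dir[OF C.S f]]
        tens1_dir[OF C.S smooth_on_ddir[OF f]]
        tens1_comp[OF C.S tens1_dir[OF C.S f] C.Gam_right] tens1_comp[OF C.S tens1_dir[OF C.S f] C.Gam_left])
  from trace_g[OF c p tens2_bilinear[OF this x']] show ?thesis
    by (simp add: laplacian_def Let_def cov)
qed

end

section \<open>The Bochner condition in real form\<close>

definition cadd :: "(complex^'m::finite \<Rightarrow> complex) \<Rightarrow> bool" where
  "cadd f \<longleftrightarrow> (\<forall>Z W. f (Z + W) = f Z + f W)"

definition clin :: "(complex^'m::finite \<Rightarrow> complex) \<Rightarrow> bool" where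
  "clin f \<longleftrightarrow> cadd f \<and> (\<forall>k Z. f (k *s Z) = k * f Z)"

text \<open>Needed for the slots \<beta> and \<delta>, which enter the Bochner condition through
  \<open>cnj_vec\<close>.\<close>

definition aclin :: "(complex^'m::finite \<Rightarrow> complex) \<Rightarrow> bool" where
  "aclin f \<longleftrightarrow> cadd f \<and> (\<forall>k Z. f (k *s Z) = cnj k * f Z)"

definition rlin :: "(real^'m::finite \<Rightarrow> complex) \<Rightarrow> bool" where
  "rlin f \<longleftrightarrow> (\<forall>u v. f (u + v) = f u + f v) \<and> (\<forall>r u. f (r *\<^sub>R u) = of_real r * f u)"

lemma Re_Im_vec:
  "Re_vec (Z + W) = Re_vec Z + Re_vec W" "Im_vec (Z + W) = Im_vec Z + Im_vec W"
  "Re_vec (k *s Z) = Re k *\<^sub>R Re_vec Z - Im k *\<^sub>R Im_vec Z"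
  "Im_vec (k *s Z) = Re k *\<^sub>R Im_vec Z + Im k *\<^sub>R Re_vec Z"
  "Re_vec (cnj_vec Z) = Re_vec Z" "Im_vec (cnj_vec Z) = - Im_vec Z"
  by (simp_all add: Re_vec_def Im_vec_def cnj_vec_def vec_eq_iff)

lemma rlin_simps:
  assumes "rlin f"
  shows "f (u + v) = f u + f v" "f (r *\<^sub>R u) = of_real r * f u" "f (- u) = - f u" "f (u - v) = f u - f v"
proof -
  show a: "f (u + v) = f u + f v" and "f (r *\<^sub>R u) = of_real r * f u" for u v r
    using assms by (auto simp: rlin_def)
  show b: "f (- u) = - f u" for u
    using assms unfolding rlin_def by (metis mult_minus1 of_real_1 of_real_minus scaleR_minus1_left)
  show "f (u - v) = f u - f v" using a[of u "- v"] b[of v] by simp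
qed

lemma clin_cext:
  assumes "rlin f"
  shows "clin (cext f)"
proof -
  note f = rlin_simps[OF assms]
  have "Complex a b * (w + \<i> * z) = (of_real a * w - of_real b * z) + \<i> * (of_real a * z + of_real b * w)" for a b w z
    by (simp add: complex_eq_iff algebra_simps)
  then have "cext f (k *s Z) = k * cext f Z" for k Z
    by (cases k) (simp add: cext_def Re_Im_vec f)
  then show ?thesis by (simp add: clin_def cadd_def cext_def Re_Im_vec f algebra_simps)
qed

lemma aclin_cnj_vec:
  assumes "clin f"
  shows "aclin (\<lambda>Z. f (cnj_vec Z))"
proof -
  have "cnj_vec (Z + W) = cnj_vec Z + cnj_vec W" "cnj_vec (k *s Z) = cnj k *s cnj_vec Z" for k and Z W :: "complex^'a"
    by (simp_all add: cnj_vec_def vec_eq_iff)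
  then show ?thesis using assms by (simp add: clin_def aclin_def cadd_def)
qed

lemma rlin_cext:
  assumes "\<And>v. rlin (\<lambda>u. f u v)"
  shows "rlin (\<lambda>u. cext (f u) Z)"
  using assms by (simp add: rlin_def cext_def algebra_simps)

lemma zero_on_span:
  assumes f: "clin f \<or> aclin f" and B: "\<And>Z. Z \<in> B \<Longrightarrow> f Z = 0" and Z: "Z \<in> vec.span B"
  shows "f Z = 0"
  using Z
proof (induction rule: vec.span_induct_alt)
  case base
  have "f (0 + 0) = f 0 + f 0" using f unfolding clin_def aclin_def cadd_def by blast
  then show ?case by simp
next
  case (step k x y)
  then show ?case using f B by (auto simp: clin_def aclin_def cadd_def)
qed

text \<open>\<open>cext f Z\<close> is complex linear in \<open>f\<close>, so linearity in an inner
  slot survives complexification of the outer ones.\<close>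

lemma clin_param:
  assumes "\<And>x. clin (F x)"
  shows "clin (\<lambda>W. cext (\<lambda>x. F x W) Z)"
  using assms by (simp add: clin_def cadd_def cext_def algebra_simps)

lemma rlin_of_real: "linear f \<Longrightarrow> rlin (\<lambda>u. complex_of_real (f u))"
  by (simp add: rlin_def linear_add linear_cmul)

lemma clin_cext2:
  assumes "bilinear b"
  shows "clin (\<lambda>Z. cext2 b Z W)" "clin (\<lambda>W. cext2 b Z W)"
  using assms unfolding cext2_def bilinear_def
  by (auto intro!: clin_cext rlin_cext clin_param rlin_of_real)

lemma clin_cext4:
  assumes "\<And>y z u. linear (\<lambda>x. r x y z u)" "\<And>x z u. linear (\<lambda>y. r x y z u)"
    "\<And>x y u. linear (\<lambda>z. r x y z u)" "\<And>x y z. linear (\<lambda>u. r x y z u)"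
  shows "clin (\<lambda>Z. cext4 r Z Z2 Z3 Z4)" "clin (\<lambda>Z. cext4 r Z1 Z Z3 Z4)"
    "clin (\<lambda>Z. cext4 r Z1 Z2 Z Z4)" "clin (\<lambda>Z. cext4 r Z1 Z2 Z3 Z)"
proof -
  show "clin (\<lambda>Z. cext4 r Z Z2 Z3 Z4)" unfolding cext4_def
    by (rule clin_cext, rule rlin_cext, rule rlin_cext, rule rlin_cext, rule rlin_of_real, rule assms(1))
  show "clin (\<lambda>Z. cext4 r Z1 Z Z3 Z4)" unfolding cext4_def
    by (rule clin_param, rule clin_cext, rule rlin_cext, rule rlin_cext, rule rlin_of_real, rule assms(2))
  show "clin (\<lambda>Z. cext4 r Z1 Z2 Z Z4)" unfolding cext4_def
    by (rule clin_param, rule clin_param, rule clin_cext, rule rlin_cext, rule rlin_of_real, rule assms(3))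
  show "clin (\<lambda>Z. cext4 r Z1 Z2 Z3 Z)" unfolding cext4_def
    by (rule clin_param, rule clin_param, rule clin_param, rule clin_cext, rule rlin_of_real, rule assms(4))
qed

text \<open>The vector a - iJa, twice the (1,0) part of a; its conjugate is a + iJa. It links
  conditions on a complex basis with conditions on real vectors.\<close>

definition hat :: "(real^'m::finite \<Rightarrow> real^'m) \<Rightarrow> real^'m \<Rightarrow> complex^'m" where
  "hat j a = (\<chi> i. Complex (a $ i) (- (j a $ i)))"

lemma Re_Im_hat: "Re_vec (hat j a) = a" "Im_vec (hat j a) = - j a"
  by (simp_all add: hat_def Re_vec_def Im_vec_def vec_eq_iff)

lemma hat_holomorphic:
  assumes "linear j" "\<And>v. j (j v) = - v"
  shows "hat j a \<in> holomorphic_tangent_space j"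
  unfolding holomorphic_tangent_space_def mem_Collect_eq cext_endo_def Re_Im_hat
  by (simp add: hat_def vec_eq_iff complex_eq_iff assms linear_neg[OF assms(1)])

text \<open>Both sides are linear in \<alpha>, \<gamma> and antilinear in \<beta>, \<delta>, so the
  condition spreads slot by slot from \<open>B\<close> to its span and holds at
  \<open>hat j a\<close> to \<open>hat j d\<close>. A J-invariant form \<open>h\<close> takes the
  value 2 (h(a,b) + i h(a,Jb)) on the pair a - iJa, b + iJb; the real part of a product of two such
  values is 4 times the stated kind of difference.\<close>

lemma bochner_real:
  fixes r :: "real^'m::finite \<Rightarrow> real^'m \<Rightarrow> real^'m \<Rightarrow> real^'m \<Rightarrow> real" and h \<rho> :: "real^'m \<Rightarrow> real^'m \<Rightarrow> real"
    and k l :: real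
  assumes r: "\<And>y z u. linear (\<lambda>x. r x y z u)" "\<And>x z u. linear (\<lambda>y. r x y z u)"
    "\<And>x y u. linear (\<lambda>z. r x y z u)" "\<And>x y z. linear (\<lambda>u. r x y z u)"
    and r12: "\<And>x y z u. r (j x) (j y) z u = r x y z u" and r34: "\<And>x y z u. r x y (j z) (j u) = r x y z u"
    and h: "bilinear h" "\<And>x y. h (j x) (j y) = h x y"
    and \<rho>: "bilinear \<rho>" "\<And>x y. \<rho> (j x) (j y) = \<rho> x y"
    and j: "linear j" "\<And>v. j (j v) = - v"
    and B: "complex_basis j B"
    and eq: "\<And>\<alpha> \<beta> \<gamma> \<delta>. \<lbrakk>\<alpha> \<in> B; \<beta> \<in> B; \<gamma> \<in> B; \<delta> \<in> B\<rbrakk> \<Longrightarrow>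
      cext4 r \<alpha> (cnj_vec \<beta>) \<gamma> (cnj_vec \<delta>) =
        of_real k * (cext2 h \<alpha> (cnj_vec \<beta>) * cext2 \<rho> \<gamma> (cnj_vec \<delta>) + cext2 h \<gamma> (cnj_vec \<beta>) * cext2 \<rho> \<alpha> (cnj_vec \<delta>)
          + cext2 h \<gamma> (cnj_vec \<delta>) * cext2 \<rho> \<alpha> (cnj_vec \<beta>) + cext2 h \<alpha> (cnj_vec \<delta>) * cext2 \<rho> \<gamma> (cnj_vec \<beta>))
        - of_real l * (cext2 h \<alpha> (cnj_vec \<beta>) * cext2 h \<gamma> (cnj_vec \<delta>) + cext2 h \<gamma> (cnj_vec \<beta>) * cext2 h \<alpha> (cnj_vec \<delta>))"
  shows "r a b c d - r a (j b) c (j d) =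
    (k * (h a b * \<rho> c d + h c b * \<rho> a d + h c d * \<rho> a b + h a d * \<rho> c b)
      - l * (h a b * h c d + h c b * h a d))
    - (k * (h a (j b) * \<rho> c (j d) + h c (j b) * \<rho> a (j d) + h c (j d) * \<rho> a (j b) + h a (j d) * \<rho> c (j b))
      - l * (h a (j b) * h c (j d) + h c (j b) * h a (j d)))"
proof -
  define \<Phi> where "\<Phi> \<alpha> \<beta> \<gamma> \<delta> = cext4 r \<alpha> (cnj_vec \<beta>) \<gamma> (cnj_vec \<delta>) -
      (of_real k * (cext2 h \<alpha> (cnj_vec \<beta>) * cext2 \<rho> \<gamma> (cnj_vec \<delta>) + cext2 h \<gamma> (cnj_vec \<beta>) * cext2 \<rho> \<alpha> (cnj_vec \<delta>)
          + cext2 h \<gamma> (cnj_vec \<delta>) * cext2 \<rho> \<alpha> (cnj_vec \<beta>) + cext2 h \<alpha> (cnj_vec \<delta>) * cext2 \<rho> \<gamma> (cnj_vec \<beta>))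
        - of_real l * (cext2 h \<alpha> (cnj_vec \<beta>) * cext2 h \<gamma> (cnj_vec \<delta>) + cext2 h \<gamma> (cnj_vec \<beta>) * cext2 h \<alpha> (cnj_vec \<delta>)))"
    for \<alpha> \<beta> \<gamma> \<delta>
  note cl = clin_cext4[OF r, unfolded clin_def cadd_def] clin_cext2[OF h(1), unfolded clin_def cadd_def]
    clin_cext2[OF \<rho>(1), unfolded clin_def cadd_def]
  note acl = aclin_cnj_vec[OF clin_cext4(2)[OF r], unfolded aclin_def cadd_def]
    aclin_cnj_vec[OF clin_cext4(4)[OF r], unfolded aclin_def cadd_def]
    aclin_cnj_vec[OF clin_cext2(2)[OF h(1)], unfolded aclin_def cadd_def]
    aclin_cnj_vec[OF clin_cext2(2)[OF \<rho>(1)], unfolded aclin_def cadd_def]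
  have s1: "clin (\<lambda>\<alpha>. \<Phi> \<alpha> \<beta> \<gamma> \<delta>)" for \<beta> \<gamma> \<delta>
    by (simp add: clin_def cadd_def \<Phi>_def cl algebra_simps)
  have s2: "aclin (\<lambda>\<beta>. \<Phi> \<alpha> \<beta> \<gamma> \<delta>)" for \<alpha> \<gamma> \<delta>
    by (simp add: aclin_def cadd_def \<Phi>_def acl algebra_simps)
  have s3: "clin (\<lambda>\<gamma>. \<Phi> \<alpha> \<beta> \<gamma> \<delta>)" for \<alpha> \<beta> \<delta>
    by (simp add: clin_def cadd_def \<Phi>_def cl algebra_simps)
  have s4: "aclin (\<lambda>\<delta>. \<Phi> \<alpha> \<beta> \<gamma> \<delta>)" for \<alpha> \<beta> \<gamma>
    by (simp add: aclin_def cadd_def \<Phi>_def acl algebra_simps)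
  have z0: "\<Phi> \<alpha> \<beta> \<gamma> \<delta> = 0" if "\<alpha> \<in> B" "\<beta> \<in> B" "\<gamma> \<in> B" "\<delta> \<in> B" for \<alpha> \<beta> \<gamma> \<delta>
    using eq[OF that] by (simp add: \<Phi>_def)
  have z1: "\<Phi> \<alpha> \<beta> \<gamma> \<delta> = 0" if "\<alpha> \<in> vec.span B" "\<beta> \<in> B" "\<gamma> \<in> B" "\<delta> \<in> B" for \<alpha> \<beta> \<gamma> \<delta>
    by (rule zero_on_span[OF disjI1[OF s1] z0 that(1)]) (use that in auto)
  have z2: "\<Phi> \<alpha> \<beta> \<gamma> \<delta> = 0" if "\<alpha> \<in> vec.span B" "\<beta> \<in> vec.span B" "\<gamma> \<in> B" "\<delta> \<in> B" for \<alpha> \<beta> \<gamma> \<delta>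
    by (rule zero_on_span[OF disjI2[OF s2] z1 that(2)]) (use that in auto)
  have z3: "\<Phi> \<alpha> \<beta> \<gamma> \<delta> = 0" if "\<alpha> \<in> vec.span B" "\<beta> \<in> vec.span B" "\<gamma> \<in> vec.span B" "\<delta> \<in> B" for \<alpha> \<beta> \<gamma> \<delta>
    by (rule zero_on_span[OF disjI1[OF s3] z2 that(3)]) (use that in auto)
  have z4: "\<Phi> \<alpha> \<beta> \<gamma> \<delta> = 0" if "\<alpha> \<in> vec.span B" "\<beta> \<in> vec.span B" "\<gamma> \<in> vec.span B" "\<delta> \<in> vec.span B" for \<alpha> \<beta> \<gamma> \<delta>
    by (rule zero_on_span[OF disjI2[OF s4] z3 that(4)]) (use that in auto)
  have hat: "hat j v \<in> vec.span B" for v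
    using hat_holomorphic[OF j] B by (simp add: complex_basis_def)
  have "Re (\<Phi> (hat j a) (hat j b) (hat j c) (hat j d)) = 0"
    by (simp add: z4 hat)
  moreover have nr: "r (- x) y z u = - r x y z u" "r x (- y) z u = - r x y z u"
      "r x y (- z) u = - r x y z u" "r x y z (- u) = - r x y z u" for x y z u
    using linear_neg[OF r(1)] linear_neg[OF r(2)] linear_neg[OF r(3)] linear_neg[OF r(4)] by auto
  moreover have jr: "r (j x) y z u = - r x (j y) z u" "r x y (j z) u = - r x y z (j u)" for x y z u
    using r12[of x "j y" z u] r34[of x y z "j u"] by (simp_all add: j nr)
  moreover have jh: "h (j x) y = - h x (j y)" "\<rho> (j x) y = - \<rho> x (j y)" for x y
    using h(2)[of x "j y"] \<rho>(2)[of x "j y"] by (simp_all add: j bilinear_rneg[OF h(1)] bilinear_rneg[OF \<rho>(1)])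
  ultimately show ?thesis
    by (simp add: \<Phi>_def cext4_def cext2_def cext_def Re_Im_vec Re_Im_hat j linear_neg[OF j(1)]
        bilinear_lneg[OF h(1)] bilinear_rneg[OF h(1)] bilinear_lneg[OF \<rho>(1)] bilinear_rneg[OF \<rho>(1)] algebra_simps)
qed

context kaehler_mfd
begin

lemma bochner_chart:
  assumes c: "c \<in> A" and n: "CARD('m) = 2 * n" "2 * n \<ge> 4" and BK: "bochner_kaehler M A g J nab n"
  shows "bochner_chart (snd c ` fst c) (chart_metric c) (christoffel c) (chart_J c) n"
proof -
  interpret C: kaehler_chart "snd c ` fst c" "chart_metric c" "christoffel c" "chart_J c"
    by (rule kaehler_chart[OF c])
  show ?thesis
  proof
    show "CARD('m) = 2 * n" "2 \<le> n" using n by auto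
    fix x a b e d assume x: "x \<in> snd c ` fst c"
    then obtain p where p: "x = snd c p" "p \<in> fst c" by blast
    note top = chart_topspace[OF c p(2)]
    let ?L = "to_chart c p" and ?E = "of_chart c p"
    let ?h = "g p" and ?\<rho> = "ricci A g nab p" and ?r = "curvature A g nab p"
    note curv = curvature_chart[OF c p(2)] and ric = ricci_chart[OF c p(2)] and scal = scalar_curvature_chart[OF c p(2)]
      and L = linear_to_chart[OF c p(2)] and Jc = J_chart[OF c p(2)]
    have x': "snd c p \<in> snd c ` fst c" using x p by simp
    have lr: "linear (\<lambda>x. ?r x y z u)" "linear (\<lambda>y. ?r x y z u)" "linear (\<lambda>z. ?r x y z u)" "linear (\<lambda>u. ?r x y z u)"
      for x y z u
      unfolding curv
      by (intro linear_compose[OF L, unfolded o_def] tens1_linear[OF C.tens1_Rm1 x'] tens1_linear[OF C.tens1_Rm2 x']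
          tens1_linear[OF C.tens1_Rm3 x'] tens1_linear[OF C.tens1_Rm4 x'])+
    have bric: "bilinear ?\<rho>"
      unfolding bilinear_def ric
      by (intro allI conjI linear_compose[OF L, unfolded o_def] tens1_linear[OF tens2_right[OF C.tens2_Ric] x']
          tens1_linear[OF tens2_left[OF C.tens2_Ric] x'])
    obtain B where B: "complex_basis (J p) B"
      and eq: "\<forall>\<alpha>\<in>B. \<forall>\<beta>\<in>B. \<forall>\<gamma>\<in>B. \<forall>\<delta>\<in>B.
           let G = (\<lambda>Z W. cext2 (g p) Z (cnj_vec W));
               Rho = (\<lambda>Z W. cext2 (ricci A g nab p) Z (cnj_vec W));
               \<tau> = complex_of_real (scalar_curvature A g nab p)
           in cext4 (curvature A g nab p) \<alpha> (cnj_vec \<beta>) \<gamma> (cnj_vec \<delta>) =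
              1 / (of_nat n + 2) *
                (G \<alpha> \<beta> * Rho \<gamma> \<delta> + G \<gamma> \<beta> * Rho \<alpha> \<delta> + G \<gamma> \<delta> * Rho \<alpha> \<beta> + G \<alpha> \<delta> * Rho \<gamma> \<beta>)
              - \<tau> / (2 * (of_nat n + 1) * (of_nat n + 2)) *
                (G \<alpha> \<beta> * G \<gamma> \<delta> + G \<gamma> \<beta> * G \<alpha> \<delta>)"
      using BK top unfolding bochner_kaehler_def by blast
    let ?k = "1 / (real n + 2)" and ?l = "scalar_curvature A g nab p / (2 * (real n + 1) * (real n + 2))"
    \<comment> \<open>The real identity at \<open>p\<close> for the vectors whose components in
      \<open>c\<close> are a, b, e, d; the letter \<open>e\<close> takes the third slot because
      \<open>c\<close> is the chart.\<close>
    have "?r (?E a) (?E b) (?E e) (?E d) - ?r (?E a) (J p (?E b)) (?E e) (J p (?E d)) =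
      (?k * (?h (?E a) (?E b) * ?\<rho> (?E e) (?E d) + ?h (?E e) (?E b) * ?\<rho> (?E a) (?E d)
          + ?h (?E e) (?E d) * ?\<rho> (?E a) (?E b) + ?h (?E a) (?E d) * ?\<rho> (?E e) (?E b))
        - ?l * (?h (?E a) (?E b) * ?h (?E e) (?E d) + ?h (?E e) (?E b) * ?h (?E a) (?E d)))
      - (?k * (?h (?E a) (J p (?E b)) * ?\<rho> (?E e) (J p (?E d)) + ?h (?E e) (J p (?E b)) * ?\<rho> (?E a) (J p (?E d))
          + ?h (?E e) (J p (?E d)) * ?\<rho> (?E a) (J p (?E b)) + ?h (?E a) (J p (?E d)) * ?\<rho> (?E e) (J p (?E b)))
        - ?l * (?h (?E a) (J p (?E b)) * ?h (?E e) (J p (?E d)) + ?h (?E e) (J p (?E b)) * ?h (?E a) (J p (?E d))))"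
    proof (rule bochner_real[OF lr _ _ inner_form.bil[OF inner_form_g[OF top]] g_J_J[OF top] bric _ linear_J[OF top] J_J[OF top] B])
      show "?r (J p x) (J p y) z u = ?r x y z u" "?r x y (J p z) (J p u) = ?r x y z u" for x y z u
        unfolding curv Jc by (simp_all add: C.Rm_J12[OF x'] C.Rm_J34[OF x'])
      show "?\<rho> (J p x) (J p y) = ?\<rho> x y" for x y
        unfolding ric Jc by (rule C.Ric_J[OF x'])
      fix \<alpha> \<beta> \<gamma> \<delta> assume "\<alpha> \<in> B" "\<beta> \<in> B" "\<gamma> \<in> B" "\<delta> \<in> B"
      from eq[THEN bspec, OF this(1), THEN bspec, OF this(2), THEN bspec, OF this(3), THEN bspec, OF this(4)]
      show "cext4 ?r \<alpha> (cnj_vec \<beta>) \<gamma> (cnj_vec \<delta>) =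
        of_real ?k * (cext2 ?h \<alpha> (cnj_vec \<beta>) * cext2 ?\<rho> \<gamma> (cnj_vec \<delta>) + cext2 ?h \<gamma> (cnj_vec \<beta>) * cext2 ?\<rho> \<alpha> (cnj_vec \<delta>)
          + cext2 ?h \<gamma> (cnj_vec \<delta>) * cext2 ?\<rho> \<alpha> (cnj_vec \<beta>) + cext2 ?h \<alpha> (cnj_vec \<delta>) * cext2 ?\<rho> \<gamma> (cnj_vec \<beta>))
        - of_real ?l * (cext2 ?h \<alpha> (cnj_vec \<beta>) * cext2 ?h \<gamma> (cnj_vec \<delta>) + cext2 ?h \<gamma> (cnj_vec \<beta>) * cext2 ?h \<alpha> (cnj_vec \<delta>))"
        by (simp add: Let_def)
    qed
    then show "C.Rm x a b e d - C.Rm x a (chart_J c x b) e (chart_J c x d) =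
      C.bochner_form n x a b e d - C.bochner_form n x a (chart_J c x b) e (chart_J c x d)"
      unfolding curv ric Jc scal g_chart[OF c p(2)] C.bochner_form_def
      using c p by simp
  qed
qed

text \<open>A zero derivative on a coordinate ball, which is convex, makes \<open>F\<close> constant
  there. So the set where \<open>F\<close> takes a given value and its complement are both open, and
  connectedness excludes a proper splitting.\<close>

lemma locally_constant_imp_constant_on:
  fixes F :: "'a \<Rightarrow> real"
  assumes conn: "connected_space M"
    and d: "\<And>c p. \<lbrakk>c \<in> A; p \<in> fst c\<rbrakk> \<Longrightarrow> ((\<lambda>x. F (chart_inv c x)) has_derivative (\<lambda>w. 0)) (at (snd c p))"
  shows "F constant_on topspace M"
proof (cases "topspace M = {}")
  case False
  have loc: "\<exists>V. openin M V \<and> p \<in> V \<and> (\<forall>q\<in>V. F q = F p)" if p: "p \<in> topspace M" for p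
  proof -
    obtain c where c: "c \<in> A" "p \<in> fst c" using p chart_cover by blast
    obtain r where r: "r > 0" "ball (snd c p) r \<subseteq> snd c ` fst c"
      using open_chart_range[OF c(1)] c open_contains_ball by blast
    let ?V = "{q \<in> fst c. snd c q \<in> ball (snd c p) r}"
    have "continuous_map (subtopology M (fst c)) (top_of_set (snd c ` fst c)) (snd c)"
      using chart_on[OF c(1)] homeomorphic_imp_continuous_map unfolding chart_on_def by blast
    then have "continuous_map (subtopology M (fst c)) euclidean (snd c)"
      using continuous_map_into_fulltopology by blast
    then have "openin (subtopology M (fst c)) {q \<in> topspace (subtopology M (fst c)). snd c q \<in> ball (snd c p) r}"
      by (rule openin_continuous_map_preimage) simp
    moreover have "topspace (subtopology M (fst c)) = fst c"
      using openin_subset[OF chart_open[OF c(1)]] by (simp add: Int_absorb1)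
    ultimately have "openin (subtopology M (fst c)) ?V"
      by (simp only:)
    then have o: "openin M ?V"
      using openin_trans_full chart_open[OF c(1)] by blast
    have "\<exists>k. \<forall>x\<in>ball (snd c p) r. F (chart_inv c x) = k"
    proof (rule has_derivative_zero_constant)
      fix x assume x: "x \<in> ball (snd c p) r"
      then obtain q where "x = snd c q" "q \<in> fst c" using r by blast
      then show "((\<lambda>x. F (chart_inv c x)) has_derivative (\<lambda>h. 0)) (at x within ball (snd c p) r)"
        using d[OF c(1)] has_derivative_at_withinI by blast
    qed simp
    then obtain k where k: "\<And>x. x \<in> ball (snd c p) r \<Longrightarrow> F (chart_inv c x) = k" by blast
    have "F q = k" if "q \<in> fst c" "snd c q \<in> ball (snd c p) r" for q
      using k[OF that(2)] c(1) that(1) by simp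
    then have "\<forall>q\<in>?V. F q = F p"
      using c(2) r(1) by simp
    moreover have "p \<in> ?V" using c(2) r(1) by simp
    ultimately show ?thesis using o by (intro exI[of _ ?V] conjI)
  qed
  from False obtain p0 where p0: "p0 \<in> topspace M" by blast
  \<comment> \<open>A general \<open>P\<close> serves the level set and its complement at
    once.\<close>
  have "openin M {q \<in> topspace M. P (F q)}" for P
  proof (subst openin_subopen, safe)
    fix q assume q: "q \<in> topspace M" "P (F q)"
    obtain V where V: "openin M V" "q \<in> V" and FV: "\<forall>q'\<in>V. F q' = F q" using loc[OF q(1)] by blast
    have "q' \<in> topspace M \<and> P (F q')" if "q' \<in> V" for q'
      using bspec[OF FV that] openin_subset[OF V(1)] that q(2) by auto
    then show "\<exists>T. openin M T \<and> q \<in> T \<and> T \<subseteq> {q \<in> topspace M. P (F q)}"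
      using V by blast
  qed
  note o = this[of "\<lambda>y. y = F p0"] this[of "\<lambda>y. y \<noteq> F p0"]
  have "{q \<in> topspace M. F q \<noteq> F p0} = {}"
    by (rule ccontr, rule connected_spaceD[OF conn o]) (use p0 in auto)
  then show ?thesis unfolding constant_on_def by blast
qed (simp add: constant_on_def)

end

theorem proposition4p2:
  fixes M :: "'a topology"
    and A :: "('a, 'm::finite) chart set"
    and g :: "'a \<Rightarrow> real^'m \<Rightarrow> real^'m \<Rightarrow> real"
    and J :: "'a \<Rightarrow> real^'m \<Rightarrow> real^'m"
    and nab :: "('a \<Rightarrow> real^'m) \<Rightarrow> ('a \<Rightarrow> real^'m) \<Rightarrow> 'a \<Rightarrow> real^'m"
    and n :: nat
  assumes dim: "CARD('m) = 2 * n" "2 * n \<ge> 4"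
    and conn: "connected_space M"
    and BK: "bochner_kaehler M A g J nab n"
  shows "(\<lambda>p. ricci_norm_squared A g nab p
              - (scalar_curvature A g nab p)\<^sup>2 / (2 * (real n + 1))
              + laplacian A g nab (scalar_curvature A g nab) p / (real n + 1))
         constant_on topspace M"
proof -
  interpret kaehler_mfd M A g J nab
    using BK by unfold_locales (simp add: bochner_kaehler_def)
  show ?thesis
  proof (rule locally_constant_imp_constant_on[OF conn])
    fix c p assume c: "c \<in> A" and p: "p \<in> fst c"
    interpret C: bochner_chart "snd c ` fst c" "chart_metric c" "christoffel c" "chart_J c" n
      by (rule bochner_chart[OF c dim BK])
    have x: "snd c p \<in> snd c ` fst c" using p by auto
    show "((\<lambda>x. ricci_norm_squared A g nab (chart_inv c x)
              - (scalar_curvature A g nab (chart_inv c x))\<^sup>2 / (2 * (real n + 1))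
              + laplacian A g nab (scalar_curvature A g nab) (chart_inv c x) / (real n + 1))
        has_derivative (\<lambda>w. 0)) (at (snd c p))"
    \<comment> \<open>The coordinate expression and the manifold expression agree on the whole chart
      image, which is open, so they share their derivative at each of its points.\<close>
    proof (rule has_derivative_transform_within_open[OF C.ddir_bochner_invariant[OF x] C.S x])
      fix y assume "y \<in> snd c ` fst c"
      then obtain q where q: "y = snd c q" "q \<in> fst c" by blast
      show "C.RicN y - (C.Scal y)\<^sup>2 / (2 * (real n + 1)) + C.Lap y / (real n + 1)
        = ricci_norm_squared A g nab (chart_inv c y)
              - (scalar_curvature A g nab (chart_inv c y))\<^sup>2 / (2 * (real n + 1))
              + laplacian A g nab (scalar_curvature A g nab) (chart_inv c y) / (real n + 1)"
        using q c laplacian_chart[OF c q(2) C.smooth_Scal scalar_curvature_chart[OF c]]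
        by (simp add: ricci_norm_chart[OF c q(2)] scalar_curvature_chart[OF c q(2)] C.RicN_def C.Lap_def C.Hess_def)
    qed
  qed
qed

end
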